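(* Let $1\leq q<\infty$, $r\in(0,1)$, $u\in B^r_{q,\infty}(\mathbb{R}^N,\mathbb{R}^d)$, let $E\subset\mathbb{R}^N$ be an $\mathcal{L}^N$-measurable set and let $\eta\in W^{1,1}(\mathbb{R}^N)$. For $\varepsilon>0$ put $u_\varepsilon(x):=\int_{\mathbb{R}^N}\eta(z)u(x-\varepsilon z)\,dz$. If the limit $$\lim_{\varepsilon\to 0^+}\int_{S^{N-1}}\int_E\chi_{E}(x+\varepsilon n)\frac{|u(x+\varepsilon n)-u(x)|^q}{\varepsilon^{rq}}\,dx\,d\mathcal{H}^{N-1}(n)$$ exists, then $$\lim_{\varepsilon\to 0^+}\frac{1}{|\ln\varepsilon|}\left[u_\varepsilon\right]^q_{W^{r,q}(E,\mathbb{R}^d)}=N\left|\int_{\mathbb{R}^N}\eta(z)dz\right|^q\lim_{\varepsilon\to 0^+}\int_{E}\frac{1}{\varepsilon^N}\int_{E\cap B_\varepsilon(x)}\frac{|u(x)-u(y)|^q}{|x-y|^{rq}}\,dy\,dx=N\left|\int_{\mathbb{R}^N}\eta(z)dz\right|^q[u]^q_{B^{r,q}(E,\mathbb{R}^d)}.$$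
   Context: $N,d$ are natural numbers ($\geq1$). $\mathcal{L}^N$ is Lebesgue measure on $\mathbb{R}^N$, $\mathcal{H}^{N-1}$ is $(N-1)$-dimensional Hausdorff measure, $S^{N-1}$ is the unit sphere in $\mathbb{R}^N$, $B_\varepsilon(x)$ is the open ball, $\chi_E$ is the characteristic function of $E$. For $1\leq q<\infty$, $r\in(0,1)$, the Besov space is $$B^r_{q,\infty}(\mathbb{R}^N,\mathbb{R}^d):=\Big\{u\in L^q(\mathbb{R}^N,\mathbb{R}^d):\sup_{h\in\mathbb{R}^N\setminus\{0\}}\int_{\mathbb{R}^N}\frac{|u(x+h)-u(x)|^q}{|h|^{rq}}dx<\infty\Big\}.$$ The Gagliardo seminorm on a measurable set $E\subset\mathbb{R}^N$ is $\left[u\right]_{W^{r,q}(E,\mathbb{R}^d)}:=\left(\int_{E}\int_{E}\frac{|u(x)-u(y)|^q}{|x-y|^{N+rq}}dx\,dy\right)^{1/q}$. The upper infinitesimal $B^{r,q}$-seminorm is $$[u]_{B^{r,q}(E,\mathbb{R}^d)}:=\limsup_{\varepsilon\to 0^+}\left(\int_{E}\frac{1}{\varepsilon^N}\int_{E\cap B_{\varepsilon}(x)}\frac{|u(x)-u(y)|^q}{|x-y|^{rq}}\,dy\,dx\right)^{1/q}.$$ $W^{1,1}(\mathbb{R}^N)$ is the usual Sobolev space of real-valued functions. *)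

theory Defs
  imports "HOL-Analysis.Analysis"
begin

(* Real powers with exponent p > 0 on [0,\<infinity>]. *)
definition enn_powr :: "ennreal \<Rightarrow> real \<Rightarrow> ennreal"
  where "enn_powr a p = (if a = \<infinity> then \<infinity> else ennreal (enn2real a powr p))"


section \<open>Hausdorff measure\<close>

(* The factor unit_ball_vol k / 2^k is the usual normalization of H^k.  The case distinction
   matters for k = 0, where H^0 is counting measure: a nonempty set counts 1 (even when its
   diameter is 0), the empty set counts 0. *)
definition hausdorff_gauge :: "nat \<Rightarrow> 'a::metric_space set \<Rightarrow> ennreal"
  where "hausdorff_gauge k C =
    (if C = {} then 0 else ennreal (unit_ball_vol (real k) * (diameter C / 2) ^ k))"

(* Boundedness is required because diameter is unspecified on unbounded sets. *)
definition hausdorff_pre :: "nat \<Rightarrow> real \<Rightarrow> 'a::metric_space set \<Rightarrow> ennreal"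
  where "hausdorff_pre k \<delta> A =
    (INF C \<in> {C :: nat \<Rightarrow> 'a set. A \<subseteq> (\<Union>j. C j) \<and> (\<forall>j. bounded (C j) \<and> diameter (C j) \<le> \<delta>)}.
       \<Sum>j. hausdorff_gauge k (C j))"

definition hausdorff_outer :: "nat \<Rightarrow> 'a::metric_space set \<Rightarrow> ennreal"
  where "hausdorff_outer k A = (SUP \<delta> \<in> {0<..}. hausdorff_pre k \<delta> A)"

(* H^k on its Caratheodory-measurable sets. *)
definition hausdorff_measure :: "nat \<Rightarrow> 'a::metric_space measure"
  where "hausdorff_measure k =
    measure_of UNIV (lambda_system UNIV (Pow UNIV) (hausdorff_outer k)) (hausdorff_outer k)"

lemma hausdorff_pre_empty:
  assumes "\<delta> > 0" shows "hausdorff_pre k \<delta> {} = 0"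
proof -
  have "hausdorff_pre k \<delta> ({}::'a set) \<le> (\<Sum>j. hausdorff_gauge k ((\<lambda>_::nat. {}::'a set) j))"
    unfolding hausdorff_pre_def using assms by (intro INF_lower) auto
  then show ?thesis by (simp add: hausdorff_gauge_def)
qed

lemma hausdorff_pre_mono: "A \<subseteq> B \<Longrightarrow> hausdorff_pre k \<delta> A \<le> hausdorff_pre k \<delta> B"
  unfolding hausdorff_pre_def by (intro INF_superset_mono) auto

lemma hausdorff_pre_UN:
  fixes A :: "nat \<Rightarrow> 'a::metric_space set"
  shows "hausdorff_pre k \<delta> (\<Union>i. A i) \<le> (\<Sum>i. hausdorff_pre k \<delta> (A i))"
proof (cases "(\<Sum>i. hausdorff_pre k \<delta> (A i)) = \<infinity>")
  case False
  then have fin: "hausdorff_pre k \<delta> (A i) < \<infinity>" for i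
    using ennreal_suminf_lessD[of "\<lambda>i. hausdorff_pre k \<delta> (A i)" \<infinity>] by (simp add: less_top)
  show ?thesis
  proof (rule ennreal_le_epsilon)
    fix e :: real assume e: "0 < e"
    have "\<exists>C. A i \<subseteq> (\<Union>j::nat. C j) \<and> (\<forall>j. bounded (C j) \<and> diameter (C j) \<le> \<delta>) \<and>
        (\<Sum>j. hausdorff_gauge k (C j)) < hausdorff_pre k \<delta> (A i) + ennreal (e * (1/2) ^ Suc i)" for i
    proof -
      have "hausdorff_pre k \<delta> (A i) < hausdorff_pre k \<delta> (A i) + ennreal (e * (1/2) ^ Suc i)"
        using fin[of i] e by (simp add: less_top[symmetric] ennreal_add_left_cancel_less)
      then show ?thesis
        unfolding hausdorff_pre_def[of k \<delta> "A i"] INF_less_iff by blast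
    qed
    then have "\<exists>C. \<forall>i. A i \<subseteq> (\<Union>j::nat. C i j) \<and>
        (\<forall>j. bounded (C i j) \<and> diameter (C i j) \<le> \<delta>) \<and>
        (\<Sum>j. hausdorff_gauge k (C i j)) < hausdorff_pre k \<delta> (A i) + ennreal (e * (1/2) ^ Suc i)"
      by (intro choice allI)
    then obtain C where C0: "\<forall>i. A i \<subseteq> (\<Union>j::nat. C i j) \<and>
        (\<forall>j. bounded (C i j) \<and> diameter (C i j) \<le> \<delta>) \<and>
        (\<Sum>j. hausdorff_gauge k (C i j)) < hausdorff_pre k \<delta> (A i) + ennreal (e * (1/2) ^ Suc i)" ..
    then have C: "A i \<subseteq> (\<Union>j. C i j)" "bounded (C i j) \<and> diameter (C i j) \<le> \<delta>" for i j
      by (simp_all only:)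
    have C3: "(\<Sum>j. hausdorff_gauge k (C i j))
        \<le> hausdorff_pre k \<delta> (A i) + ennreal (e * (1/2) ^ Suc i)" for i
      using C0 by (intro less_imp_le) (simp only:)
    define D where "D n = (case prod_decode n of (i, j) \<Rightarrow> C i j)" for n
    have "(\<Union>i. A i) \<subseteq> (\<Union>n. D n)"
    proof
      fix x assume "x \<in> (\<Union>i. A i)"
      then obtain i j where "x \<in> C i j" using C(1) by blast
      then have "x \<in> D (prod_encode (i, j))" by (simp add: D_def)
      then show "x \<in> (\<Union>n. D n)" by blast
    qed
    moreover have "bounded (D n) \<and> diameter (D n) \<le> \<delta>" for n
      using C(2) by (simp add: D_def split: prod.split)
    ultimately have "hausdorff_pre k \<delta> (\<Union>i. A i) \<le> (\<Sum>n. hausdorff_gauge k (D n))"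
      unfolding hausdorff_pre_def by (intro INF_lower) auto
    also have "\<dots> = (\<Sum>n. (\<lambda>(i, j). hausdorff_gauge k (C i j)) (prod_decode n))"
      by (simp add: D_def case_prod_unfold)
    also have "\<dots> = (\<Sum>i. \<Sum>j. hausdorff_gauge k (C i j))"
      using suminf_ennreal_2dimen[of "\<lambda>i. \<Sum>j. hausdorff_gauge k (C i j)"
          "\<lambda>(i, j). hausdorff_gauge k (C i j)"] by (simp add: comp_def)
    also have "\<dots> \<le> (\<Sum>i. hausdorff_pre k \<delta> (A i) + ennreal (e * (1/2) ^ Suc i))"
      by (intro suminf_le C3 summableI)
    also have "\<dots> = (\<Sum>i. hausdorff_pre k \<delta> (A i)) + (\<Sum>i. ennreal (e * (1/2) ^ Suc i))"
      by (simp add: suminf_add)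
    also have "(\<Sum>i. ennreal (e * (1/2) ^ Suc i)) = ennreal e"
      using sums_mult[OF power_half_series, of e] e
      by (intro suminf_ennreal_eq) auto
    finally show "hausdorff_pre k \<delta> (\<Union>i. A i) \<le> (\<Sum>i. hausdorff_pre k \<delta> (A i)) + ennreal e" .
  qed
qed simp

lemma outer_measure_space_hausdorff:
  "outer_measure_space (Pow UNIV) (hausdorff_outer k :: 'a::metric_space set \<Rightarrow> ennreal)"
  (is "outer_measure_space _ ?\<mu>")
  unfolding outer_measure_space_def
proof (intro conjI)
  show "positive (Pow UNIV) ?\<mu>"
    by (auto simp: positive_def hausdorff_outer_def hausdorff_pre_empty)
  show "increasing (Pow UNIV) ?\<mu>"
    by (auto simp: increasing_def hausdorff_outer_def intro!: SUP_mono' hausdorff_pre_mono)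
  show "countably_subadditive (Pow UNIV) ?\<mu>"
    unfolding countably_subadditive_def
  proof (intro allI impI)
    fix A :: "nat \<Rightarrow> 'a set"
    assume "range A \<subseteq> Pow UNIV"
    show "hausdorff_outer k (\<Union> (range A)) \<le> (\<Sum>i. hausdorff_outer k (A i))"
      unfolding hausdorff_outer_def[of k "\<Union> (range A)"]
    proof (rule SUP_least)
      fix \<delta> :: real assume d: "\<delta> \<in> {0<..}"
      have "hausdorff_pre k \<delta> (\<Union> (range A)) \<le> (\<Sum>i. hausdorff_pre k \<delta> (A i))"
        by (rule hausdorff_pre_UN)
      also have "\<dots> \<le> (\<Sum>i. hausdorff_outer k (A i))"
        unfolding hausdorff_outer_def using d by (intro suminf_le SUP_upper) auto
      finally show "hausdorff_pre k \<delta> (\<Union> (range A)) \<le> (\<Sum>i. hausdorff_outer k (A i))" .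
    qed
  qed
qed

lemma
  fixes A :: "'a::metric_space set"
  shows sets_hausdorff_measure:
      "sets (hausdorff_measure k :: 'a measure) =
        lambda_system UNIV (Pow UNIV) (hausdorff_outer k)"
    and emeasure_hausdorff_measure:
      "A \<in> sets (hausdorff_measure k) \<Longrightarrow> emeasure (hausdorff_measure k) A = hausdorff_outer k A"
proof -
  interpret sigma_algebra UNIV "Pow UNIV :: 'a set set" by (rule sigma_algebra_Pow)
  have ms: "measure_space UNIV (lambda_system UNIV (Pow UNIV :: 'a set set) (hausdorff_outer k))
      (hausdorff_outer k)"
    by (rule caratheodory_lemma[OF outer_measure_space_hausdorff])
  then interpret L: sigma_algebra UNIV "lambda_system UNIV (Pow UNIV :: 'a set set) (hausdorff_outer k)"
    by (simp add: measure_space_def)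
  show *: "sets (hausdorff_measure k :: 'a measure) = lambda_system UNIV (Pow UNIV) (hausdorff_outer k)"
    unfolding hausdorff_measure_def by (rule L.sets_measure_of_eq)
  show "emeasure (hausdorff_measure k) A = hausdorff_outer k A" if "A \<in> sets (hausdorff_measure k)"
    using that ms unfolding * unfolding hausdorff_measure_def measure_space_def
    by (intro emeasure_measure_of_sigma) auto
qed


section \<open>The Sobolev space \<open>W\<^sup>1\<^sup>,\<^sup>1\<close>\<close>

definition partial_deriv :: "'a::euclidean_space \<Rightarrow> ('a \<Rightarrow> real) \<Rightarrow> 'a \<Rightarrow> real"
  where "partial_deriv i f x = frechet_derivative f (at x) i"

(* Functions of class C^k on the whole space. *)
primrec C_k :: "nat \<Rightarrow> ('a::euclidean_space \<Rightarrow> real) \<Rightarrow> bool"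
  where
    "C_k 0 f = continuous_on UNIV f"
  | "C_k (Suc k) f = (f differentiable_on UNIV \<and> (\<forall>i\<in>Basis. C_k k (partial_deriv i f)))"

definition test_fun :: "('a::euclidean_space \<Rightarrow> real) \<Rightarrow> bool"
  where "test_fun \<phi> \<longleftrightarrow> (\<forall>k. C_k k \<phi>) \<and> compact (closure {x. \<phi> x \<noteq> 0})"

definition weak_partial_deriv ::
    "'a::euclidean_space \<Rightarrow> ('a \<Rightarrow> real) \<Rightarrow> ('a \<Rightarrow> real) \<Rightarrow> bool"
  where "weak_partial_deriv i f g \<longleftrightarrow>
    (\<forall>\<phi>. test_fun \<phi> \<longrightarrow>
      (LINT x|lebesgue. f x * partial_deriv i \<phi> x) = - (LINT x|lebesgue. g x * \<phi> x))"

definition sobolev_W11 :: "('a::euclidean_space \<Rightarrow> real) set"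
  where "sobolev_W11 = {f. integrable lebesgue f \<and>
    (\<forall>i\<in>Basis. \<exists>g. integrable lebesgue g \<and> weak_partial_deriv i f g)}"


section \<open>Besov space and seminorms\<close>

definition besov_space :: "real \<Rightarrow> real \<Rightarrow> ('a::euclidean_space \<Rightarrow> 'b::euclidean_space) set"
  where "besov_space r q = {u. u \<in> borel_measurable lebesgue \<and>
    (\<integral>\<^sup>+x. ennreal (norm (u x) powr q) \<partial>lebesgue) < \<infinity> \<and>
    (SUP h \<in> UNIV - {0}.
      \<integral>\<^sup>+x. ennreal (norm (u (x + h) - u x) powr q / norm h powr (r * q)) \<partial>lebesgue) < \<infinity>}"

(* Here and below the integrand is 0 on the diagonal x = y (0 / 0 = 0), a null set. *)
definition gagliardo_seminorm ::
    "real \<Rightarrow> real \<Rightarrow> 'a::euclidean_space set \<Rightarrow> ('a \<Rightarrow> 'b::euclidean_space) \<Rightarrow> ennreal"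
  where "gagliardo_seminorm r q E u =
    enn_powr (\<integral>\<^sup>+y\<in>E. (\<integral>\<^sup>+x\<in>E.
        ennreal (norm (u x - u y) powr q / norm (x - y) powr (real DIM('a) + r * q))
      \<partial>lebesgue) \<partial>lebesgue) (1 / q)"

definition ball_functional ::
    "real \<Rightarrow> real \<Rightarrow> 'a::euclidean_space set \<Rightarrow> ('a \<Rightarrow> 'b::euclidean_space) \<Rightarrow> real \<Rightarrow> ennreal"
  where "ball_functional r q E u \<epsilon> =
    (\<integral>\<^sup>+x\<in>E. (ennreal (1 / \<epsilon> ^ DIM('a)) * (\<integral>\<^sup>+y\<in>E \<inter> ball x \<epsilon>.
        ennreal (norm (u x - u y) powr q / norm (x - y) powr (r * q))
      \<partial>lebesgue)) \<partial>lebesgue)"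

definition upper_B_seminorm ::
    "real \<Rightarrow> real \<Rightarrow> 'a::euclidean_space set \<Rightarrow> ('a \<Rightarrow> 'b::euclidean_space) \<Rightarrow> ennreal"
  where "upper_B_seminorm r q E u =
    Limsup (at_right 0) (\<lambda>\<epsilon>. enn_powr (ball_functional r q E u \<epsilon>) (1 / q))"

definition sphere_functional ::
    "real \<Rightarrow> real \<Rightarrow> 'a::euclidean_space set \<Rightarrow> ('a \<Rightarrow> 'b::euclidean_space) \<Rightarrow> real \<Rightarrow> ennreal"
  where "sphere_functional r q E u \<epsilon> =
    (\<integral>\<^sup>+n\<in>sphere 0 1. (\<integral>\<^sup>+x\<in>E.
        ennreal (indicat_real E (x + \<epsilon> *\<^sub>R n) *
          (norm (u (x + \<epsilon> *\<^sub>R n) - u x) powr q / \<epsilon> powr (r * q)))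
      \<partial>lebesgue) \<partial>hausdorff_measure (DIM('a) - 1))"

(* For u in L^q and \<eta> in L^1 the integrand is integrable for almost every x (Young);
   elsewhere the Bochner integral takes the value 0. *)
definition rescaled_conv ::
    "('a::euclidean_space \<Rightarrow> real) \<Rightarrow> ('a \<Rightarrow> 'b::euclidean_space) \<Rightarrow> real \<Rightarrow> 'a \<Rightarrow> 'b"
  where "rescaled_conv \<eta> u \<epsilon> x = (LINT z|lebesgue. \<eta> z *\<^sub>R u (x - \<epsilon> *\<^sub>R z))"

end

theory Submission
  imports Defs "HOL-Computational_Algebra.Polynomial"
begin

text \<open>
  Write \<open>N\<close> for the dimension, \<open>p = r q\<close>, and \<open>D(v, h)\<close> for the integral of
  \<open>|v(x + h) - v(x)|\<^sup>q\<close> over all \<open>x\<close> with \<open>x\<close> and \<open>x + h\<close> in \<open>E\<close> (\<open>pair_energy\<close>).  By Tonelli, each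
  functional of \<open>u\<close> in the theorem is an integral of \<open>D\<close> with a radial weight: the sphere functional \<open>S(\<rho>)\<close>
  integrates \<open>\<rho>\<^sup>-\<^sup>p D(u, \<rho> n)\<close> over the unit vectors \<open>n\<close>, the ball functional has the weight
  \<open>\<epsilon>\<^sup>-\<^sup>N |h|\<^sup>-\<^sup>p\<close> on \<open>|h| < \<epsilon>\<close>, and the \<open>q\<close>-th power of the Gagliardo seminorm has the weight
  \<open>|h|\<^sup>-\<^sup>N\<^sup>-\<^sup>p\<close>.  In polar coordinates, with some constant \<open>\<kappa> > 0\<close>, the ball functional is \<open>\<kappa>\<close> times the
  integral of \<open>t\<^sup>N\<^sup>-\<^sup>1 S(t \<epsilon>)\<close> over \<open>0 < t < 1\<close>, so \<open>S \<rightarrow> L\<close> makes it converge to \<open>\<kappa> L / N\<close>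
  (\<open>ball_energy_lim\<close>).  The part \<open>\<epsilon> < |h| < 1\<close> of the Gagliardo integral of \<open>u\<close> is \<open>\<kappa>\<close> times the integral
  of \<open>S(\<rho>) / \<rho>\<close> over \<open>\<epsilon> < \<rho> < 1\<close>, which is asymptotic to \<open>\<kappa> L |ln \<epsilon>|\<close> (\<open>log_average_at_0\<close>).  The quotient
  \<open>N\<close> of these two limits is the constant in the theorem, and \<open>\<kappa>\<close> cancels.

  It remains to pass from \<open>u\<close> to its mollification \<open>u\<^sub>\<epsilon>\<close>.  Let \<open>m\<close> be the integral of \<open>\<eta>\<close>; three scales of
  \<open>h\<close> behave differently.

  \<^item> For \<open>|h| > \<epsilon>\<close> the function \<open>u\<^sub>\<epsilon>\<close> is close to \<open>m u\<close>: the increment of \<open>u\<^sub>\<epsilon> - m u\<close> is a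
    superposition of second order increments of \<open>u\<close>, of size \<open>min |h| (\<epsilon> |z|)\<close> to the power \<open>r\<close>.  After
    division by \<open>|h|\<^sup>p\<close> the \<open>L\<^sup>q\<close> error is at most a multiple of \<open>tail (|h| / \<epsilon>)\<close>, where \<open>tail\<close> vanishes at
    infinity by dominated convergence (\<open>Lq_powr_fdiff_error\<close>, \<open>tail_tendsto_0\<close>).  The logarithmic average of
    such a term tends to \<open>0\<close> (\<open>log_average_tail\<close>).
  \<^item> For \<open>|h| \<le> \<epsilon>\<close> the smoothness of \<open>\<eta>\<close> enters.  The second difference of \<open>u\<^sub>\<epsilon>\<close> puts one difference on
    \<open>\<eta>\<close>, which costs \<open>|h| / \<epsilon>\<close> because \<open>\<eta>\<close> is in \<open>W\<^sup>1\<^sup>,\<^sup>1\<close>, and one on \<open>u\<close>.  A dyadic iteration (Marchaud's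
    inequality) recovers a first difference that gains a positive power of \<open>|h| / \<epsilon>\<close>
    (\<open>Lq_powr_fdiff_mollify_small\<close>).  This scale therefore contributes a bounded amount.
  \<^item> For \<open>|h| \<ge> 1\<close> the weight is integrable and the contribution is bounded.

  After division by \<open>|ln \<epsilon>|\<close> only the annulus survives.  Comparison of \<open>q\<close>-th powers costs a factor
  \<open>(1 - \<delta>)\<^sup>1\<^sup>-\<^sup>q\<close> in front of the main term and \<open>\<delta>\<^sup>1\<^sup>-\<^sup>q\<close> in front of the error, and \<open>\<delta>\<close> is sent to \<open>0\<close> last
  (\<open>tendsto_of_split_bounds\<close>).

  Polar coordinates for the Hausdorff measure come from a uniqueness theorem: two finite measures on a compact
  set are proportional if, for each of them, all balls of equal radius centred in the set have equal measure (\<open>uniformly_distributed_eq\<close>).  It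
  applies on the sphere to the cone measure, for which polar coordinates are elementary, and to the Hausdorff
  measure, which is positive and finite there (\<open>hausdorff_outer_sphere_pos\<close>,
  \<open>hausdorff_outer_sphere_finite\<close>).
\<close>

section \<open>Hausdorff measure: Borel sets and isometries\<close>

lemma hausdorff_outer_empty: "hausdorff_outer k {} = 0"
  by (simp add: hausdorff_outer_def hausdorff_pre_empty)

lemma hausdorff_outer_mono: "A \<subseteq> B \<Longrightarrow> hausdorff_outer k A \<le> hausdorff_outer k B"
  unfolding hausdorff_outer_def by (auto intro!: SUP_mono' hausdorff_pre_mono)

lemma hausdorff_outer_UN:
  fixes A :: "nat \<Rightarrow> 'a::metric_space set"
  shows "hausdorff_outer k (\<Union>i. A i) \<le> (\<Sum>i. hausdorff_outer k (A i))"
  unfolding hausdorff_outer_def[of k "\<Union> (range A)"]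
proof (rule SUP_least)
  fix \<delta> :: real assume d: "\<delta> \<in> {0<..}"
  have "hausdorff_pre k \<delta> (\<Union> (range A)) \<le> (\<Sum>i. hausdorff_pre k \<delta> (A i))"
    by (rule hausdorff_pre_UN)
  also have "\<dots> \<le> (\<Sum>i. hausdorff_outer k (A i))"
    unfolding hausdorff_outer_def using d by (intro suminf_le SUP_upper) auto
  finally show "hausdorff_pre k \<delta> (\<Union> (range A)) \<le> (\<Sum>i. hausdorff_outer k (A i))" .
qed

lemma hausdorff_outer_Un:
  fixes A B :: "'a::metric_space set"
  shows "hausdorff_outer k (A \<union> B) \<le> hausdorff_outer k A + hausdorff_outer k B"
proof -
  define C where "C i = (if i = 0 then A else if i = Suc 0 then B else {})" for i :: nat
  have "A \<subseteq> C 0" "B \<subseteq> C 1" by (simp_all add: C_def)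
  then have "A \<union> B \<subseteq> (\<Union>i. C i)" by blast
  then have "hausdorff_outer k (A \<union> B) \<le> hausdorff_outer k (\<Union>i. C i)"
    by (rule hausdorff_outer_mono)
  also have "\<dots> \<le> (\<Sum>i. hausdorff_outer k (C i))"
    by (rule hausdorff_outer_UN)
  also have "\<dots> = (\<Sum>i\<in>{0, Suc 0}. hausdorff_outer k (C i))"
    by (rule suminf_finite) (simp_all add: C_def hausdorff_outer_empty)
  also have "\<dots> = hausdorff_outer k A + hausdorff_outer k B"
    by (simp add: C_def)
  finally show ?thesis .
qed

lemma hausdorff_pre_antimono: "\<delta> \<le> \<delta>' \<Longrightarrow> hausdorff_pre k \<delta>' A \<le> hausdorff_pre k \<delta> A"
  unfolding hausdorff_pre_def by (intro INF_superset_mono) (auto intro: order_trans)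

text \<open>A set of diameter at most \<open>\<delta>\<close> meets only one of two sets that are further than \<open>\<delta>\<close> apart, so a cover of the union splits into two covers.\<close>

lemma hausdorff_pre_Un_separated:
  fixes A B :: "'a::metric_space set"
  assumes sep: "\<And>x y. x \<in> A \<Longrightarrow> y \<in> B \<Longrightarrow> \<delta> < dist x y"
  shows "hausdorff_pre k \<delta> A + hausdorff_pre k \<delta> B \<le> hausdorff_pre k \<delta> (A \<union> B)"
  unfolding hausdorff_pre_def[of k \<delta> "A \<union> B"]
proof (rule INF_greatest)
  fix C :: "nat \<Rightarrow> 'a set"
  assume "C \<in> {C. A \<union> B \<subseteq> (\<Union>j. C j) \<and> (\<forall>j. bounded (C j) \<and> diameter (C j) \<le> \<delta>)}"
  then have C: "A \<union> B \<subseteq> (\<Union>j. C j)" "\<And>j. bounded (C j)" "\<And>j. diameter (C j) \<le> \<delta>"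
    by auto
  define P where "P D j = (if C j \<inter> D = {} then {} else C j)" for D :: "'a set" and j
  have cov: "hausdorff_pre k \<delta> D \<le> (\<Sum>j. hausdorff_gauge k (P D j))" if D: "D \<subseteq> (\<Union>j. C j)" for D
  proof (cases "\<delta> \<ge> 0")
    case True
    show ?thesis unfolding hausdorff_pre_def
    proof (rule INF_lower, safe)
      fix x assume "x \<in> D"
      with D obtain j where "x \<in> C j" by auto
      with \<open>x \<in> D\<close> show "x \<in> (\<Union>j. P D j)" by (auto simp: P_def)
    qed (use C True in \<open>auto simp: P_def\<close>)
  next
    case False
    then show ?thesis using C(3)[of 0] diameter_ge_0[OF C(2)[of 0]] by simp
  qed
  have one: "hausdorff_gauge k (P A j) + hausdorff_gauge k (P B j) \<le> hausdorff_gauge k (C j)" for j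
  proof -
    have "C j \<inter> A = {} \<or> C j \<inter> B = {}"
    proof (rule ccontr)
      assume "\<not> ?thesis"
      then obtain x y where xy: "x \<in> C j" "x \<in> A" "y \<in> C j" "y \<in> B" by auto
      then have "dist x y \<le> \<delta>"
        using diameter_bounded_bound[OF C(2)[of j] xy(1,3)] C(3)[of j] by simp
      with sep xy show False by fastforce
    qed
    then show ?thesis by (auto simp: P_def hausdorff_gauge_def)
  qed
  have "hausdorff_pre k \<delta> A + hausdorff_pre k \<delta> B
      \<le> (\<Sum>j. hausdorff_gauge k (P A j)) + (\<Sum>j. hausdorff_gauge k (P B j))"
    using C(1) by (intro add_mono cov) auto
  also have "\<dots> = (\<Sum>j. hausdorff_gauge k (P A j) + hausdorff_gauge k (P B j))"
    by (simp add: suminf_add)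
  also have "\<dots> \<le> (\<Sum>j. hausdorff_gauge k (C j))"
    by (intro suminf_le one summableI)
  finally show "hausdorff_pre k \<delta> A + hausdorff_pre k \<delta> B \<le> (\<Sum>j. hausdorff_gauge k (C j))" .
qed

lemma hausdorff_outer_Un_separated:
  fixes A B :: "'a::metric_space set"
  assumes "0 < d" and sep: "\<And>x y. x \<in> A \<Longrightarrow> y \<in> B \<Longrightarrow> d \<le> dist x y"
  shows "hausdorff_outer k A + hausdorff_outer k B \<le> hausdorff_outer k (A \<union> B)"
proof -
  have *: "hausdorff_pre k s A + hausdorff_pre k t B \<le> hausdorff_outer k (A \<union> B)"
    if "0 < s" "0 < t" for s t
  proof -
    define \<delta> where "\<delta> = min (min s t) (d / 2)"
    have \<delta>: "0 < \<delta>" "\<delta> \<le> s" "\<delta> \<le> t" "\<delta> < d"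
      using that \<open>0 < d\<close> by (auto simp: \<delta>_def)
    have "hausdorff_pre k s A + hausdorff_pre k t B \<le> hausdorff_pre k \<delta> A + hausdorff_pre k \<delta> B"
      by (intro add_mono hausdorff_pre_antimono \<delta>)
    also have "\<dots> \<le> hausdorff_pre k \<delta> (A \<union> B)"
      using sep \<delta> by (intro hausdorff_pre_Un_separated) fastforce
    also have "\<dots> \<le> hausdorff_outer k (A \<union> B)"
      unfolding hausdorff_outer_def using \<delta> by (intro SUP_upper) auto
    finally show ?thesis .
  qed
  have ne: "{0<..} \<noteq> ({} :: real set)" by (simp add: ex_in_conv[symmetric] gt_ex)
  have "hausdorff_outer k A + hausdorff_outer k B =
      (SUP s\<in>{0<..}. SUP t\<in>{0<..}. hausdorff_pre k s A + hausdorff_pre k t B)"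
    unfolding hausdorff_outer_def
    by (simp add: ennreal_SUP_add_left[OF ne, symmetric] ennreal_SUP_add_right[OF ne, symmetric])
  also have "\<dots> \<le> hausdorff_outer k (A \<union> B)"
    by (intro SUP_least *) auto
  finally show ?thesis .
qed

lemma sum_hausdorff_outer_separated:
  fixes R :: "nat \<Rightarrow> 'a::metric_space set"
  assumes sep: "\<And>n. \<exists>d>0. \<forall>k<n. \<forall>x\<in>R k. \<forall>y\<in>R n. d \<le> dist x y"
  shows "(\<Sum>i<n. hausdorff_outer k (R i)) \<le> hausdorff_outer k (\<Union>i<n. R i)"
proof (induction n)
  case (Suc n)
  obtain d where d: "d > 0" "\<And>k x y. k < n \<Longrightarrow> x \<in> R k \<Longrightarrow> y \<in> R n \<Longrightarrow> d \<le> dist x y"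
    using sep[of n] by blast
  have "(\<Sum>i<Suc n. hausdorff_outer k (R i)) \<le> hausdorff_outer k (\<Union>i<n. R i) + hausdorff_outer k (R n)"
    using Suc.IH by (simp add: add_right_mono)
  also have "\<dots> \<le> hausdorff_outer k ((\<Union>i<n. R i) \<union> R n)"
    using d by (intro hausdorff_outer_Un_separated[of d]) auto
  also have "(\<Union>i<n. R i) \<union> R n = (\<Union>i<Suc n. R i)"
    by (auto simp: less_Suc_eq)
  finally show ?case .
qed (simp add: hausdorff_outer_empty)

text \<open>In the next proof only shells of the same parity are separated, so the series over all shells is treated in two halves.\<close>

lemma suminf_even_odd_ennreal:
  fixes f :: "nat \<Rightarrow> ennreal"
  shows "(\<Sum>n. f n) = (\<Sum>n. f (2 * n)) + (\<Sum>n. f (2 * n + 1))"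
proof -
  have "f sums ((\<Sum>n. f (2 * n)) + (\<Sum>n. f (2 * n + 1)))"
  proof -
    have "(\<lambda>n. \<Sum>i<n. f i) \<longlonglongrightarrow> suminf f" by (simp add: summable_LIMSEQ)
    then have 1: "(\<lambda>n. \<Sum>i<2 * n. f i) \<longlonglongrightarrow> suminf f"
      by (rule filterlim_compose) (auto intro!: filterlim_subseq simp: strict_mono_def)
    have "(\<Sum>i<2 * n. f i) = (\<Sum>i<n. f (2 * i)) + (\<Sum>i<n. f (2 * i + 1))" for n
      by (induction n) (auto simp: algebra_simps)
    with 1 have 1: "(\<lambda>n. (\<Sum>i<n. f (2 * i)) + (\<Sum>i<n. f (2 * i + 1))) \<longlonglongrightarrow> suminf f"
      by simp
    have 2: "(\<lambda>n. (\<Sum>i<n. f (2 * i)) + (\<Sum>i<n. f (2 * i + 1))) \<longlonglongrightarrow>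
        (\<Sum>n. f (2 * n)) + (\<Sum>n. f (2 * n + 1))"
      by (intro tendsto_add summable_LIMSEQ summableI)
    show ?thesis using LIMSEQ_unique[OF 1 2] summable_sums[OF summableI, of f] by simp
  qed
  then show ?thesis by (simp add: sums_iff)
qed

text \<open>Caratheodory's criterion for metric outer measures: outside \<open>F\<close> the test set \<open>T\<close> is exhausted by the parts \<open>Q n\<close> at
  distance at least \<open>a n\<close> from \<open>F\<close>, which are separated from \<open>T \<inter> F\<close>.  The remainder of \<open>T - F\<close> is covered by thin shells
  \<open>R i\<close>; their measures are summable, since shells of equal parity are separated from each other, so the remainder vanishes
  in the limit.\<close>

lemma closed_in_lambda_system_hausdorff:
  fixes F :: "'a::metric_space set"
  assumes "closed F"
  shows "F \<in> lambda_system UNIV (Pow UNIV) (hausdorff_outer k)"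
proof (cases "F = {}")
  case True
  interpret sigma_algebra UNIV "Pow UNIV :: 'a set set" by (rule sigma_algebra_Pow)
  show ?thesis unfolding True
    using lambda_system_empty outer_measure_space_hausdorff[where 'a='a]
    by (auto simp: outer_measure_space_def)
next
  case False
  let ?H = "hausdorff_outer k :: 'a set \<Rightarrow> ennreal"
  interpret sigma_algebra UNIV "Pow UNIV :: 'a set set" by (rule sigma_algebra_Pow)
  have "?H (T \<inter> F) + ?H (T - F) \<le> ?H T" for T
  proof (cases "?H T = \<infinity>")
    case finT: False
    define a where "a n = 1 / (real n + 1)" for n
    have a: "a n > 0" "m < n \<Longrightarrow> a n < a m" for m n
      by (auto simp: a_def frac_less2)
    have a': "m \<le> n \<Longrightarrow> a n \<le> a m" for m n
      using a(2)[of m n] by (cases "m = n") auto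
    have lip: "infdist x F \<le> infdist y F + dist x y" for x y
      by (rule infdist_triangle)
    define Q where "Q n = {x \<in> T. a n \<le> infdist x F}" for n
    define R where "R n = {x \<in> T. a (Suc n) \<le> infdist x F \<and> infdist x F < a n}" for n
    have sepQ: "?H (T \<inter> F) + ?H (Q n) \<le> ?H T" for n
    proof -
      have "?H (T \<inter> F) + ?H (Q n) \<le> ?H ((T \<inter> F) \<union> Q n)"
      proof (rule hausdorff_outer_Un_separated[OF a(1)[of n]])
        fix x y assume "x \<in> T \<inter> F" "y \<in> Q n"
        then show "a n \<le> dist x y" using lip[of y x] by (auto simp: Q_def dist_commute)
      qed
      also have "\<dots> \<le> ?H T" by (rule hausdorff_outer_mono) (auto simp: Q_def)
      finally show ?thesis .
    qed
    have sepR: "(\<Sum>i. ?H (R (2 * i + p))) \<le> ?H T" for p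
    proof (rule suminf_le_const[OF summableI])
      fix n
      have "(\<Sum>i<n. ?H (R (2 * i + p))) \<le> ?H (\<Union>i<n. R (2 * i + p))"
      proof (rule sum_hausdorff_outer_separated)
        fix n
        show "\<exists>d>0. \<forall>k<n. \<forall>x\<in>R (2 * k + p). \<forall>y\<in>R (2 * n + p). d \<le> dist x y"
        proof (cases "n = 0")
          case True
          then show ?thesis by (auto intro: exI[of _ 1])
        next
          case False
          define m where "m = 2 * n + p - 1"
          have m: "2 * n + p = Suc m" using False by (simp add: m_def)
          show ?thesis
          proof (intro exI conjI allI impI ballI)
            show "a m - a (Suc m) > 0" using a(2)[of m "Suc m"] by simp
            fix k x y assume k: "k < n" "x \<in> R (2 * k + p)" "y \<in> R (2 * n + p)"
            have "a m \<le> a (Suc (2 * k + p))" using k(1) by (intro a') (simp add: m_def)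
            with k(2,3) lip[of x y] show "a m - a (Suc m) \<le> dist x y"
              by (auto simp: R_def m)
          qed
        qed
      qed
      also have "\<dots> \<le> ?H T" by (rule hausdorff_outer_mono) (auto simp: R_def)
      finally show "(\<Sum>i<n. ?H (R (2 * i + p))) \<le> ?H T" .
    qed
    have "(\<Sum>i. ?H (R i)) \<le> ?H T + ?H T"
      unfolding suminf_even_odd_ennreal[of "\<lambda>i. ?H (R i)"]
      using sepR[of 0] sepR[of 1] by (intro add_mono) auto
    also have "\<dots> < \<infinity>" using finT by (simp add: less_top[symmetric])
    finally have finR: "(\<Sum>i. ?H (R i)) \<noteq> \<infinity>" by simp
    have sub: "?H (T - F) \<le> ?H (Q n) + (\<Sum>i. ?H (R (i + n)))" for n
    proof -
      have "T - F \<subseteq> Q n \<union> (\<Union>i. R (i + n))"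
      proof
        fix x assume x: "x \<in> T - F"
        then have pos: "infdist x F > 0"
          using infdist_pos_not_in_closed[OF assms False] by auto
        have "a \<longlonglongrightarrow> 0" unfolding a_def
          by (rule real_tendsto_divide_at_top[OF tendsto_const])
             (auto intro!: filterlim_tendsto_add_at_top filterlim_real_sequentially simp: add.commute)
        then obtain j where j: "a j \<le> infdist x F"
          using order_tendstoD(2)[of a 0 sequentially "infdist x F"] pos
          by (auto simp: eventually_sequentially intro: less_imp_le)
        define l where "l = (LEAST j. a j \<le> infdist x F)"
        have l: "a l \<le> infdist x F" unfolding l_def by (rule LeastI[of _ j]) fact
        show "x \<in> Q n \<union> (\<Union>i. R (i + n))"
        proof (cases "l \<le> n")
          case True
          then show ?thesis using a'[OF True] l x by (auto simp: Q_def)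
        next
          case False
          then obtain i where i: "l = Suc (i + n)" by (metis add.commute less_iff_Suc_add not_le)
          have "\<not> a (i + n) \<le> infdist x F"
            using not_less_Least[of "i + n" "\<lambda>j. a j \<le> infdist x F"] i by (simp add: l_def[symmetric])
          then have "x \<in> R (i + n)" using l i x by (auto simp: R_def)
          then show ?thesis by auto
        qed
      qed
      then have "?H (T - F) \<le> ?H (Q n \<union> (\<Union>i. R (i + n)))"
        by (rule hausdorff_outer_mono)
      also have "\<dots> \<le> ?H (Q n) + ?H (\<Union>i. R (i + n))"
        by (rule hausdorff_outer_Un)
      also have "\<dots> \<le> ?H (Q n) + (\<Sum>i. ?H (R (i + n)))"
        by (intro add_left_mono hausdorff_outer_UN)
      finally show ?thesis .
    qed
    show "?H (T \<inter> F) + ?H (T - F) \<le> ?H T"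
    proof (rule LIMSEQ_le_const)
      show "(\<lambda>n. ?H T + (\<Sum>i. ?H (R (i + n)))) \<longlonglongrightarrow> ?H T"
      proof -
        have "(\<lambda>n. ?H T + (\<Sum>i. ?H (R (i + n)))) \<longlonglongrightarrow> ?H T + 0"
        proof (intro tendsto_add tendsto_const)
          define e where "e i = enn2real (?H (R i))" for i
          have fin: "?H (R i) \<noteq> \<infinity>" for i
            using finR ennreal_suminf_lessD[of "\<lambda>i. ?H (R i)" \<infinity>] by (simp add: less_top)
          have e: "?H (R i) = ennreal (e i)" "e i \<ge> 0" for i
            using fin[of i] by (simp_all add: e_def less_top)
          have se: "summable e"
            using finR e by (intro summable_suminf_not_top) auto
          have "(\<Sum>i. ?H (R (i + n))) = ennreal (\<Sum>i. e (i + n))" for n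
            unfolding e(1) by (rule suminf_ennreal2) (auto simp: e(2) summable_iff_shift se)
          moreover have "(\<lambda>n. ennreal (\<Sum>i. e (i + n))) \<longlonglongrightarrow> ennreal 0"
            by (intro tendsto_ennrealI suminf_exist_split2 se)
          ultimately show "(\<lambda>n. \<Sum>i. ?H (R (i + n))) \<longlonglongrightarrow> 0" by simp
        qed
        then show ?thesis by simp
      qed
      have "?H (T \<inter> F) + ?H (T - F) \<le> ?H T + (\<Sum>i. ?H (R (i + n)))" for n
      proof -
        have "?H (T \<inter> F) + ?H (T - F) \<le> ?H (T \<inter> F) + (?H (Q n) + (\<Sum>i. ?H (R (i + n))))"
          by (intro add_left_mono sub)
        also have "\<dots> \<le> ?H T + (\<Sum>i. ?H (R (i + n)))"
          using add_right_mono[OF sepQ[of n]] by (simp add: add.assoc)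
        finally show ?thesis .
      qed
      then show "\<exists>N. \<forall>n\<ge>N. ?H (T \<inter> F) + ?H (T - F) \<le> ?H T + (\<Sum>i. ?H (R (i + n)))" by blast
    qed
  qed simp
  moreover have "?H T \<le> ?H (T \<inter> F) + ?H (T - F)" for T
    using hausdorff_outer_Un[of k "T \<inter> F" "T - F"] by (simp add: Un_Diff_Int Int_Diff_Un)
  ultimately show ?thesis
    unfolding lambda_system_eq by (auto intro: antisym)
qed

lemma borel_subset_sets_hausdorff:
  "sets (borel :: 'a::metric_space measure) \<subseteq> sets (hausdorff_measure k)"
proof -
  have sp: "space (hausdorff_measure k :: 'a measure) = UNIV"
    by (simp add: hausdorff_measure_def space_measure_of_conv)
  have "Collect closed \<subseteq> sets (hausdorff_measure k :: 'a measure)"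
    unfolding sets_hausdorff_measure using closed_in_lambda_system_hausdorff by blast
  then have "sigma_sets UNIV (Collect closed) \<subseteq> sets (hausdorff_measure k :: 'a measure)"
    using sets.sigma_sets_subset[of "Collect closed" "hausdorff_measure k :: 'a measure"] sp by simp
  then show ?thesis
    unfolding borel_eq_closed by simp
qed

lemma space_hausdorff_measure: "space (hausdorff_measure k :: 'a::metric_space measure) = UNIV"
  by (simp add: hausdorff_measure_def space_measure_of_conv)

lemma hausdorff_outer_isometry_le:
  fixes f :: "'a::metric_space \<Rightarrow> 'a"
  assumes f: "\<And>x y. dist (f x) (f y) = dist x y"
  shows "hausdorff_outer k (f ` A) \<le> hausdorff_outer k A"
  unfolding hausdorff_outer_def
proof (rule SUP_mono', unfold hausdorff_pre_def, rule INF_mono, safe)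
  fix \<delta> and C :: "nat \<Rightarrow> 'a set"
  assume C: "A \<subseteq> \<Union> (range C)" "\<forall>j. bounded (C j) \<and> diameter (C j) \<le> \<delta>"
  have d: "diameter (f ` X) = diameter X" for X
  proof -
    have "(\<lambda>(x, y). dist x y) ` (f ` X \<times> f ` X) = (\<lambda>(x, y). dist x y) ` (X \<times> X)"
      unfolding map_prod_surj_on[OF refl refl, symmetric] image_image
      by (rule image_cong) (auto simp: f)
    then show ?thesis unfolding diameter_def by simp
  qed
  have b: "bounded (f ` X)" if X: "bounded X" for X
  proof -
    obtain c e where "\<forall>y\<in>X. dist c y \<le> e" using X unfolding bounded_def by blast
    then have "\<forall>y\<in>f ` X. dist (f c) y \<le> e" by (simp add: f)
    then show ?thesis unfolding bounded_def by blast
  qed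
  have g: "hausdorff_gauge k (f ` X) = hausdorff_gauge k X" for X
    by (simp add: hausdorff_gauge_def d)
  show "\<exists>Ca\<in>{C. f ` A \<subseteq> \<Union> (range C) \<and> (\<forall>j. bounded (C j) \<and> diameter (C j) \<le> \<delta>)}.
      (\<Sum>j. hausdorff_gauge k (Ca j)) \<le> (\<Sum>j. hausdorff_gauge k (C j))"
    using C by (intro bexI[of _ "\<lambda>j. f ` C j"]) (simp_all add: d b g image_UN[symmetric] image_mono)
qed

lemma hausdorff_outer_isometry:
  fixes f :: "'a::metric_space \<Rightarrow> 'a"
  assumes f: "\<And>x y. dist (f x) (f y) = dist x y" and "surj f"
  shows "hausdorff_outer k (f ` A) = hausdorff_outer k A"
proof (rule antisym)
  have inj: "inj f" using f by (metis dist_eq_0_iff injI)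
  have "dist (inv f x) (inv f y) = dist x y" for x y
    using f[of "inv f x" "inv f y"] \<open>surj f\<close> by (simp add: surj_f_inv_f)
  then have "hausdorff_outer k (inv f ` f ` A) \<le> hausdorff_outer k (f ` A)"
    by (rule hausdorff_outer_isometry_le)
  then show "hausdorff_outer k A \<le> hausdorff_outer k (f ` A)"
    using inj by (simp add: image_image)
qed (rule hausdorff_outer_isometry_le[OF f])

section \<open>Uniformly distributed measures\<close>

text \<open>For \<open>x\<close> in the open set \<open>U\<close> the quotient of \<open>N (U \<inter> ball x \<rho>)\<close> by \<open>k \<rho>\<close> is eventually \<open>1\<close> as \<open>\<rho> \<rightarrow> 0\<close>.  Fatou's lemma and
  Tonelli turn the \<open>M\<close>-integral of this quotient over \<open>U\<close> into an \<open>N\<close>-integral of \<open>M (ball y \<rho>) / k \<rho> = c\<close>.\<close>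

lemma uniformly_distributed_le:
  fixes M N :: "'a::euclidean_space measure"
  assumes "sigma_finite_measure M" "sigma_finite_measure N"
    and [measurable_cong]: "sets M = sets borel" "sets N = sets borel"
    and S[measurable]: "S \<in> sets borel" and "emeasure M (- S) = 0" "emeasure N (- S) = 0"
    and N: "\<And>x r. x \<in> S \<Longrightarrow> 0 < r \<Longrightarrow> emeasure N (ball x r) = k r"
    and M: "\<And>x r. x \<in> S \<Longrightarrow> 0 < r \<Longrightarrow> emeasure M (ball x r) = c * k r"
    and k: "\<And>r. 0 < r \<Longrightarrow> 0 < k r" "\<And>r. 0 < r \<Longrightarrow> k r < \<infinity>"
    and "open U"
  shows "emeasure M U \<le> c * emeasure N U"
proof -
  interpret M: sigma_finite_measure M by fact
  interpret N: sigma_finite_measure N by fact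
  interpret pair_sigma_finite M N ..
  have [measurable]: "U \<in> sets borel" using \<open>open U\<close> by auto
  have aeM: "AE x in M. x \<in> S"
    using assms(6) by (intro AE_I[of _ _ "- S"]) auto
  have aeN: "AE x in N. x \<in> S"
    using assms(7) by (intro AE_I[of _ _ "- S"]) auto
  define r where "r n = 1 / (real n + 1)" for n
  have r: "r n > 0" for n by (auto simp: r_def)
  have r0: "r \<longlonglongrightarrow> 0" unfolding r_def
    by (rule real_tendsto_divide_at_top[OF tendsto_const])
       (auto intro!: filterlim_tendsto_add_at_top filterlim_real_sequentially simp: add.commute)
  define W where "W n x y = (indicator U x * indicator U y * (if dist x y < r n then 1 else 0) :: ennreal)"
    for n x y
  have [measurable]: "(\<lambda>(x, y). W n x y) \<in> borel_measurable (M \<Otimes>\<^sub>M N)" for n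
    unfolding W_def by measurable
  have ball_meas[measurable]: "ball y t \<in> sets M" for y t by (simp add: assms)
  have [measurable]: "W n x \<in> borel_measurable borel" "(\<lambda>y. W n y x) \<in> borel_measurable borel" for n x
    unfolding W_def by measurable
  have upper: "(\<integral>\<^sup>+x. (\<integral>\<^sup>+y. W n x y \<partial>N) \<partial>M) \<le> c * k (r n) * emeasure N U" for n
  proof -
    have "(\<integral>\<^sup>+x. (\<integral>\<^sup>+y. W n x y \<partial>N) \<partial>M) = (\<integral>\<^sup>+y. (\<integral>\<^sup>+x. W n x y \<partial>M) \<partial>N)"
      by (rule Fubini'[symmetric]) measurable
    also have "\<dots> \<le> (\<integral>\<^sup>+y. c * k (r n) * indicator U y \<partial>N)"
    proof (rule nn_integral_mono_AE, use aeN in eventually_elim)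
      fix y assume "y \<in> S"
      have "(\<integral>\<^sup>+x. W n x y \<partial>M) \<le> (\<integral>\<^sup>+x. indicator U y * indicator (ball y (r n)) x \<partial>M)"
        by (intro nn_integral_mono) (auto simp: W_def dist_commute split: split_indicator)
      also have "\<dots> = indicator U y * emeasure M (ball y (r n))"
        by (subst nn_integral_cmult) simp_all
      finally show "(\<integral>\<^sup>+x. W n x y \<partial>M) \<le> c * k (r n) * indicator U y"
        using M[OF \<open>y \<in> S\<close> r] by (simp add: mult.commute)
    qed
    also have "\<dots> = c * k (r n) * emeasure N U"
      by (subst nn_integral_cmult) auto
    finally show ?thesis .
  qed
  define f where "f n x = (\<integral>\<^sup>+y. W n x y \<partial>N) / k (r n)" for n x
  have [measurable]: "f n \<in> borel_measurable M" for n unfolding f_def by measurable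
  have "emeasure M U = (\<integral>\<^sup>+x. indicator U x \<partial>M)" by simp
  also have "\<dots> \<le> (\<integral>\<^sup>+x. liminf (\<lambda>n. f n x) \<partial>M)"
  proof (rule nn_integral_mono_AE, use aeM in eventually_elim)
    fix x assume "x \<in> S"
    show "indicator U x \<le> liminf (\<lambda>n. f n x)"
    proof (cases "x \<in> U")
      case True
      obtain e where e: "e > 0" "ball x e \<subseteq> U" using True \<open>open U\<close> by (meson openE)
      have "eventually (\<lambda>n. r n < e) sequentially"
        using order_tendstoD(2)[OF r0 e(1)] .
      then have "eventually (\<lambda>n. 1 \<le> f n x) sequentially"
      proof eventually_elim
        case (elim n)
        have "k (r n) = (\<integral>\<^sup>+y. indicator (ball x (r n)) y \<partial>N)"
          using N[OF \<open>x \<in> S\<close> r] by simp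
        also have "\<dots> \<le> (\<integral>\<^sup>+y. W n x y \<partial>N)"
          using e elim True by (intro nn_integral_mono) (auto simp: W_def subset_eq split: split_indicator)
        finally have "k (r n) / k (r n) \<le> f n x" unfolding f_def by (rule divide_right_mono_ennreal)
        then show ?case using k[OF r[of n]] by (simp add: ennreal_divide_self)
      qed
      then show ?thesis using True by (simp add: Liminf_bounded)
    qed simp
  qed
  also have "\<dots> \<le> liminf (\<lambda>n. \<integral>\<^sup>+x. f n x \<partial>M)"
    by (rule nn_integral_liminf) auto
  also have "\<dots> \<le> liminf (\<lambda>n. c * emeasure N U)"
  proof (intro Liminf_mono always_eventually allI)
    fix n
    have "(\<integral>\<^sup>+x. f n x \<partial>M) = (\<integral>\<^sup>+x. (\<integral>\<^sup>+y. W n x y \<partial>N) \<partial>M) / k (r n)"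
      unfolding f_def by (rule nn_integral_divide) auto
    also have "\<dots> \<le> c * k (r n) * emeasure N U / k (r n)"
      by (intro divide_right_mono_ennreal upper)
    also have "\<dots> = c * emeasure N U"
      using k[OF r[of n]] 
        ennreal_mult_divide_eq[of "k (r n)" "c * emeasure N U"] by (simp add: ac_simps less_top)
    finally show "(\<integral>\<^sup>+x. f n x \<partial>M) \<le> c * emeasure N U" .
  qed
  also have "\<dots> = c * emeasure N U" by (simp add: Liminf_const)
  finally show ?thesis .
qed

text \<open>Integrating the indicator of \<open>dist x y < \<rho>\<close> in both orders gives \<open>h \<rho> * N UNIV = k \<rho> * M UNIV\<close>, so the quotient of the ball
  measures does not depend on the radius, and the previous lemma applies in both directions.\<close>

lemma uniformly_distributed_eq:
  fixes M N :: "'a::euclidean_space measure"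
  assumes "finite_measure M" "finite_measure N"
    and sets[measurable_cong]: "sets M = sets borel" "sets N = sets borel"
    and "compact S" and nul: "emeasure M (- S) = 0" "emeasure N (- S) = 0"
    and N: "\<And>x r. x \<in> S \<Longrightarrow> 0 < r \<Longrightarrow> emeasure N (ball x r) = k r"
    and M: "\<And>x r. x \<in> S \<Longrightarrow> 0 < r \<Longrightarrow> emeasure M (ball x r) = h r"
    and pos: "0 < emeasure M UNIV" "0 < emeasure N UNIV"
  shows "\<exists>c. 0 < c \<and> (\<forall>A\<in>sets borel. emeasure M A = ennreal c * emeasure N A)"
proof -
  interpret M: finite_measure M by fact
  interpret N: finite_measure N by fact
  interpret pair_sigma_finite M N ..
  have sp: "space M = UNIV" "space N = UNIV"
    using sets_eq_imp_space_eq[OF sets(1)] sets_eq_imp_space_eq[OF sets(2)] by auto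
  have [measurable]: "S \<in> sets borel" using \<open>compact S\<close> by (simp add: compact_imp_closed)
  have ballpos: "0 < g r" if L: "sets L = sets borel" "emeasure L (- S) = 0" "0 < emeasure L UNIV"
    "\<And>x. x \<in> S \<Longrightarrow> emeasure L (ball x r) = g r" "0 < r" for L g r
  proof (rule ccontr)
    assume "\<not> 0 < g r"
    then have g: "g r = 0" by (simp add: zero_less_iff_neq_zero)
    have cov: "S \<subseteq> (\<Union>x\<in>S. ball x r)"
    proof
      fix x assume "x \<in> S"
      then show "x \<in> (\<Union>x\<in>S. ball x r)" using centre_in_ball[of x r] \<open>0 < r\<close> by blast
    qed
    obtain D where D: "D \<subseteq> S" "finite D" "S \<subseteq> (\<Union>x\<in>D. ball x r)"
      by (rule compactE_image[of S S "\<lambda>x. ball x r", OF \<open>compact S\<close> open_ball cov])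
    have [measurable]: "(\<Union>x\<in>D. ball x r) \<in> sets L"
      unfolding L by (intro borel_open open_UN ballI open_ball)
    have [measurable]: "- S \<in> sets L" unfolding L by measurable
    have "emeasure L UNIV \<le> emeasure L (- S \<union> (\<Union>x\<in>D. ball x r))"
      using D by (intro emeasure_mono) auto
    also have "\<dots> \<le> emeasure L (- S) + emeasure L (\<Union>x\<in>D. ball x r)"
      by (intro emeasure_subadditive) measurable
    also have "\<dots> \<le> 0 + (\<Sum>x\<in>D. emeasure L (ball x r))"
      using D by (intro add_mono emeasure_subadditive_finite) (simp_all add: L image_subset_iff)
    also have "\<dots> = 0" using D L(4) g by (simp add: subset_eq)
    finally show False using L(3) by simp
  qed
  have kpos: "0 < k r" if "0 < r" for r
    using ballpos[of N r k] sets nul pos N that by blast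
  have hpos: "0 < h r" if "0 < r" for r
    using ballpos[of M r h] sets nul pos M that by blast
  have aeM: "AE x in M. x \<in> S"
    using nul by (intro AE_I[of _ _ "- S"]) auto
  have aeN: "AE x in N. x \<in> S"
    using nul by (intro AE_I[of _ _ "- S"]) auto
  define m n where "m = measure M UNIV" and "n = measure N UNIV"
  have m: "emeasure M UNIV = ennreal m" "m > 0"
    using pos(1) M.emeasure_eq_measure[of UNIV] by (auto simp: m_def)
  have n: "emeasure N UNIV = ennreal n" "n > 0"
    using pos(2) N.emeasure_eq_measure[of UNIV] by (auto simp: n_def)
  have "S \<noteq> {}"
    using nul m by auto
  have fin: "k r < \<infinity>" "h r < \<infinity>" if "0 < r" for r
  proof -
    obtain x where "x \<in> S" using \<open>S \<noteq> {}\<close> by auto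
    then show "k r < \<infinity>" "h r < \<infinity>"
      using N[OF _ that, of x] M[OF _ that, of x] M.emeasure_finite[of "ball x r"]
        N.emeasure_finite[of "ball x r"] by (auto simp: less_top)
  qed
  \<comment> \<open>Both sides are the double integral of the indicator of \<open>dist x y < r\<close>.\<close>
  have hk: "h r * ennreal n = k r * ennreal m" if r: "0 < r" for r
  proof -
    have "(\<integral>\<^sup>+x. (\<integral>\<^sup>+y. (if dist x y < r then 1 else 0) \<partial>N) \<partial>M) = (\<integral>\<^sup>+x. k r \<partial>M)"
    proof (rule nn_integral_cong_AE, use aeM in eventually_elim)
      fix x assume "x \<in> S"
      have "(\<integral>\<^sup>+y. (if dist x y < r then 1 else 0) \<partial>N) = (\<integral>\<^sup>+y. indicator (ball x r) y \<partial>N)"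
        by (intro nn_integral_cong) (auto split: split_indicator)
      then show "(\<integral>\<^sup>+y. (if dist x y < r then 1 else 0) \<partial>N) = k r"
        using N[OF \<open>x \<in> S\<close> r] by simp
    qed
    moreover have "(\<integral>\<^sup>+y. (\<integral>\<^sup>+x. (if dist x y < r then 1 else 0) \<partial>M) \<partial>N) = (\<integral>\<^sup>+x. h r \<partial>N)"
    proof (rule nn_integral_cong_AE, use aeN in eventually_elim)
      fix x assume "x \<in> S"
      have "(\<integral>\<^sup>+y. (if dist y x < r then 1 else 0) \<partial>M) = (\<integral>\<^sup>+y. indicator (ball x r) y \<partial>M)"
        by (intro nn_integral_cong) (auto split: split_indicator simp: dist_commute)
      then show "(\<integral>\<^sup>+y. (if dist y x < r then 1 else 0) \<partial>M) = h r"
        using M[OF \<open>x \<in> S\<close> r] by simp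
    qed
    moreover have "(\<integral>\<^sup>+x. (\<integral>\<^sup>+y. (if dist x y < r then 1 else 0) \<partial>N) \<partial>M) =
      (\<integral>\<^sup>+y. (\<integral>\<^sup>+x. (if dist x y < r then 1 else (0::ennreal)) \<partial>M) \<partial>N)"
      by (rule Fubini'[symmetric]) measurable
    ultimately show ?thesis using m n sp by simp
  qed
  define c where "c = m / n"
  have c: "c > 0" using m n by (simp add: c_def)
  have hk': "h r = ennreal c * k r" "k r = ennreal (1 / c) * h r" if r: "0 < r" for r
  proof -
    define a b where "a = enn2real (h r)" and "b = enn2real (k r)"
    then have ab: "h r = ennreal a" "k r = ennreal b" "a \<ge> 0" "b \<ge> 0"
      using fin[OF r] by auto
    have "a * n = b * m"
      using hk[OF r] ab m n by (simp add: ennreal_mult[symmetric])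
    then show "h r = ennreal c * k r" "k r = ennreal (1 / c) * h r"
      using ab m n c by (auto simp: ennreal_mult[symmetric] c_def field_simps)
  qed
  have op: "emeasure M U = ennreal c * emeasure N U" if "open U" for U
  proof (rule antisym)
    show "emeasure M U \<le> ennreal c * emeasure N U"
      by (rule uniformly_distributed_le[where S = S and k = k])
         (use N M hk'(1) kpos fin that nul sets M.sigma_finite_measure_axioms N.sigma_finite_measure_axioms in simp_all)
    have "emeasure N U \<le> ennreal (1 / c) * emeasure M U"
      by (rule uniformly_distributed_le[where S = S and k = h])
         (use N M hk'(2) hpos fin that nul sets M.sigma_finite_measure_axioms N.sigma_finite_measure_axioms in simp_all)
    then have "ennreal c * emeasure N U \<le> ennreal c * (ennreal (1 / c) * emeasure M U)"
      by (rule mult_left_mono) simp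
    also have "\<dots> = emeasure M U"
      using c by (simp add: mult.assoc[symmetric] ennreal_mult[symmetric])
    finally show "ennreal c * emeasure N U \<le> emeasure M U" .
  qed
  have "M = scale_measure (ennreal c) N"
  proof (rule measure_eqI_generator_eq[of "Collect open" UNIV _ _ "\<lambda>_. UNIV"])
    show "Int_stable (Collect (open :: 'a set \<Rightarrow> bool))" by (auto simp: Int_stable_def)
    show "emeasure M X = emeasure (scale_measure (ennreal c) N) X" if "X \<in> Collect open" for X
      using op that by simp
  qed (auto simp: sets borel_def)
  then show ?thesis using c by (auto intro!: exI[of _ c])
qed

text \<open>Lebesgue measure is uniformly distributed on the whole space and so is its image under an isometry, with the same ball
  measures.\<close>

lemma emeasure_lborel_isometry:
  fixes f g :: "'a::euclidean_space \<Rightarrow> 'a"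
  assumes f: "\<And>x y. dist (f x) (f y) = dist x y" and g: "\<And>x. f (g x) = x"
    and A[measurable]: "A \<in> sets borel"
  shows "emeasure lborel (f -` A) = emeasure lborel A"
proof -
  have "continuous_on UNIV f"
    unfolding continuous_on_iff by (auto simp: f)
  then have [measurable]: "f \<in> borel_measurable borel" by (rule borel_measurable_continuous_onI)
  define M where "M = distr lborel borel f"
  have sets_M: "sets M = sets borel" by (simp add: M_def)
  have M: "emeasure M B = emeasure lborel (f -` B)" if "B \<in> sets borel" for B
    using that by (simp add: M_def emeasure_distr)
  have "dist x (f y) = dist (g x) y" for x y
    using f[of "g x" y] g by simp
  then have "f -` ball x r = ball (g x) r" for x r
    by auto
  then have Mball: "emeasure M (ball x r) = ennreal (unit_ball_vol DIM('a) * r ^ DIM('a))" if "0 < r" for x r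
    using that by (simp add: M emeasure_ball)
  have Lball: "emeasure lborel (ball x r) = ennreal (unit_ball_vol DIM('a) * r ^ DIM('a))" if "0 < r" for x :: 'a and r
    using that by (simp add: emeasure_ball)
  have "\<exists>n::nat. norm x < real n + 1" for x :: 'a
    using reals_Archimedean2[of "norm x"] by (meson less_add_one less_trans)
  then have cover: "(\<Union>n::nat. ball (0::'a) (real n + 1)) = UNIV"
    by auto
  have sM: "sigma_finite_measure M"
  proof
    show "\<exists>A. countable A \<and> A \<subseteq> sets M \<and> \<Union> A = space M \<and> (\<forall>a\<in>A. emeasure M a \<noteq> \<infinity>)"
    proof (intro exI[of _ "range (\<lambda>n::nat. ball (0::'a) (real n + 1))"] conjI ballI)
      show "\<Union> (range (\<lambda>n::nat. ball (0::'a) (real n + 1))) = space M"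
        by (simp add: M_def cover)
      fix a assume "a \<in> range (\<lambda>n::nat. ball (0::'a) (real n + 1))"
      then obtain n :: nat where "a = ball 0 (real n + 1)" by auto
      then show "emeasure M a \<noteq> \<infinity>"
        using Mball[of "real n + 1" 0] by simp
    qed (auto simp: M_def)
  qed
  have "M = lborel"
  proof (rule measure_eqI_generator_eq[of "Collect open" UNIV _ _ "\<lambda>n. ball 0 (real n + 1)"])
    show "Int_stable (Collect (open :: 'a set \<Rightarrow> bool))" by (auto simp: Int_stable_def)
    fix X :: "'a set" assume "X \<in> Collect open"
    then have X: "open X" by simp
    have "emeasure M X \<le> 1 * emeasure lborel X"
      by (rule uniformly_distributed_le[where S = UNIV and k = "\<lambda>r. ennreal (unit_ball_vol DIM('a) * r ^ DIM('a))"])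
         (use sM X Mball Lball in
           \<open>simp_all add: lborel.sigma_finite_measure_axioms sets_M\<close>)
    moreover have "emeasure lborel X \<le> 1 * emeasure M X"
      by (rule uniformly_distributed_le[where S = UNIV and k = "\<lambda>r. ennreal (unit_ball_vol DIM('a) * r ^ DIM('a))"])
         (use sM X Mball Lball in
           \<open>simp_all add: lborel.sigma_finite_measure_axioms sets_M\<close>)
    ultimately show "emeasure M X = emeasure lborel X" by simp
  next
    show "(\<Union>i. ball (0::'a) (real i + 1)) = UNIV"
      by (rule cover)
    show "emeasure M (ball 0 (real i + 1)) \<noteq> \<infinity>" for i :: nat
      using Mball[of "real i + 1" 0] by simp
  qed (auto simp: sets_M borel_def)
  with M[OF A] show ?thesis by simp
qed

text \<open>The reflection in the bisecting hyperplane of two vectors of equal length.\<close>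

lemma isometric_involution_exists:
  fixes a b :: "'a::euclidean_space"
  assumes "norm a = norm b"
  shows "\<exists>f. (\<forall>x y. dist (f x) (f y) = dist x y) \<and> (\<forall>x. f (f x) = x) \<and> f a = b \<and>
    (\<forall>c x. f (c *\<^sub>R x) = c *\<^sub>R f x) \<and> (\<forall>x. norm (f x) = norm x)"
proof (cases "a = b")
  case True
  then show ?thesis by (intro exI[of _ id]) simp
next
  case False
  define w where "w = a - b"
  have w: "w \<bullet> w > 0" using False by (simp add: w_def)
  define f where "f x = x - (2 * (x \<bullet> w) / (w \<bullet> w)) *\<^sub>R w" for x
  have lin: "f (x - y) = f x - f y" for x y
    by (simp add: f_def inner_diff_left diff_divide_distrib right_diff_distrib scaleR_left_diff_distrib)
  have nf: "norm (f x) = norm x" for x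
  proof -
    have "f x \<bullet> f x = x \<bullet> x"
      using w by (simp add: f_def inner_diff_left inner_diff_right inner_commute field_simps power2_eq_square)
    then show ?thesis by (simp add: norm_eq)
  qed
  have "f a = b"
  proof -
    have "2 * (a \<bullet> w) = w \<bullet> w"
      using assms by (simp add: w_def inner_diff_left inner_diff_right inner_commute norm_eq)
    then show ?thesis using w by (simp add: f_def w_def)
  qed
  moreover have "f (f x) = x" for x
  proof -
    have "f x \<bullet> w = - (x \<bullet> w)"
      using w by (simp add: f_def inner_diff_left)
    then have "f (f x) = f x + (2 * (x \<bullet> w) / (w \<bullet> w)) *\<^sub>R w"
      unfolding f_def[of "f x"] by simp
    then show ?thesis by (simp add: f_def)
  qed
  moreover have "f (c *\<^sub>R x) = c *\<^sub>R f x" for c x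
    by (simp add: f_def scaleR_diff_right)
  ultimately show ?thesis using nf lin by (intro exI[of _ f]) (simp only: dist_norm lin[symmetric] nf simp_thms)
qed

section \<open>Polar coordinates for the cone measure\<close>

definition cone :: "'a::euclidean_space set \<Rightarrow> real \<Rightarrow> 'a set"
  where "cone A t = {x. x \<noteq> 0 \<and> norm x < t \<and> sgn x \<in> A}"

text \<open>The surface measure of the sphere up to the factor \<open>DIM('a)\<close>.\<close>

definition cone_measure :: "'a::euclidean_space measure"
  where "cone_measure = distr (restrict_space lborel (ball 0 1 - {0})) borel sgn"

lemma sgn_borel[measurable]: "(sgn :: 'a::euclidean_space \<Rightarrow> 'a) \<in> borel_measurable borel"
proof -
  have "(sgn :: 'a \<Rightarrow> 'a) = (\<lambda>x. x /\<^sub>R norm x)" by (simp add: fun_eq_iff sgn_div_norm)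
  then show ?thesis by simp
qed

lemma sets_cone_measure[simp, measurable_cong]: "sets cone_measure = sets borel"
  by (simp add: cone_measure_def)

lemma space_cone_measure[simp]: "space cone_measure = UNIV"
  by (simp add: cone_measure_def)

lemma cone_borel[measurable]:
  assumes [measurable]: "A \<in> sets borel" shows "cone A t \<in> sets borel"
  unfolding cone_def by measurable

lemma emeasure_cone_measure:
  assumes [measurable]: "A \<in> sets borel"
  shows "emeasure cone_measure A = emeasure lborel (cone A 1)"
proof -
  have "sgn \<in> measurable (restrict_space lborel (ball (0::'a) 1 - {0})) borel"
    by (rule measurable_restrict_space1) simp
  then have "emeasure cone_measure A = emeasure (restrict_space lborel (ball 0 1 - {0}))
      (sgn -` A \<inter> (ball 0 1 - {0}))"
    unfolding cone_measure_def by (simp add: emeasure_distr space_restrict_space)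
  also have "sgn -` A \<inter> (ball 0 1 - {0}) = cone A 1"
    by (auto simp: cone_def)
  also have "emeasure (restrict_space lborel (ball 0 1 - {0})) (cone A 1) = emeasure lborel (cone A 1)"
    by (rule emeasure_restrict_space) (auto simp: cone_def)
  finally show ?thesis .
qed

lemma emeasure_cone:
  fixes A :: "'a::euclidean_space set"
  assumes [measurable]: "A \<in> sets borel" and t: "0 < t"
  shows "emeasure lborel (cone A t) = ennreal (t ^ DIM('a)) * emeasure cone_measure A"
proof -
  have eq: "(lborel :: 'a measure) = density (distr lborel borel (\<lambda>x. 0 + t *\<^sub>R x)) (\<lambda>_. \<bar>t\<bar> ^ DIM('a))"
    using t by (intro lborel_affine) simp
  have "emeasure lborel (cone A t) =
      emeasure (density (distr lborel borel (\<lambda>x. 0 + t *\<^sub>R x)) (\<lambda>_. \<bar>t\<bar> ^ DIM('a))) (cone A t)"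
    using eq by simp
  also have "\<dots> = ennreal (t ^ DIM('a)) * emeasure lborel ((\<lambda>x. t *\<^sub>R x) -` cone A t)"
    using t by (simp add: emeasure_density nn_integral_cmult emeasure_distr)
  also have "(\<lambda>x. t *\<^sub>R x) -` cone A t = cone A 1"
    using t by (auto simp: cone_def sgn_scaleR)
  finally show ?thesis by (simp add: emeasure_cone_measure)
qed

lemma finite_cone_measure: "finite_measure (cone_measure :: 'a::euclidean_space measure)"
proof
  have "emeasure lborel (cone (UNIV :: 'a set) 1) \<le> emeasure lborel (ball (0::'a) 1)"
    by (intro emeasure_mono) (auto simp: cone_def)
  also have "\<dots> < \<infinity>" by (rule emeasure_lborel_ball_finite)
  finally show "emeasure (cone_measure :: 'a measure) (space cone_measure) \<noteq> \<infinity>"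
    by (simp add: emeasure_cone_measure)
qed

lemma cone_measure_sphere: "emeasure cone_measure (- sphere (0::'a::euclidean_space) 1) = 0"
proof -
  have "- sphere (0::'a) 1 \<in> sets borel" by measurable
  moreover have "cone (- sphere (0::'a) 1) 1 = {}"
    by (auto simp: cone_def norm_sgn)
  ultimately show ?thesis by (simp only: emeasure_cone_measure emeasure_empty)
qed

lemma cone_measure_pos: "0 < emeasure (cone_measure :: 'a::euclidean_space measure) UNIV"
proof -
  have "emeasure lborel (ball (0::'a) 1) \<le> emeasure lborel (cone (UNIV :: 'a set) 1 \<union> {0})"
    by (intro emeasure_mono) (auto simp: cone_def)
  also have "\<dots> \<le> emeasure lborel (cone (UNIV :: 'a set) 1) + emeasure lborel {0::'a}"
    by (intro emeasure_subadditive) auto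
  finally have "emeasure lborel (ball (0::'a) 1) \<le> emeasure (cone_measure :: 'a measure) UNIV"
    by (simp add: emeasure_cone_measure)
  moreover have "0 < emeasure lborel (ball (0::'a) 1)"
    by (simp add: emeasure_ball)
  ultimately show ?thesis by simp
qed

lemma cone_measure_ball_eq:
  fixes x y :: "'a::euclidean_space"
  assumes "norm x = norm y"
  shows "emeasure cone_measure (ball x r) = emeasure cone_measure (ball y r)"
proof -
  obtain f :: "'a \<Rightarrow> 'a" where f: "\<And>x y. dist (f x) (f y) = dist x y" "\<And>x. f (f x) = x" "f x = y"
    "\<And>c x. f (c *\<^sub>R x) = c *\<^sub>R f x" "\<And>x. norm (f x) = norm x"
    using isometric_involution_exists[OF assms] by blast
  have f0: "f z = 0 \<longleftrightarrow> z = 0" for z using f(5)[of z] by (metis norm_eq_zero)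
  have sgnf: "sgn (f z) = f (sgn z)" for z by (simp add: sgn_div_norm f(4,5))
  have dxy: "dist y (f z) = dist x z" for z using f(1)[of x z] f(3) by simp
  have "f -` cone (ball y r) 1 = cone (ball x r) 1"
    by (auto simp: cone_def f(5) f0 sgnf dxy)
  then show ?thesis
    using emeasure_lborel_isometry[of f f "cone (ball y r) 1"] f(1,2)
    by (simp add: emeasure_cone_measure)
qed

text \<open>The image of Lebesgue measure under \<open>x \<mapsto> (|x|, x / |x|)\<close> is a product: on rectangles \<open>{..<t} \<times> B\<close> this is the scaling
  behaviour of cones, and these determine the measure.\<close>

lemma nn_integral_polar_cone_measure:
  fixes f :: "'a::euclidean_space \<Rightarrow> ennreal"
  assumes [measurable]: "f \<in> borel_measurable borel"
  shows "(\<integral>\<^sup>+x. f x \<partial>lborel) = (\<integral>\<^sup>+\<rho>. (\<integral>\<^sup>+n. f (\<rho> *\<^sub>R n) \<partial>cone_measure) *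
     (ennreal (real DIM('a) * \<rho> ^ (DIM('a) - 1)) * indicator {0<..} \<rho>) \<partial>lborel)"
proof -
  let ?N = "DIM('a)"
  define w where "w \<rho> = ennreal (real ?N * \<rho> ^ (?N - 1)) * indicator {0<..} \<rho>" for \<rho> :: real
  have [measurable]: "w \<in> borel_measurable borel" unfolding w_def by measurable
  define P where "P = density lborel w"
  have setsP[measurable_cong]: "sets P = sets borel" by (simp add: P_def)
  define D where "D = density lborel (indicator (- {0::'a}))"
  have setsD[measurable_cong]: "sets D = sets borel" by (simp add: D_def)
  have AE0: "AE x in lborel. x \<noteq> (0::'a)"
    by (rule AE_lborel_singleton)
  have P_lessThan: "emeasure P {..<t} = (if t \<le> 0 then 0 else ennreal (t ^ ?N))" for t
  proof -
    have "emeasure P {..<t} = (\<integral>\<^sup>+\<rho>. w \<rho> * indicator {..<t} \<rho> \<partial>lborel)"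
      by (simp add: P_def emeasure_density)
    also have "\<dots> = (if t \<le> 0 then 0 else ennreal (t ^ ?N))"
    proof (cases "t \<le> 0")
      case True
      then have "(\<integral>\<^sup>+\<rho>. w \<rho> * indicator {..<t} \<rho> \<partial>lborel) = (\<integral>\<^sup>+\<rho>. 0 \<partial>(lborel :: real measure))"
        by (intro nn_integral_cong) (auto simp: w_def split: split_indicator)
      then show ?thesis using True by simp
    next
      case False
      have "(\<integral>\<^sup>+\<rho>. w \<rho> * indicator {..<t} \<rho> \<partial>lborel) =
          (\<integral>\<^sup>+\<rho>. ennreal (real ?N * \<rho> ^ (?N - 1)) * indicator {0..t} \<rho> \<partial>lborel)"
        using AE_lborel_singleton[of "0::real"] AE_lborel_singleton[of t]
        by (intro nn_integral_cong_AE, eventually_elim) (auto simp: w_def split: split_indicator)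
      also have "\<dots> = ennreal (t ^ ?N - 0 ^ ?N)"
        using False by (intro nn_integral_FTC_Icc) (auto intro!: derivative_eq_intros)
      finally show ?thesis using False by simp
    qed
    finally show ?thesis .
  qed
  have "finite_measure (cone_measure :: 'a measure)" by (rule finite_cone_measure)
  then interpret C: finite_measure "cone_measure :: 'a measure" .
  have rect: "emeasure P A * emeasure cone_measure B =
      emeasure (distr D (borel \<Otimes>\<^sub>M borel) (\<lambda>x. (norm x, sgn x))) (A \<times> B)"
    if [measurable]: "A \<in> sets borel" "B \<in> sets borel" for A and B :: "'a set"
  proof -
    define M where "M = distr (density D (indicator (sgn -` B))) borel norm"
    have [measurable]: "sgn -` B \<in> sets borel" using measurable_sets[OF sgn_borel that(2)] by simp
    have M: "emeasure M X = emeasure lborel {x. x \<noteq> 0 \<and> norm x \<in> X \<and> sgn x \<in> B}"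
      if [measurable]: "X \<in> sets borel" for X
    proof -
      have "emeasure M X = emeasure (density D (indicator (sgn -` B))) {x. norm x \<in> X}"
        unfolding M_def by (subst emeasure_distr) (auto simp: D_def vimage_def)
      also have "\<dots> = (\<integral>\<^sup>+x. indicator (- {0}) x * (indicator (sgn -` B) x * indicator {x. norm x \<in> X} x) \<partial>lborel)"
        unfolding D_def by (simp add: emeasure_density nn_integral_density)
      also have "\<dots> = (\<integral>\<^sup>+x. indicator {x. x \<noteq> 0 \<and> norm x \<in> X \<and> sgn x \<in> B} x \<partial>lborel)"
        by (intro nn_integral_cong) (auto split: split_indicator)
      also have "\<dots> = emeasure lborel {x. x \<noteq> 0 \<and> norm x \<in> X \<and> sgn x \<in> B}"
        by (subst nn_integral_indicator) auto
      finally show ?thesis .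
    qed
    have lt: "emeasure M {..<t} = emeasure cone_measure B * emeasure P {..<t}" for t
    proof (cases "t \<le> 0")
      case True
      then have "{x::'a. x \<noteq> 0 \<and> norm x \<in> {..<t} \<and> sgn x \<in> B} = {}"
        by (auto simp: not_less intro: order_trans)
      then have "emeasure M {..<t} = emeasure lborel ({} :: 'a set)"
        using M[of "{..<t}"] by (simp only: borel_open open_lessThan)
      then show ?thesis using True by (simp add: P_lessThan)
    next
      case False
      have "{x::'a. x \<noteq> 0 \<and> norm x \<in> {..<t} \<and> sgn x \<in> B} = cone B t"
        by (auto simp: cone_def)
      then show ?thesis using False
        by (simp add: M P_lessThan emeasure_cone mult.commute)
    qed
    have "M = scale_measure (emeasure cone_measure B) P"
    proof (rule measure_eqI_generator_eq[of "range lessThan" UNIV _ _ "\<lambda>n. {..<real n}"])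
      show "Int_stable (range (lessThan :: real \<Rightarrow> real set))"
      proof -
        have "{..<a} \<inter> {..<b} = {..<min a b}" for a b :: real by auto
        then show ?thesis by (auto simp: Int_stable_def)
      qed
      show "emeasure M X = emeasure (scale_measure (emeasure cone_measure B) P) X" if "X \<in> range lessThan" for X
        using that lt by (auto simp del: lessThan_iff)
      show "sets M = sigma_sets UNIV (range lessThan)"
        "sets (scale_measure (emeasure cone_measure B) P) = sigma_sets UNIV (range lessThan)"
        by (simp_all add: M_def P_def borel_Iio)
      show "(\<Union>n::nat. {..<real n}) = UNIV"
        using reals_Archimedean2 by auto
      show "emeasure M {..<real n} \<noteq> \<infinity>" for n :: nat
        using C.emeasure_finite[of B] by (simp add: lt P_lessThan ennreal_mult_eq_top_iff)
    qed auto
    then have "emeasure P A * emeasure cone_measure B = emeasure M A"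
      by (simp add: mult.commute)
    also have "\<dots> = emeasure D {x. norm x \<in> A \<and> sgn x \<in> B}"
      unfolding M[OF that(1)] D_def
      by (subst emeasure_density) (auto simp flip: indicator_inter_arith intro!: nn_integral_cong
          simp del: nn_integral_indicator simp: nn_integral_indicator[symmetric] split: split_indicator)
    also have "\<dots> = emeasure (distr D (borel \<Otimes>\<^sub>M borel) (\<lambda>x. (norm x, sgn x))) (A \<times> B)"
      by (subst emeasure_distr) (auto simp: D_def vimage_def)
    finally show ?thesis .
  qed
  have "sigma_finite_measure P"
  proof
    show "\<exists>A. countable A \<and> A \<subseteq> sets P \<and> \<Union> A = space P \<and> (\<forall>a\<in>A. emeasure P a \<noteq> \<infinity>)"
    proof (intro exI[of _ "range (\<lambda>n::nat. {..<real n})"] conjI ballI)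
      show "\<Union> (range (\<lambda>n::nat. {..<real n})) = space P"
        using reals_Archimedean2 by (auto simp: P_def)
    qed (auto simp: P_def[symmetric] setsP P_lessThan split: if_splits)
  qed
  then interpret P: sigma_finite_measure P .
  have pair: "P \<Otimes>\<^sub>M cone_measure = distr D (borel \<Otimes>\<^sub>M borel) (\<lambda>x. (norm x, sgn x))"
  proof (rule pair_measure_eqI)
    show "sets (P \<Otimes>\<^sub>M cone_measure) = sets (distr D (borel \<Otimes>\<^sub>M borel) (\<lambda>x. (norm x, sgn x::'a)))"
      by (simp add: setsP cong: sets_pair_measure_cong)
  qed (use rect in \<open>auto simp: setsP P.sigma_finite_measure_axioms C.sigma_finite_measure_axioms\<close>)
  have "(\<integral>\<^sup>+x. f x \<partial>lborel) = (\<integral>\<^sup>+x. f (norm x *\<^sub>R sgn x) \<partial>D)"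
    unfolding D_def using AE0
    by (subst nn_integral_density) (auto intro!: nn_integral_cong_AE elim!: eventually_mono
        simp: sgn_div_norm)
  also have "\<dots> = (\<integral>\<^sup>+z. (\<lambda>(\<rho>, n). f (\<rho> *\<^sub>R n)) z \<partial>distr D (borel \<Otimes>\<^sub>M borel) (\<lambda>x. (norm x, sgn x)))"
    by (subst nn_integral_distr) (auto simp: D_def)
  also have "\<dots> = (\<integral>\<^sup>+\<rho>. (\<integral>\<^sup>+n. f (\<rho> *\<^sub>R n) \<partial>cone_measure) \<partial>P)"
    unfolding pair[symmetric] by (subst C.nn_integral_fst[symmetric]) auto
  also have "\<dots> = (\<integral>\<^sup>+\<rho>. w \<rho> * (\<integral>\<^sup>+n. f (\<rho> *\<^sub>R n) \<partial>cone_measure) \<partial>lborel)"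
    unfolding P_def by (subst nn_integral_density) auto
  finally show ?thesis by (simp add: w_def mult.commute)
qed

section \<open>Polar coordinates for the Hausdorff measure\<close>

text \<open>The balls of radius \<open>d / 2\<close> around the points are disjoint and lie in a shell of thickness \<open>d\<close>, whose volume is
  at most a constant times \<open>d\<close>.\<close>

lemma card_separated_sphere_le:
  fixes X :: "'a::euclidean_space set"
  assumes X: "finite X" "X \<subseteq> sphere 0 1" and sep: "\<And>x y. x \<in> X \<Longrightarrow> y \<in> X \<Longrightarrow> x \<noteq> y \<Longrightarrow> d \<le> dist x y"
    and d: "0 < d" "d \<le> 1"
  shows "real (card X) * d ^ (DIM('a) - 1) \<le> real DIM('a) * 4 ^ DIM('a)"
proof -
  let ?N = "DIM('a)"
  define V where "V = unit_ball_vol (real ?N)"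
  have V: "V > 0" by (simp add: V_def)
  define t where "t = d / 2"
  have t: "0 < t" "t \<le> 1 / 2" using d by (auto simp: t_def)
  have far: "1 - t < norm y" "norm y < 1 + t" if "x \<in> X" "y \<in> ball x t" for x y
  proof -
    have "norm x = 1" using X that by auto
    then show "1 - t < norm y" "norm y < 1 + t"
      using that(2) norm_triangle_ineq2[of x y] norm_triangle_ineq2[of y x] by (auto simp: dist_norm norm_minus_commute)
  qed
  have "emeasure lborel ((\<Union>x\<in>X. ball x t) \<union> ball 0 (1 - t)) =
      emeasure lborel (\<Union>x\<in>X. ball x t) + emeasure lborel (ball (0::'a) (1 - t))"
    by (intro plus_emeasure[symmetric]) (auto intro!: borel_open dest: far)
  also have "emeasure lborel (\<Union>x\<in>X. ball x t) = (\<Sum>x\<in>X. emeasure lborel (ball x t))"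
  proof (intro sum_emeasure[symmetric])
    show "disjoint_family_on (\<lambda>x. ball x t) X"
      unfolding disjoint_family_on_def
    proof safe
      fix x y z assume "x \<in> X" "y \<in> X" "x \<noteq> y" "z \<in> ball x t" "z \<in> ball y t"
      then have "dist x y < d" using dist_triangle[of x y z] by (simp add: t_def dist_commute)
      then show "z \<in> {}" using sep \<open>x \<in> X\<close> \<open>y \<in> X\<close> \<open>x \<noteq> y\<close> by fastforce
    qed
  qed (auto simp: X)
  finally have "(\<Sum>x\<in>X. emeasure lborel (ball x t)) + emeasure lborel (ball (0::'a) (1 - t))
      = emeasure lborel ((\<Union>x\<in>X. ball x t) \<union> ball 0 (1 - t))" by simp
  also have "\<dots> \<le> emeasure lborel (ball (0::'a) (1 + t))"
    using t far by (intro emeasure_mono) auto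
  finally have "ennreal (real (card X) * (V * t ^ ?N) + V * (1 - t) ^ ?N) \<le> ennreal (V * (1 + t) ^ ?N)"
    using t V by (simp add: emeasure_ball V_def[symmetric] ennreal_mult ennreal_of_nat_eq_real_of_nat)
  then have "V * (real (card X) * t ^ ?N + (1 - t) ^ ?N) \<le> V * (1 + t) ^ ?N"
    using V t by (subst (asm) ennreal_le_iff) (auto simp: algebra_simps)
  then have 1: "real (card X) * t ^ ?N \<le> (1 + t) ^ ?N - (1 - t) ^ ?N"
    using V by simp
  have "(1 + t) ^ ?N - (1 - t) ^ ?N = (2 * t) * (\<Sum>i<?N. (1 + t) ^ i * (1 - t) ^ (?N - Suc i))"
    using power_diff_sumr2[of "1 + t" ?N "1 - t"] by (simp add: mult.commute)
  also have "\<dots> \<le> (2 * t) * (\<Sum>i<?N. 2 ^ ?N)"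
  proof (intro mult_left_mono sum_mono)
    fix i assume i: "i \<in> {..<?N}"
    have "(1 + t) ^ i * (1 - t) ^ (?N - Suc i) \<le> 2 ^ i * 1"
      using t by (intro mult_mono power_mono power_le_one) auto
    also have "\<dots> \<le> 2 ^ ?N" using i by (simp add: power_increasing)
    finally show "(1 + t) ^ i * (1 - t) ^ (?N - Suc i) \<le> 2 ^ ?N" .
  qed (use t in auto)
  also have "\<dots> = d * (real ?N * 2 ^ ?N)" by (simp add: t_def)
  finally have "real (card X) * d ^ ?N / 2 ^ ?N \<le> d * (real ?N * 2 ^ ?N)"
    using 1 by (simp add: t_def power_divide)
  then have "real (card X) * d ^ ?N \<le> d * (real ?N * 2 ^ ?N) * 2 ^ ?N"
    by (simp add: field_simps)
  also have "d ^ ?N = d * d ^ (?N - 1)"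
    using power_minus_mult[of ?N d] by (simp add: mult.commute)
  finally have "d * (real (card X) * d ^ (?N - 1)) \<le> d * (real ?N * (2 ^ ?N * 2 ^ ?N))"
    by (simp add: ac_simps)
  then have "real (card X) * d ^ (?N - 1) \<le> real ?N * (2 ^ ?N * 2 ^ ?N)"
    using d by simp
  also have "(2::real) ^ ?N * 2 ^ ?N = 4 ^ ?N" by (simp flip: power_mult_distrib)
  finally show ?thesis .
qed

text \<open>A separated subset of the sphere of maximal cardinality is also a net, so the packing bound controls a cover by balls.\<close>

lemma hausdorff_outer_sphere_finite:
  "hausdorff_outer (DIM('a) - 1) (sphere (0::'a::euclidean_space) 1) < \<infinity>"
proof -
  let ?N = "DIM('a)" and ?k = "DIM('a) - 1" and ?S = "sphere (0::'a) 1"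
  define C where "C = unit_ball_vol (real ?k) * (real ?N * 4 ^ ?N)"
  have pre: "hausdorff_pre ?k (2 * d) ?S \<le> ennreal C" if d: "0 < d" "d \<le> 1" for d
  proof -
    define P where "P X \<longleftrightarrow> finite X \<and> X \<subseteq> ?S \<and> (\<forall>x\<in>X. \<forall>y\<in>X. x \<noteq> y \<longrightarrow> d \<le> dist x y)" for X
    have bound: "real (card X) * d ^ ?k \<le> real ?N * 4 ^ ?N" if "P X" for X
      using that d by (intro card_separated_sphere_le) (auto simp: P_def)
    define b where "b = nat \<lceil>real ?N * 4 ^ ?N / d ^ ?k\<rceil>"
    have "P {}" by (simp add: P_def)
    moreover have "\<forall>X. P X \<longrightarrow> card X < Suc b"
    proof safe
      fix X assume "P X"
      then have "real (card X) \<le> real ?N * 4 ^ ?N / d ^ ?k"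
        using bound d by (simp add: field_simps)
      then have "card X \<le> b" unfolding b_def by linarith
      then show "card X < Suc b" by simp
    qed
    ultimately obtain X where X: "P X" "\<And>Y. P Y \<Longrightarrow> card Y \<le> card X"
      using ex_has_greatest_nat[of P "{}" card "Suc b"] by (metis less_imp_le)
    have cov: "\<exists>x\<in>X. y \<in> cball x d" if "y \<in> ?S" for y
    proof (rule ccontr)
      assume no: "\<not> ?thesis"
      then have "y \<notin> X" using d by auto
      moreover have "P (insert y X)"
        using X(1) no that unfolding P_def
        by (auto simp: dist_commute not_le intro: less_imp_le)
      ultimately show False using X(2)[of "insert y X"] X(1) by (simp add: P_def)
    qed
    obtain f where f: "bij_betw f {..<card X} X"
      using X(1) ex_bij_betw_nat_finite[of X] by (auto simp: P_def lessThan_atLeast0)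
    define B where "B j = (if j < card X then cball (f j) d else {})" for j
    have "?S \<subseteq> (\<Union>j. B j)"
    proof
      fix y assume "y \<in> ?S"
      then obtain x where "x \<in> X" "y \<in> cball x d" using cov by blast
      moreover then obtain j where "j < card X" "x = f j"
        using f by (auto simp: bij_betw_def)
      ultimately show "y \<in> (\<Union>j. B j)" by (auto simp: B_def intro!: exI[of _ j])
    qed
    then have "hausdorff_pre ?k (2 * d) ?S \<le> (\<Sum>j. hausdorff_gauge ?k (B j))"
      unfolding hausdorff_pre_def using d by (intro INF_lower) (auto simp: B_def)
    also have "\<dots> = (\<Sum>j<card X. hausdorff_gauge ?k (B j))"
      by (intro suminf_finite) (auto simp: B_def hausdorff_gauge_def)
    also have "\<dots> = (\<Sum>j<card X. ennreal (unit_ball_vol (real ?k) * d ^ ?k))"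
      using d by (intro sum.cong) (auto simp: B_def hausdorff_gauge_def)
    also have "\<dots> = ennreal (unit_ball_vol (real ?k) * (real (card X) * d ^ ?k))"
      using d by (simp add: ennreal_mult ennreal_of_nat_eq_real_of_nat ac_simps)
    also have "\<dots> \<le> ennreal C"
      unfolding C_def using bound[OF X(1)] by (intro ennreal_leI mult_left_mono) auto
    finally show ?thesis .
  qed
  have "hausdorff_outer ?k ?S \<le> ennreal C"
    unfolding hausdorff_outer_def
  proof (rule SUP_least)
    fix \<delta> :: real assume "\<delta> \<in> {0<..}"
    then have "hausdorff_pre ?k \<delta> ?S \<le> hausdorff_pre ?k (2 * min 1 (\<delta> / 2)) ?S"
      by (intro hausdorff_pre_antimono) auto
    also have "\<dots> \<le> ennreal C" using \<open>\<delta> \<in> {0<..}\<close> by (intro pre) auto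
    finally show "hausdorff_pre ?k \<delta> ?S \<le> ennreal C" .
  qed
  also have "\<dots> < \<infinity>" by simp
  finally show ?thesis .
qed

text \<open>The part \<open>|y| \<ge> 1 - d\<close> of the cone over \<open>cball x d\<close> lies in \<open>cball x (2 * d)\<close> and carries at least the fraction \<open>d\<close> of the
  volume of the cone.  The case \<open>d = 0\<close> is the limit of larger radii; in dimension one it
  relies on \<open>0 ^ 0 = 1\<close>.\<close>

lemma cone_measure_cball_le:
  fixes x :: "'a::euclidean_space"
  assumes x: "norm x = 1" and d: "0 \<le> d" "d < 1"
  shows "emeasure cone_measure (cball x d) \<le> ennreal (unit_ball_vol DIM('a) * 2 ^ DIM('a) * d ^ (DIM('a) - 1))"
proof -
  let ?N = "DIM('a)"
  interpret C: finite_measure "cone_measure :: 'a measure" by (rule finite_cone_measure)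
  have pos: "emeasure cone_measure (cball x d) \<le> ennreal (unit_ball_vol ?N * 2 ^ ?N * d ^ (?N - 1))"
    if d: "0 < d" "d < 1" for d
  proof -
    define s where "s = measure cone_measure (cball x d)"
    have s: "emeasure cone_measure (cball x d) = ennreal s" "0 \<le> s"
      by (auto simp: s_def C.emeasure_eq_measure)
    have sub: "cone (cball x d) 1 \<subseteq> cone (cball x d) (1 - d) \<union> cball x (2 * d)"
    proof
      fix y assume y: "y \<in> cone (cball x d) 1"
      show "y \<in> cone (cball x d) (1 - d) \<union> cball x (2 * d)"
      proof (cases "norm y < 1 - d")
        case False
        have "norm y *\<^sub>R sgn y = y" by (cases "y = 0") (simp_all add: sgn_div_norm)
        then have "sgn y - y = (1 - norm y) *\<^sub>R sgn y" by (simp add: scaleR_diff_left)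
        then have "dist (sgn y) y = norm ((1 - norm y) *\<^sub>R sgn y)" by (simp add: dist_norm)
        also have "\<dots> \<le> d" using y False by (simp add: cone_def norm_sgn)
        finally have "dist x y \<le> 2 * d"
          using y dist_triangle[of x y "sgn y"] by (simp add: cone_def)
        then show ?thesis by simp
      qed (use y in \<open>auto simp: cone_def\<close>)
    qed
    have "ennreal s = emeasure lborel (cone (cball x d) 1)"
      by (simp add: s(1)[symmetric] emeasure_cone_measure)
    also have "\<dots> \<le> emeasure lborel (cone (cball x d) (1 - d) \<union> cball x (2 * d))"
      by (intro emeasure_mono sub) auto
    also have "\<dots> \<le> emeasure lborel (cone (cball x d) (1 - d)) + emeasure lborel (cball x (2 * d))"
      by (intro emeasure_subadditive) auto
    also have "\<dots> = ennreal ((1 - d) ^ ?N * s + unit_ball_vol ?N * (2 * d) ^ ?N)"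
      using d s by (simp add: emeasure_cone emeasure_cball ennreal_mult)
    finally have "s \<le> (1 - d) ^ ?N * s + unit_ball_vol ?N * (2 * d) ^ ?N"
      using d s by (subst (asm) ennreal_le_iff) auto
    moreover have "(1 - d) ^ ?N * s \<le> (1 - d) * s"
      using d s power_decreasing[of 1 ?N "1 - d"] by (intro mult_right_mono) (auto simp: Suc_leI)
    ultimately have "s * d \<le> unit_ball_vol ?N * (2 * d) ^ ?N"
      by (simp add: algebra_simps)
    also have "(2 * d) ^ ?N = 2 ^ ?N * d ^ (?N - 1) * d"
      using power_minus_mult[of ?N d] by (simp add: power_mult_distrib mult.assoc)
    finally have "s \<le> unit_ball_vol ?N * 2 ^ ?N * d ^ (?N - 1)"
      using d by (simp add: mult.assoc[symmetric])
    then show ?thesis unfolding s by (rule ennreal_leI)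
  qed
  show ?thesis
  proof (rule tendsto_lowerbound)
    show "((\<lambda>t. ennreal (unit_ball_vol ?N * 2 ^ ?N * t ^ (?N - 1))) \<longlongrightarrow>
      ennreal (unit_ball_vol ?N * 2 ^ ?N * d ^ (?N - 1))) (at_right d)"
      by (intro tendsto_ennrealI tendsto_intros)
    have "eventually (\<lambda>t. t \<in> {d<..<1}) (at_right d)"
      using d by (intro eventually_at_right_real) auto
    then show "eventually (\<lambda>t. emeasure cone_measure (cball x d) \<le>
        ennreal (unit_ball_vol ?N * 2 ^ ?N * t ^ (?N - 1))) (at_right d)"
    proof eventually_elim
      case (elim t)
      have "emeasure cone_measure (cball x d) \<le> emeasure cone_measure (cball x t)"
        using elim by (intro emeasure_mono) auto
      also have "\<dots> \<le> ennreal (unit_ball_vol ?N * 2 ^ ?N * t ^ (?N - 1))"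
        using elim d by (intro pos) auto
      finally show ?case .
    qed
  qed auto
qed

text \<open>The cone measure of a set is at most a constant times its gauge, so a cover of the sphere cannot have small total gauge.\<close>

lemma hausdorff_outer_sphere_pos:
  "0 < hausdorff_outer (DIM('a) - 1) (sphere (0::'a::euclidean_space) 1)"
proof (rule ccontr)
  let ?N = "DIM('a)" and ?k = "DIM('a) - 1" and ?S = "sphere (0::'a) 1"
  assume "\<not> ?thesis"
  then have zero: "hausdorff_outer ?k ?S = 0" by (simp add: zero_less_iff_neq_zero)
  \<comment> \<open>The quotient of the bound in \<open>cone_measure_cball_le\<close> by the Hausdorff gauge.\<close>
  define K where "K = unit_ball_vol ?N * 2 ^ ?N * 2 ^ ?k / unit_ball_vol ?k"
  have K: "K > 0" by (simp add: K_def)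
  have pre: "emeasure cone_measure ?S \<le> ennreal K * hausdorff_pre ?k (1 / 2) ?S"
  proof -
    have "emeasure cone_measure ?S / ennreal K \<le> hausdorff_pre ?k (1 / 2) ?S"
      unfolding hausdorff_pre_def
    proof (rule INF_greatest)
      fix C :: "nat \<Rightarrow> 'a set"
      assume "C \<in> {C. ?S \<subseteq> (\<Union>j. C j) \<and> (\<forall>j. bounded (C j) \<and> diameter (C j) \<le> 1 / 2)}"
      then have C: "?S \<subseteq> (\<Union>j. C j)" "\<And>j. bounded (C j)" "\<And>j. diameter (C j) \<le> 1 / 2" by auto
      define X where "X j = (SOME x. x \<in> C j \<inter> ?S)" for j
      have X: "X j \<in> C j \<inter> ?S" if "C j \<inter> ?S \<noteq> {}" for j
        using that unfolding X_def some_in_eq .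
      define B where "B j = (if C j \<inter> ?S = {} then {} else cball (X j) (diameter (C j)))" for j
      have [measurable]: "B j \<in> sets borel" for j by (simp add: B_def)
      have le: "emeasure cone_measure (B j) \<le> ennreal K * hausdorff_gauge ?k (C j)"
        and sub: "C j \<inter> ?S \<subseteq> B j" for j
      proof -
        show "emeasure cone_measure (B j) \<le> ennreal K * hausdorff_gauge ?k (C j)"
        proof (cases "C j \<inter> ?S = {}")
          case False
          have "norm (X j) = 1" using X[OF False] by simp
          moreover have "0 \<le> diameter (C j)" "diameter (C j) < 1"
            using C(3)[of j] diameter_ge_0[OF C(2)[of j]] by simp_all
          ultimately have "emeasure cone_measure (cball (X j) (diameter (C j))) \<le>
              ennreal (unit_ball_vol ?N * 2 ^ ?N * diameter (C j) ^ ?k)"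
            by (rule cone_measure_cball_le)
          then have "emeasure cone_measure (B j) \<le> ennreal (unit_ball_vol ?N * 2 ^ ?N * diameter (C j) ^ ?k)"
            using False unfolding B_def by (simp only: if_False)
          also have "unit_ball_vol ?N * 2 ^ ?N * diameter (C j) ^ ?k
              = K * (unit_ball_vol ?k * (diameter (C j) / 2) ^ ?k)"
            using unit_ball_vol_pos[of ?k] by (simp add: K_def power_divide del: unit_ball_vol_pos)
          finally show ?thesis
            using False K by (auto simp: hausdorff_gauge_def ennreal_mult')
        next
          case True
          then have "B j = {}" unfolding B_def by (rule if_P)
          then show ?thesis by simp
        qed
        show "C j \<inter> ?S \<subseteq> B j"
        proof
          fix y assume y: "y \<in> C j \<inter> ?S"
          then have ne: "C j \<inter> ?S \<noteq> {}" by blast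
          have "dist (X j) y \<le> diameter (C j)"
            using X[OF ne] y by (intro diameter_bounded_bound[OF C(2)]) auto
          then show "y \<in> B j"
            using ne unfolding B_def by (simp only: if_False mem_cball)
        qed
      qed
      have "?S \<subseteq> (\<Union>j. B j)" using C(1) sub by blast
      then have "emeasure cone_measure ?S \<le> emeasure cone_measure (\<Union>j. B j)"
        by (intro emeasure_mono) auto
      also have "\<dots> \<le> (\<Sum>j. emeasure cone_measure (B j))"
        by (intro emeasure_subadditive_countably) auto
      also have "\<dots> \<le> (\<Sum>j. ennreal K * hausdorff_gauge ?k (C j))"
        by (intro suminf_le le summableI)
      also have "\<dots> = ennreal K * (\<Sum>j. hausdorff_gauge ?k (C j))"
        by simp
      finally have "emeasure cone_measure ?S / ennreal K \<le> ennreal K * (\<Sum>j. hausdorff_gauge ?k (C j)) / ennreal K"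
        by (rule divide_right_mono_ennreal)
      also have "\<dots> = (\<Sum>j. hausdorff_gauge ?k (C j))"
        using ennreal_mult_divide_eq[of "ennreal K" "\<Sum>j. hausdorff_gauge ?k (C j)"] K
        by (simp add: mult.commute)
      finally show "emeasure cone_measure ?S / ennreal K \<le> (\<Sum>j. hausdorff_gauge ?k (C j))" .
    qed
    then have "ennreal K * (emeasure cone_measure ?S / ennreal K) \<le> ennreal K * hausdorff_pre ?k (1 / 2) ?S"
      by (rule mult_left_mono) simp
    moreover have "ennreal K * (emeasure cone_measure ?S / ennreal K) = emeasure cone_measure ?S"
      using K ennreal_mult_divide_eq[of "ennreal K" "emeasure cone_measure ?S"]
      by (simp add: ennreal_times_divide mult.commute)
    ultimately show ?thesis by simp
  qed
  have "hausdorff_pre ?k (1 / 2) ?S \<le> hausdorff_outer ?k ?S"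
    unfolding hausdorff_outer_def by (intro SUP_upper) auto
  with pre zero have S0: "emeasure cone_measure ?S = 0" by simp
  have "emeasure (cone_measure :: 'a measure) UNIV \<le> emeasure cone_measure (?S \<union> - ?S)"
    by (intro emeasure_mono) auto
  also have "\<dots> \<le> emeasure cone_measure ?S + emeasure cone_measure (- ?S)"
    by (intro emeasure_subadditive) auto
  finally show False using S0 cone_measure_sphere[where 'a='a] cone_measure_pos[where 'a='a] by simp
qed

text \<open>The Hausdorff measure is restricted to the Borel sets, so that it lives on the same \<open>\<sigma>\<close>-algebra as Lebesgue measure and
  product measures can be formed.\<close>

definition hausdorff_sphere :: "'a::euclidean_space measure"
  where "hausdorff_sphere = density (distr (hausdorff_measure (DIM('a) - 1)) borel (\<lambda>x. x)) (indicator (sphere 0 1))"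

lemma sphere_borel[measurable]: "sphere (a::'a::euclidean_space) r \<in> sets borel"
  by (simp add: borel_closed)

lemma measurable_id_hausdorff:
  "(\<lambda>x. x) \<in> measurable (hausdorff_measure k :: 'a::euclidean_space measure) borel"
  using borel_subset_sets_hausdorff[where 'a='a, of k]
  by (intro measurableI) (auto simp: space_hausdorff_measure)

lemma sets_hausdorff_sphere[simp, measurable_cong]: "sets hausdorff_sphere = sets borel"
  by (simp add: hausdorff_sphere_def)

lemma nn_integral_hausdorff_sphere:
  fixes f :: "'a::euclidean_space \<Rightarrow> ennreal"
  assumes [measurable]: "f \<in> borel_measurable borel"
  shows "(\<integral>\<^sup>+n. f n \<partial>hausdorff_sphere) = (\<integral>\<^sup>+n\<in>sphere 0 1. f n \<partial>hausdorff_measure (DIM('a) - 1))"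
  unfolding hausdorff_sphere_def
  using measurable_id_hausdorff[where 'a='a, of "DIM('a) - 1"]
  by (subst nn_integral_density) (auto simp: nn_integral_distr mult.commute)

lemma emeasure_hausdorff_sphere:
  fixes A :: "'a::euclidean_space set"
  assumes [measurable]: "A \<in> sets borel"
  shows "emeasure hausdorff_sphere A = hausdorff_outer (DIM('a) - 1) (sphere 0 1 \<inter> A)"
proof -
  have "sphere 0 1 \<inter> A \<in> sets borel" by measurable
  then have 1: "sphere 0 1 \<inter> A \<in> sets (hausdorff_measure (DIM('a) - 1))"
    using borel_subset_sets_hausdorff by blast
  have "emeasure hausdorff_sphere A = (\<integral>\<^sup>+n. indicator A n \<partial>hausdorff_sphere)"
    by simp
  also have "\<dots> = (\<integral>\<^sup>+n\<in>sphere 0 1. indicator A n \<partial>hausdorff_measure (DIM('a) - 1))"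
    by (rule nn_integral_hausdorff_sphere) simp
  also have "\<dots> = (\<integral>\<^sup>+n. indicator (sphere 0 1 \<inter> A) n \<partial>hausdorff_measure (DIM('a) - 1))"
    by (intro nn_integral_cong) (auto split: split_indicator)
  also have "\<dots> = hausdorff_outer (DIM('a) - 1) (sphere 0 1 \<inter> A)"
    using 1 by (simp add: emeasure_hausdorff_measure)
  finally show ?thesis .
qed

lemma finite_hausdorff_sphere: "finite_measure (hausdorff_sphere :: 'a::euclidean_space measure)"
  using hausdorff_outer_sphere_finite[where 'a='a] sets_eq_imp_space_eq[OF sets_hausdorff_sphere[where 'a='a]]
  by (intro finite_measureI) (simp add: emeasure_hausdorff_sphere)

lemma nn_integral_polar:
  "\<exists>\<kappa>>0. \<forall>f \<in> borel_measurable borel. (\<integral>\<^sup>+x. f x \<partial>lborel) =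
    (\<integral>\<^sup>+\<rho>. (\<integral>\<^sup>+n. f (\<rho> *\<^sub>R n) \<partial>(hausdorff_sphere :: 'a::euclidean_space measure)) *
      (ennreal (\<kappa> * \<rho> ^ (DIM('a) - 1)) * indicator {0<..} \<rho>) \<partial>lborel)"
proof -
  let ?k = "DIM('a) - 1" and ?S = "sphere (0::'a) 1" and ?H = "hausdorff_sphere :: 'a measure"
  obtain e :: 'a where e: "norm e = 1" using vector_choose_size[of 1] by auto
  have Hball: "emeasure ?H (ball x r) = emeasure ?H (ball e r)" if "x \<in> ?S" for x r
  proof -
    have ex: "norm e = norm x" using e that by simp
    obtain f :: "'a \<Rightarrow> 'a" where f: "\<And>x y. dist (f x) (f y) = dist x y" "\<And>x. f (f x) = x" "f e = x"
      "\<And>x. norm (f x) = norm x"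
      using isometric_involution_exists[OF ex] by blast
    have dx: "dist x (f z) = dist e z" for z using f(1)[of e z] f(3) by simp
    have "f ` (?S \<inter> ball e r) = ?S \<inter> ball x r"
    proof safe
      fix z assume "z \<in> ?S" "z \<in> ball x r"
      moreover have "f z \<in> ?S \<inter> ball e r" using calculation dx[of "f z"] f(2,4) by auto
      ultimately show "z \<in> f ` (?S \<inter> ball e r)" using f(2) by (metis imageI)
    qed (use f(4) dx in auto)
    moreover have "surj f" using f(2) by (metis surjI)
    ultimately show ?thesis
      using hausdorff_outer_isometry[of f ?k "?S \<inter> ball e r"] f(1) by (simp add: emeasure_hausdorff_sphere)
  qed
  have "\<exists>c. 0 < c \<and> (\<forall>A\<in>sets borel. emeasure (cone_measure :: 'a measure) A = ennreal c * emeasure ?H A)"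
  proof (rule uniformly_distributed_eq[where S = ?S])
    show "emeasure (cone_measure :: 'a measure) (ball x r) = emeasure cone_measure (ball e r)" if "x \<in> ?S" for x r
      using that e by (intro cone_measure_ball_eq) auto
    show "emeasure ?H (ball x r) = emeasure ?H (ball e r)" if "x \<in> ?S" for x r
      by (rule Hball[OF that])
    have "- ?S \<in> sets borel" by measurable
    then show "emeasure ?H (- ?S) = 0"
      by (simp add: emeasure_hausdorff_sphere hausdorff_outer_empty del: sphere_def)
    show "0 < emeasure ?H UNIV"
      using hausdorff_outer_sphere_pos[where 'a='a] by (simp add: emeasure_hausdorff_sphere)
  qed (auto intro: finite_cone_measure finite_hausdorff_sphere simp: cone_measure_sphere cone_measure_pos)
  then obtain c where c: "0 < c" "\<And>A. A \<in> sets borel \<Longrightarrow> emeasure (cone_measure :: 'a measure) A = ennreal c * emeasure ?H A"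
    by blast
  have C: "(cone_measure :: 'a measure) = scale_measure (ennreal c) ?H"
    using c(2) by (intro measure_eqI) auto
  have "(\<integral>\<^sup>+x. f x \<partial>lborel) = (\<integral>\<^sup>+\<rho>. (\<integral>\<^sup>+n. f (\<rho> *\<^sub>R n) \<partial>?H) *
      (ennreal (c * real DIM('a) * \<rho> ^ ?k) * indicator {0<..} \<rho>) \<partial>lborel)"
    if [measurable]: "f \<in> borel_measurable borel" for f :: "'a \<Rightarrow> ennreal"
  proof -
    have "(\<integral>\<^sup>+x. f x \<partial>lborel) = (\<integral>\<^sup>+\<rho>. (\<integral>\<^sup>+n. f (\<rho> *\<^sub>R n) \<partial>cone_measure) *
       (ennreal (real DIM('a) * \<rho> ^ ?k) * indicator {0<..} \<rho>) \<partial>lborel)"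
      by (rule nn_integral_polar_cone_measure) measurable
    also have "\<dots> = (\<integral>\<^sup>+\<rho>. (\<integral>\<^sup>+n. f (\<rho> *\<^sub>R n) \<partial>?H) *
      (ennreal (c * real DIM('a) * \<rho> ^ ?k) * indicator {0<..} \<rho>) \<partial>lborel)"
    proof (intro nn_integral_cong)
      fix \<rho> :: real
      have "(\<lambda>n. f (\<rho> *\<^sub>R n)) \<in> borel_measurable ?H" by measurable
      then have "(\<integral>\<^sup>+n. f (\<rho> *\<^sub>R n) \<partial>cone_measure) = ennreal c * (\<integral>\<^sup>+n. f (\<rho> *\<^sub>R n) \<partial>?H)"
        unfolding C by (rule nn_integral_scale_measure)
      then show "(\<integral>\<^sup>+n. f (\<rho> *\<^sub>R n) \<partial>cone_measure) * (ennreal (real DIM('a) * \<rho> ^ ?k) * indicator {0<..} \<rho>) =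
          (\<integral>\<^sup>+n. f (\<rho> *\<^sub>R n) \<partial>?H) * (ennreal (c * real DIM('a) * \<rho> ^ ?k) * indicator {0<..} \<rho>)"
        using c(1) by (auto simp: ennreal_mult ac_simps split: split_indicator)
    qed
    finally show ?thesis .
  qed
  then show ?thesis using c(1) by (intro exI[of _ "c * real DIM('a)"]) auto
qed

section \<open>Smooth bump functions\<close>

text \<open>For \<open>P = 1\<close> this is the standard smooth function that is flat at \<open>0\<close>.  The polynomial factor makes the family closed under
  differentiation.\<close>

definition flat_fun :: "real poly \<Rightarrow> real \<Rightarrow> real"
  where "flat_fun P t = (if 0 < t then poly P (1 / t) * exp (- 1 / t) else 0)"

definition flat_step :: "real poly \<Rightarrow> real poly"
  where "flat_step P = [:0, 0, 1:] * (P - pderiv P)"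

lemma poly_over_exp_at_top: "((\<lambda>s. poly P s / exp s) \<longlongrightarrow> (0::real)) at_top"
proof -
  have "((\<lambda>s. \<Sum>i\<le>degree P. coeff P i * (s ^ i / exp s)) \<longlongrightarrow> (\<Sum>i\<le>degree P. coeff P i * (0::real))) at_top"
    by (intro tendsto_sum tendsto_mult tendsto_const tendsto_power_div_exp_0)
  then show ?thesis by (simp add: poly_altdef sum_divide_distrib)
qed

lemma flat_fun_deriv: "(flat_fun P has_real_derivative flat_fun (flat_step P) t) (at t)"
proof -
  consider "t > 0" | "t < 0" | "t = 0" by linarith
  then show ?thesis
  proof cases
    case 1
    have "((\<lambda>t. poly P (1 / t) * exp (- 1 / t)) has_real_derivative flat_fun (flat_step P) t) (at t)"
      using 1 by (auto intro!: derivative_eq_intros poly_DERIV[THEN DERIV_chain2]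
          simp: flat_fun_def flat_step_def field_simps power2_eq_square)
    moreover have "eventually (\<lambda>s. s \<in> {0<..}) (nhds t)"
      using 1 by (intro eventually_nhds_in_open) auto
    then have "eventually (\<lambda>s. flat_fun P s = poly P (1 / s) * exp (- 1 / s)) (nhds t)"
      by eventually_elim (simp add: flat_fun_def)
    ultimately show ?thesis by (simp add: DERIV_cong_ev)
  next
    case 2
    have "eventually (\<lambda>s. s \<in> {..<0}) (nhds t)"
      using 2 by (intro eventually_nhds_in_open) auto
    then have "eventually (\<lambda>s. flat_fun P s = 0) (nhds t)"
      by eventually_elim (simp add: flat_fun_def)
    then have "(flat_fun P has_real_derivative 0) (at t) = ((\<lambda>_. 0) has_real_derivative 0) (at t)"
      by (intro DERIV_cong_ev) auto
    then show ?thesis using 2 by (simp add: flat_fun_def)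
  next
    case 3
    \<comment> \<open>The exponential beats the polynomial in \<open>1 / h\<close>, including the factor \<open>1 / h\<close> of the difference quotient.\<close>
    have "((\<lambda>h. flat_fun P h / h) \<longlongrightarrow> 0) (at 0)"
    proof (rule filterlim_split_at)
      have "((\<lambda>h. flat_fun P h / h) \<longlongrightarrow> 0) (at_left 0) = ((\<lambda>h::real. 0::real) \<longlongrightarrow> 0) (at_left 0)"
        by (intro filterlim_cong refl eventually_at_leftI[of "-1"]) (auto simp: flat_fun_def)
      then show "((\<lambda>h. flat_fun P h / h) \<longlongrightarrow> 0) (at_left 0)" by simp
      have "((\<lambda>h. (\<lambda>s. poly ([:0, 1:] * P) s / exp s) (inverse h)) \<longlongrightarrow> 0) (at_right 0)"
        by (rule filterlim_compose[OF poly_over_exp_at_top filterlim_inverse_at_top_right])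
      moreover have "eventually (\<lambda>h. (\<lambda>s. poly ([:0, 1:] * P) s / exp s) (inverse h) = flat_fun P h / h) (at_right (0::real))"
        by (intro eventually_at_rightI[of 0 1]) (auto simp: flat_fun_def exp_minus field_simps)
      ultimately show "((\<lambda>h. flat_fun P h / h) \<longlongrightarrow> 0) (at_right 0)"
        by (simp only: filterlim_cong[OF refl refl])
    qed
    then show ?thesis unfolding 3 DERIV_def by (simp add: flat_fun_def)
  qed
qed

lemma partial_deriv_eq:
  "(f has_derivative f') (at x) \<Longrightarrow> partial_deriv i f x = f' i"
  unfolding partial_deriv_def by (metis frechet_derivative_at)

lemma differentiable_has_partial:
  assumes "f differentiable_on UNIV"
  shows "(f has_derivative (\<lambda>h. frechet_derivative f (at x) h)) (at x)"
  using assms by (simp add: differentiable_on_def frechet_derivative_works[symmetric])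

lemma C_k_SucD: "C_k (Suc k) f \<Longrightarrow> C_k k f"
  by (induction k arbitrary: f) (auto intro: differentiable_imp_continuous_on)

lemma C_k_const: "C_k k (\<lambda>_. c)"
proof (induction k arbitrary: c)
  case (Suc k)
  have "partial_deriv i (\<lambda>_. c) = (\<lambda>_. 0)" for i :: 'a
    by (rule ext) (simp add: partial_deriv_eq[OF has_derivative_const])
  then show ?case using Suc[of 0] by simp
qed (simp)

lemma C_k_add:
  assumes "C_k k f" "C_k k g" shows "C_k k (\<lambda>x. f x + g x)"
  using assms
proof (induction k arbitrary: f g)
  case (Suc k)
  have d: "f differentiable_on UNIV" "g differentiable_on UNIV" using Suc.prems by auto
  have "partial_deriv i (\<lambda>x. f x + g x) = (\<lambda>x. partial_deriv i f x + partial_deriv i g x)" for i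
    by (rule ext, subst partial_deriv_eq[OF has_derivative_add[OF d[THEN differentiable_has_partial]]])
       (simp add: partial_deriv_def)
  then show ?case using Suc by (auto intro: differentiable_on_add)
qed (auto intro: continuous_intros)

lemma C_k_mult:
  assumes "C_k k f" "C_k k g" shows "C_k k (\<lambda>x. f x * g x)"
  using assms
proof (induction k arbitrary: f g)
  case (Suc k)
  have d: "f differentiable_on UNIV" "g differentiable_on UNIV" using Suc.prems by auto
  have "partial_deriv i (\<lambda>x. f x * g x) = (\<lambda>x. f x * partial_deriv i g x + partial_deriv i f x * g x)" for i
    by (rule ext, subst partial_deriv_eq[OF has_derivative_mult[OF d[THEN differentiable_has_partial]]])
       (simp add: partial_deriv_def)
  moreover have "C_k k f" "C_k k g" using Suc.prems by (auto intro: C_k_SucD)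
  ultimately show ?case using Suc by (auto intro!: C_k_add differentiable_on_mult)
qed (auto intro: continuous_intros)

lemma C_k_prod:
  assumes "\<And>i. i \<in> I \<Longrightarrow> C_k k (f i)" shows "C_k k (\<lambda>x. \<Prod>i\<in>I. f i x)"
  using assms by (induction I rule: infinite_finite_induct) (simp_all add: C_k_const C_k_mult)

lemma C_k_inner: "C_k k (\<lambda>x. x \<bullet> j)"
proof (cases k)
  case (Suc m)
  have "partial_deriv i (\<lambda>x. x \<bullet> j) = (\<lambda>_. i \<bullet> j)" for i
    by (rule ext) (simp add: partial_deriv_eq[OF has_derivative_inner_left[OF has_derivative_ident]])
  then show ?thesis by (simp add: Suc C_k_const differentiable_on_def)
qed (auto intro: continuous_intros)

text \<open>The sequence \<open>\<theta>\<close> lists an outer function and all its derivatives, so that the induction over the order can shift \<open>j\<close>.\<close>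

lemma C_k_compose:
  fixes \<theta> :: "nat \<Rightarrow> real \<Rightarrow> real"
  assumes \<theta>: "\<And>j t. (\<theta> j has_real_derivative \<theta> (Suc j) t) (at t)" and w: "\<And>k. C_k k w"
  shows "C_k k (\<lambda>x. \<theta> j (w x))"
proof (induction k arbitrary: j)
  case 0
  have "continuous_on UNIV (\<theta> j)"
    using \<theta>[of j] DERIV_isCont continuous_at_imp_continuous_on by blast
  moreover have "continuous_on UNIV w" using w[of 0] by simp
  ultimately show ?case by (auto intro: continuous_on_compose2)
next
  case (Suc k)
  have d: "w differentiable_on UNIV" using w[of 1] by simp
  have D: "((\<lambda>x. \<theta> j (w x)) has_derivative (\<lambda>h. frechet_derivative w (at x) h * \<theta> (Suc j) (w x))) (at x)" for x
    using \<theta>[of j "w x"] differentiable_has_partial[OF d, of x]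
    by (auto intro: DERIV_compose_FDERIV)
  have "partial_deriv i (\<lambda>x. \<theta> j (w x)) = (\<lambda>x. partial_deriv i w x * \<theta> (Suc j) (w x))" for i
    by (rule ext, subst partial_deriv_eq[OF D]) (simp add: partial_deriv_def)
  moreover have "C_k k (partial_deriv i w)" if "i \<in> Basis" for i using w[of "Suc k"] that by simp
  moreover have "(\<lambda>x. \<theta> j (w x)) differentiable_on UNIV"
    using D by (auto simp: differentiable_on_def differentiable_def)
  ultimately show ?case using Suc[of "Suc j"] by (auto intro!: C_k_mult)
qed

text \<open>The exponent \<open>- 1 / (n s)\<close> tends to \<open>0\<close> for every \<open>s > 0\<close>, so that the bumps converge to the indicator of the open box while all
  of them vanish outside it.\<close>

definition bump :: "'a::euclidean_space \<Rightarrow> 'a \<Rightarrow> nat \<Rightarrow> 'a \<Rightarrow> real"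
  where "bump a b n x = (\<Prod>i\<in>Basis. flat_fun 1 (real n * ((x \<bullet> i - a \<bullet> i) * (b \<bullet> i - x \<bullet> i))))"

lemma flat_fun_1_bounds: "0 \<le> flat_fun 1 t" "flat_fun 1 t \<le> 1"
  by (auto simp: flat_fun_def)

lemma bump_bounds: "0 \<le> bump a b n x" "bump a b n x \<le> 1"
  unfolding bump_def by (auto intro!: prod_nonneg prod_le_1 simp: flat_fun_1_bounds)

lemma bump_outside:
  assumes "\<And>i. i \<in> Basis \<Longrightarrow> a \<bullet> i < b \<bullet> i" "x \<notin> box a b"
  shows "bump a b n x = 0"
proof -
  obtain i where i: "i \<in> Basis" "\<not> (a \<bullet> i < x \<bullet> i \<and> x \<bullet> i < b \<bullet> i)"
    using assms(2) by (auto simp: mem_box)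
  have "(x \<bullet> i - a \<bullet> i) * (b \<bullet> i - x \<bullet> i) \<le> 0"
    using i(2) assms(1)[OF i(1)] by (auto simp: mult_le_0_iff)
  then have "real n * ((x \<bullet> i - a \<bullet> i) * (b \<bullet> i - x \<bullet> i)) \<le> 0"
    by (simp add: mult_nonneg_nonpos)
  then have "flat_fun 1 (real n * ((x \<bullet> i - a \<bullet> i) * (b \<bullet> i - x \<bullet> i))) = 0"
    by (simp add: flat_fun_def)
  then show ?thesis unfolding bump_def using i(1) by (auto intro: prod_zero)
qed

lemma bump_tendsto_indicator:
  assumes "\<And>i. i \<in> Basis \<Longrightarrow> a \<bullet> i < b \<bullet> i"
  shows "(\<lambda>n. bump a b n x) \<longlonglongrightarrow> indicator (box a b) x"
proof (cases "x \<in> box a b")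
  case True
  have "(\<lambda>n. flat_fun 1 (real n * c)) \<longlonglongrightarrow> 1" if c: "c > 0" for c
  proof -
    have "filterlim (\<lambda>n. real n * c) at_top sequentially"
      by (intro filterlim_at_top_mult_tendsto_pos[OF tendsto_const c filterlim_real_sequentially])
    then have "(\<lambda>n. exp (- 1 / (real n * c))) \<longlonglongrightarrow> exp 0"
      by (intro tendsto_exp real_tendsto_divide_at_top[OF tendsto_const])
    moreover have "eventually (\<lambda>n. exp (- 1 / (real n * c)) = flat_fun 1 (real n * c)) sequentially"
      using eventually_gt_at_top[of 0] by eventually_elim (use c in \<open>simp add: flat_fun_def\<close>)
    ultimately show ?thesis by (simp add: filterlim_cong)
  qed
  then have "(\<lambda>n. bump a b n x) \<longlonglongrightarrow> (\<Prod>i\<in>(Basis::'a set). 1)"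
    unfolding bump_def using True by (intro tendsto_prod) (auto simp: mem_box)
  then show ?thesis using True by simp
qed (simp add: bump_outside[OF assms])

lemma C_k_bump: "C_k k (bump a b n)"
proof -
  define \<theta> where "\<theta> j = flat_fun ((flat_step ^^ j) 1)" for j
  have \<theta>: "(\<theta> j has_real_derivative \<theta> (Suc j) t) (at t)" for j t
    unfolding \<theta>_def using flat_fun_deriv by simp
  have w: "C_k k (\<lambda>x. real n * ((x \<bullet> i - a \<bullet> i) * (b \<bullet> i - x \<bullet> i)))" for k and i :: 'a
  proof -
    have "C_k k (\<lambda>x. real n * ((x \<bullet> i + (- (a \<bullet> i))) * (b \<bullet> i + (- 1) * (x \<bullet> i))))"
      by (intro C_k_mult C_k_add C_k_const C_k_inner)
    then show ?thesis by simp
  qed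
  have "C_k k (\<lambda>x. \<Prod>i\<in>Basis. \<theta> 0 (real n * ((x \<bullet> i - a \<bullet> i) * (b \<bullet> i - x \<bullet> i))))"
    by (rule C_k_prod) (rule C_k_compose[where \<theta> = \<theta> and j = 0, OF \<theta> w])
  then show ?thesis unfolding bump_def[abs_def] by (simp add: \<theta>_def)
qed

lemma test_fun_bump:
  assumes "\<And>i. i \<in> Basis \<Longrightarrow> a \<bullet> i < b \<bullet> i"
  shows "test_fun (bump a b n)"
proof -
  have "closure {x. bump a b n x \<noteq> 0} \<subseteq> cbox a b"
    using bump_outside[OF assms] box_subset_cbox[of a b] by (intro closure_minimal) blast+
  then show ?thesis
    unfolding test_fun_def using C_k_bump compact_cbox by (metis closed_closure compact_Int_closed inf.absorb_iff2)
qed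

lemma bump_diff: "bump a b n (x - c) = bump (a + c) (b + c) n x"
  unfolding bump_def by (intro prod.cong refl arg_cong[where f = "flat_fun 1"])
    (simp add: inner_diff_left inner_add_left algebra_simps)

lemma bump_differentiable: "(bump a b n has_derivative frechet_derivative (bump a b n) (at x)) (at x)"
  using C_k_bump[of 1 a b n] by (intro differentiable_has_partial) simp

lemma continuous_partial_deriv_bump: "i \<in> Basis \<Longrightarrow> continuous_on UNIV (partial_deriv i (bump a b n))"
  using C_k_bump[of "Suc 0" a b n] by simp

lemma partial_deriv_bump_diff:
  "partial_deriv i (bump a b n) (x - c) = partial_deriv i (bump (a + c) (b + c) n) x"
proof -
  have "((\<lambda>x. bump a b n (x - c)) has_derivative frechet_derivative (bump a b n) (at (x - c))) (at x)"
    by (rule has_derivative_compose[where f = "\<lambda>x. x - c" and f' = "\<lambda>h. h", OF _ bump_differentiable])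
       (auto intro!: derivative_eq_intros)
  then have "(bump (a + c) (b + c) n has_derivative frechet_derivative (bump a b n) (at (x - c))) (at x)"
    by (simp add: bump_diff)
  from partial_deriv_eq[OF this, of i] show ?thesis by (simp add: partial_deriv_def)
qed

lemma partial_deriv_bump_bounded:
  assumes ab: "\<And>i. i \<in> Basis \<Longrightarrow> a \<bullet> i < b \<bullet> i" and i: "i \<in> Basis"
  shows "\<exists>C. \<forall>x. \<bar>partial_deriv i (bump a b n) x\<bar> \<le> C"
proof -
  have "compact (partial_deriv i (bump a b n) ` cbox a b)"
    using continuous_partial_deriv_bump[OF i] by (intro compact_continuous_image) (auto intro: continuous_on_subset)
  then obtain C where C: "\<forall>x\<in>cbox a b. \<bar>partial_deriv i (bump a b n) x\<bar> \<le> C"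
    by (auto dest!: compact_imp_bounded simp: bounded_iff)
  have "partial_deriv i (bump a b n) x = 0" if x: "x \<notin> cbox a b" for x
  proof -
    have "eventually (\<lambda>y. y \<in> - cbox a b) (nhds x)"
      using x by (intro eventually_nhds_in_open) (auto simp: open_Compl closed_cbox)
    then have ev: "eventually (\<lambda>y. bump a b n y = 0) (nhds x)"
      by eventually_elim (metis ComplD ab box_subset_cbox bump_outside subsetD)
    have "(bump a b n has_derivative (\<lambda>_. 0)) (at x)"
      using has_derivative_transform_eventually[OF has_derivative_const[of 0 "at x"], of "bump a b n"] ev
      by (auto simp: eventually_nhds_conv_at eventually_mono)
    from partial_deriv_eq[OF this] show ?thesis by simp
  qed
  then have "\<bar>partial_deriv i (bump a b n) x\<bar> \<le> max C 0" for x
    using C by (cases "x \<in> cbox a b") auto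
  then show ?thesis by blast
qed

text \<open>In the limit \<open>n \<rightarrow> \<infinity>\<close> the integral of \<open>F\<close> over every open box vanishes.  Hence the measures with densities \<open>F\<close> and
  \<open>- F\<close> (cut off at \<open>0\<close>) agree on boxes, which generate the Borel sets.\<close>

lemma AE_zero_if_integral_bump_zero:
  fixes F :: "'a::euclidean_space \<Rightarrow> real"
  assumes F: "integrable lborel F"
    and zero: "\<And>a b n. (\<And>i. i \<in> Basis \<Longrightarrow> a \<bullet> i < b \<bullet> i) \<Longrightarrow> (LINT x|lborel. F x * bump a b n x) = 0"
  shows "AE x in lborel. F x = 0"
proof -
  have [measurable]: "F \<in> borel_measurable borel" using F by simp
  have [measurable]: "bump a b n \<in> borel_measurable borel" for a b :: 'a and n
    using C_k_bump[of 0 a b n] by (auto intro: borel_measurable_continuous_onI)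
  have box0: "(LINT x|lborel. F x * indicator (box a b) x) = 0" for a b
  proof (cases "box a b = {}")
    case False
    then have ab: "a \<bullet> i < b \<bullet> i" if "i \<in> Basis" for i using that by (auto simp: box_ne_empty)
    have "(\<lambda>n. LINT x|lborel. F x * bump a b n x) \<longlonglongrightarrow> (LINT x|lborel. F x * indicator (box a b) x)"
    proof (rule integral_dominated_convergence[where w = "\<lambda>x. \<bar>F x\<bar>"])
      show "AE x in lborel. (\<lambda>n. F x * bump a b n x) \<longlonglongrightarrow> F x * indicator (box a b) x"
        by (intro AE_I2 tendsto_mult tendsto_const bump_tendsto_indicator ab)
      show "AE x in lborel. norm (F x * bump a b n x) \<le> \<bar>F x\<bar>" for n
        by (intro AE_I2) (auto simp: abs_mult bump_bounds intro!: mult_left_le)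
    qed (use F in auto)
    then show ?thesis using zero[OF ab] LIMSEQ_unique[OF _ tendsto_const] by fastforce
  qed simp
  have emb: "emeasure (density lborel (\<lambda>x. ennreal (F x))) X = emeasure (density lborel (\<lambda>x. ennreal (- F x))) X"
    if X_in: "X \<in> range (\<lambda>(a, b). box a b :: 'a set)" for X
  proof -
    obtain a b where X: "X = box a b" using X_in by auto
    let ?I = "indicator (box a b) :: 'a \<Rightarrow> real"
    have int: "integrable lborel (\<lambda>x. max 0 (F x) * ?I x)" "integrable lborel (\<lambda>x. max 0 (- F x) * ?I x)"
      using F by (auto intro!: integrable_real_mult_indicator)
    have "(LINT x|lborel. max 0 (F x) * ?I x) - (LINT x|lborel. max 0 (- F x) * ?I x)
        = (LINT x|lborel. F x * ?I x)"
      by (subst Bochner_Integration.integral_diff[symmetric, OF int])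
         (auto intro!: Bochner_Integration.integral_cong simp: max_def split: split_indicator)
    then have eq: "(LINT x|lborel. max 0 (F x) * ?I x) = (LINT x|lborel. max 0 (- F x) * ?I x)"
      using box0 by simp
    have "emeasure (density lborel (\<lambda>x. ennreal (F x))) X = (\<integral>\<^sup>+x. ennreal (max 0 (F x) * ?I x) \<partial>lborel)"
      unfolding X by (subst emeasure_density)
        (auto intro!: nn_integral_cong simp: max_def ennreal_neg split: split_indicator)
    also have "\<dots> = (\<integral>\<^sup>+x. ennreal (max 0 (- F x) * ?I x) \<partial>lborel)"
      using nn_integral_eq_integral[OF int(1)] nn_integral_eq_integral[OF int(2)] eq by simp
    also have "\<dots> = emeasure (density lborel (\<lambda>x. ennreal (- F x))) X"
      unfolding X by (subst emeasure_density)
        (auto intro!: nn_integral_cong simp: max_def ennreal_neg split: split_indicator)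
    finally show ?thesis .
  qed
  have "density lborel (\<lambda>x. ennreal (F x)) = density lborel (\<lambda>x. ennreal (- F x))"
  proof (rule measure_eqI_generator_eq[of "range (\<lambda>(a, b). box a b)" UNIV _ _ "\<lambda>n. box (- (real n *\<^sub>R One)) (real n *\<^sub>R One)"])
    show "Int_stable (range (\<lambda>(a, b). box a b :: 'a set))"
      by (auto simp: Int_stable_def box_Int_box)
    show "(\<Union>n. box (- (real n *\<^sub>R One)) (real n *\<^sub>R One)) = (UNIV :: 'a set)"
      by (rule UN_box_eq_UNIV)
    show "emeasure (density lborel (\<lambda>x. ennreal (F x))) (box (- (real n *\<^sub>R One)) (real n *\<^sub>R One)) \<noteq> \<infinity>" for n
    proof -
      have "emeasure (density lborel (\<lambda>x. ennreal (F x))) (box (- (real n *\<^sub>R One)) (real n *\<^sub>R One))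
          \<le> (\<integral>\<^sup>+x. ennreal (norm (F x)) \<partial>lborel)"
        by (subst emeasure_density) (auto intro!: nn_integral_mono ennreal_leI split: split_indicator)
      also have "\<dots> < \<infinity>" using F by (simp add: integrable_iff_bounded)
      finally show ?thesis by simp
    qed
  qed (use emb in \<open>auto simp: borel_eq_box\<close>)
  then have "AE x in lborel. ennreal (F x) = ennreal (- F x)"
    by (intro sigma_finite_measure.density_unique[OF lborel.sigma_finite_measure_axioms]) auto
  then show ?thesis
    by eventually_elim (metis ennreal_eq_0_iff ennreal_inj ennreal_neg linorder_le_cases neg_0_le_iff_le neg_equal_0_iff_equal neg_le_0_iff_le order_antisym)
qed

section \<open>Translations of Sobolev functions in the mean\<close>

lemma nn_integral_lborel_shift:
  fixes f :: "'a::euclidean_space \<Rightarrow> ennreal"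
  assumes [measurable]: "f \<in> borel_measurable borel"
  shows "(\<integral>\<^sup>+x. f (x + c) \<partial>lborel) = (\<integral>\<^sup>+x. f x \<partial>lborel)"
proof -
  have "(\<integral>\<^sup>+x. f x \<partial>lborel) = (\<integral>\<^sup>+x. f x \<partial>distr lborel borel ((+) c))"
    by (simp add: lborel_distr_plus)
  also have "\<dots> = (\<integral>\<^sup>+x. f (x + c) \<partial>lborel)"
    by (subst nn_integral_distr) (auto simp: add.commute)
  finally show ?thesis by simp
qed

lemma integral_lborel_shift:
  fixes f :: "'a::euclidean_space \<Rightarrow> 'b::{banach, second_countable_topology}"
  assumes [measurable]: "f \<in> borel_measurable borel"
  shows "(LINT x|lborel. f (x + c)) = (LINT x|lborel. f x)"
proof -
  have "(LINT x|lborel. f x) = (LINT x|distr lborel borel ((+) c). f x)"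
    by (simp add: lborel_distr_plus)
  also have "\<dots> = (LINT x|lborel. f (x + c))"
    by (subst integral_distr) (auto simp: add.commute)
  finally show ?thesis by simp
qed

lemma integrable_lborel_shift:
  fixes f :: "'a::euclidean_space \<Rightarrow> 'b::{banach, second_countable_topology}"
  assumes "integrable lborel f"
  shows "integrable lborel (\<lambda>x. f (x + c))"
proof -
  have [measurable]: "f \<in> borel_measurable borel" using assms by simp
  have "integrable (distr lborel borel ((+) c)) f" using assms by (simp add: lborel_distr_plus)
  then show ?thesis by (subst (asm) integrable_distr_eq) (auto simp: add.commute)
qed

text \<open>Integrability for the applications of Fubini's theorem on \<open>{0..t}\<close> times the space below, with the shift along \<open>d\<close> or without it (\<open>d = 0\<close>).\<close>

lemma integrable_slab:
  fixes w :: "'a::euclidean_space \<Rightarrow> real" and h :: "'a \<Rightarrow> real \<Rightarrow> real"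
  assumes w: "integrable lborel w"
    and [measurable]: "case_prod h \<in> borel_measurable (borel \<Otimes>\<^sub>M borel)"
    and le: "\<And>x s. \<bar>h x s\<bar> \<le> indicator {0..t} s * (C * \<bar>w (x + s *\<^sub>R d)\<bar>)" and "0 \<le> C" "0 \<le> t"
  shows "integrable (lborel \<Otimes>\<^sub>M lborel) (case_prod h)"
proof (rule integrableI_bounded)
  have [measurable]: "w \<in> borel_measurable borel" using w by simp
  show "case_prod h \<in> borel_measurable (lborel \<Otimes>\<^sub>M lborel)" by measurable
  have "(\<integral>\<^sup>+z. ennreal (norm (case_prod h z)) \<partial>(lborel \<Otimes>\<^sub>M lborel)) =
      (\<integral>\<^sup>+s. (\<integral>\<^sup>+x. ennreal \<bar>h x s\<bar> \<partial>lborel) \<partial>lborel)"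
    by (subst lborel_pair.nn_integral_snd[symmetric]) (auto simp: case_prod_unfold)
  also have "\<dots> \<le> (\<integral>\<^sup>+s. (\<integral>\<^sup>+x. indicator {0..t} s * (ennreal C * ennreal \<bar>w (x + s *\<^sub>R d)\<bar>) \<partial>lborel) \<partial>lborel)"
  proof (intro nn_integral_mono)
    fix s x
    have "ennreal \<bar>h x s\<bar> \<le> ennreal (indicator {0..t} s * (C * \<bar>w (x + s *\<^sub>R d)\<bar>))"
      by (intro ennreal_leI le)
    also have "\<dots> = indicator {0..t} s * (ennreal C * ennreal \<bar>w (x + s *\<^sub>R d)\<bar>)"
      using \<open>0 \<le> C\<close> by (auto simp: ennreal_mult split: split_indicator)
    finally show "ennreal \<bar>h x s\<bar> \<le> indicator {0..t} s * (ennreal C * ennreal \<bar>w (x + s *\<^sub>R d)\<bar>)" .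
  qed
  also have "\<dots> = (\<integral>\<^sup>+s. indicator {0..t} s * (ennreal C * (\<integral>\<^sup>+x. ennreal \<bar>w (x + s *\<^sub>R d)\<bar> \<partial>lborel)) \<partial>lborel)"
    by (simp add: nn_integral_cmult)
  also have "\<dots> = (\<integral>\<^sup>+s. indicator {0..t} s * (ennreal C * (\<integral>\<^sup>+x. ennreal \<bar>w x\<bar> \<partial>lborel)) \<partial>lborel)"
    by (subst nn_integral_lborel_shift[where f = "\<lambda>x. ennreal \<bar>w x\<bar>"]) auto
  also have "\<dots> = ennreal t * (ennreal C * (\<integral>\<^sup>+x. ennreal \<bar>w x\<bar> \<partial>lborel))"
    using \<open>0 \<le> t\<close> by (subst nn_integral_multc) auto
  also have "\<dots> < \<infinity>"
    using w by (auto simp: integrable_iff_bounded ennreal_mult_less_top)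
  finally show "(\<integral>\<^sup>+z. ennreal (norm (case_prod h z)) \<partial>(lborel \<Otimes>\<^sub>M lborel)) < \<infinity>" .
qed

lemma bump_borel[measurable]: "bump a b n \<in> borel_measurable borel"
  using C_k_bump[of 0 a b n] by (auto intro: borel_measurable_continuous_onI)

lemma partial_deriv_bump_borel: "e \<in> Basis \<Longrightarrow> partial_deriv e (bump a b n) \<in> borel_measurable borel"
  by (rule borel_measurable_continuous_onI[OF continuous_partial_deriv_bump])

lemma bump_integral_along_line:
  assumes e: "e \<in> Basis" and "0 \<le> t"
  shows "(LINT s|lborel. indicator {0..t} s * partial_deriv e (bump a b n) (x - s *\<^sub>R e)) =
    bump a b n x - bump a b n (x - t *\<^sub>R e)"
proof -
  have D: "((\<lambda>s. - bump a b n (x - s *\<^sub>R e)) has_real_derivative partial_deriv e (bump a b n) (x - s *\<^sub>R e)) (at s)" for s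
  proof -
    have "((\<lambda>s. bump a b n (x - s *\<^sub>R e)) has_derivative
        (\<lambda>h. frechet_derivative (bump a b n) (at (x - s *\<^sub>R e)) (- (h *\<^sub>R e)))) (at s)"
      by (rule has_derivative_compose[where f = "\<lambda>s. x - s *\<^sub>R e" and f' = "\<lambda>h. - (h *\<^sub>R e)", OF _ bump_differentiable])
         (auto intro!: derivative_eq_intros)
    moreover have "linear (frechet_derivative (bump a b n) (at (x - s *\<^sub>R e)))"
      using bump_differentiable has_derivative_linear by blast
    ultimately have "((\<lambda>s. bump a b n (x - s *\<^sub>R e)) has_derivative
        (\<lambda>h. - (h * partial_deriv e (bump a b n) (x - s *\<^sub>R e)))) (at s)"
      by (simp add: linear_neg linear_cmul partial_deriv_def)
    from has_derivative_minus[OF this] show ?thesis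
      unfolding has_field_derivative_def by (rule has_derivative_eq_rhs) (simp add: fun_eq_iff mult.commute)
  qed
  have "(LINT s|lborel. indicator {0..t} s *\<^sub>R partial_deriv e (bump a b n) (x - s *\<^sub>R e)) =
      (- bump a b n (x - t *\<^sub>R e)) - (- bump a b n (x - 0 *\<^sub>R e))"
  proof (rule integral_FTC_Icc[OF \<open>0 \<le> t\<close>])
    show "((\<lambda>s. - bump a b n (x - s *\<^sub>R e)) has_vector_derivative partial_deriv e (bump a b n) (x - s *\<^sub>R e)) (at s within {0..t})" for s
      by (rule has_vector_derivative_at_within[OF D[of s, unfolded has_real_derivative_iff_has_vector_derivative]])
    show "continuous_on {0..t} (\<lambda>s. partial_deriv e (bump a b n) (x - s *\<^sub>R e))"
      by (rule continuous_on_compose2[OF continuous_partial_deriv_bump[OF e]]) (auto intro!: continuous_intros)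
  qed
  then show ?thesis by simp
qed

text \<open>Almost everywhere \<open>\<eta> (x + t e) - \<eta> x\<close> is the integral of \<open>g (x + s e)\<close> over \<open>0 \<le> s \<le> t\<close>.  Tested against a bump, this is the weak
  derivative identity for all translates of the bump, integrated over \<open>s\<close>.\<close>

lemma L1_translation_along_axis:
  fixes \<eta> g :: "'a::euclidean_space \<Rightarrow> real"
  assumes \<eta>: "integrable lborel \<eta>" and g: "integrable lborel g" and e: "e \<in> Basis" and t: "0 \<le> t"
    and weak: "\<And>a b n. (\<And>i. i \<in> Basis \<Longrightarrow> a \<bullet> i < b \<bullet> i) \<Longrightarrow>
      (LINT x|lborel. \<eta> x * partial_deriv e (bump a b n) x) = - (LINT x|lborel. g x * bump a b n x)"
  shows "(\<integral>\<^sup>+x. ennreal \<bar>\<eta> (x + t *\<^sub>R e) - \<eta> x\<bar> \<partial>lborel) \<le> ennreal t * (\<integral>\<^sup>+x. ennreal \<bar>g x\<bar> \<partial>lborel)"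
proof -
  have [measurable]: "\<eta> \<in> borel_measurable borel" "g \<in> borel_measurable borel" using \<eta> g by simp_all
  note partial_deriv_bump_borel[OF e, measurable]
  define G where "G x = (LINT s|lborel. indicator {0..t} s * g (x + s *\<^sub>R e))" for x
  have intG: "integrable (lborel \<Otimes>\<^sub>M lborel) (\<lambda>(x, s). indicator {0..t} s * g (x + s *\<^sub>R e))"
    using t by (intro integrable_slab[OF g, where C = 1 and d = e and t = t]) (auto simp: abs_mult)
  have G: "integrable lborel G"
    unfolding G_def using lborel_pair.integrable_fst[OF intG] .
  have [measurable]: "G \<in> borel_measurable borel" using G by simp
  define F where "F x = \<eta> (x + t *\<^sub>R e) - \<eta> x - G x" for x
  have F: "integrable lborel F"
    unfolding F_def using \<eta> G by (intro Bochner_Integration.integrable_diff integrable_lborel_shift)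
  have "AE x in lborel. F x = 0"
  proof (rule AE_zero_if_integral_bump_zero[OF F])
    fix a b :: 'a and n
    assume ab: "\<And>i. i \<in> Basis \<Longrightarrow> a \<bullet> i < b \<bullet> i"
    let ?f = "bump a b n" and ?d = "partial_deriv e (bump a b n)"
    have bd: "\<bar>?f x\<bar> \<le> 1" for x using bump_bounds[of a b n x] by simp
    obtain C where C: "\<And>x. \<bar>?d x\<bar> \<le> C" using partial_deriv_bump_bounded[OF ab e] by blast
    have C0: "0 \<le> C" using C[of 0] by linarith
    have mb: "integrable lborel (\<lambda>x. w x * \<phi> x)" if "integrable lborel w" "\<phi> \<in> borel_measurable borel" "\<And>x. \<bar>\<phi> x\<bar> \<le> 1"
      for w \<phi> :: "'a \<Rightarrow> real"
      using that by (intro Bochner_Integration.integrable_bound[OF that(1)]) (auto simp: abs_mult intro!: mult_left_le)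
    have shift: "(LINT x|lborel. \<psi> (x + c) * ?f x) = (LINT x|lborel. \<psi> x * ?f (x - c))"
      if [measurable]: "\<psi> \<in> borel_measurable borel" for \<psi> :: "'a \<Rightarrow> real" and c
      using integral_lborel_shift[of "\<lambda>x. \<psi> x * ?f (x - c)" c] by simp
    have eq1: "(LINT x|lborel. \<eta> x * (?f x - ?f (x - t *\<^sub>R e))) = - (LINT x|lborel. G x * ?f x)"
    proof -
      have "(LINT x|lborel. \<eta> x * (?f x - ?f (x - t *\<^sub>R e))) =
          (LINT x|lborel. (LINT s|lborel. \<eta> x * (indicator {0..t} s * ?d (x - s *\<^sub>R e))))"
        by (simp add: bump_integral_along_line[OF e t, symmetric])
      also have "\<dots> = (LINT s|lborel. (LINT x|lborel. \<eta> x * (indicator {0..t} s * ?d (x - s *\<^sub>R e))))"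
      proof (rule lborel_pair.Fubini_integral[symmetric])
        show "integrable (lborel \<Otimes>\<^sub>M lborel) (\<lambda>(x, s). \<eta> x * (indicator {0..t} s * ?d (x - s *\<^sub>R e)))"
          using t C0 C by (intro integrable_slab[OF \<eta>, where C = C and d = 0 and t = t])
            (auto simp: abs_mult mult.commute[of C] intro!: mult_left_mono split: split_indicator)
      qed
      also have "\<dots> = (LINT s|lborel. indicator {0..t} s * (LINT x|lborel. \<eta> x * ?d (x - s *\<^sub>R e)))"
        by (intro Bochner_Integration.integral_cong) (auto split: split_indicator)
      also have "\<dots> = (LINT s|lborel. - (indicator {0..t} s * (LINT x|lborel. g x * ?f (x - s *\<^sub>R e))))"
      proof (intro Bochner_Integration.integral_cong refl)
        fix s
        have "(LINT x|lborel. \<eta> x * ?d (x - s *\<^sub>R e)) = - (LINT x|lborel. g x * ?f (x - s *\<^sub>R e))"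
          unfolding partial_deriv_bump_diff bump_diff using ab by (intro weak) (simp add: inner_add_left)
        then show "indicator {0..t} s * (LINT x|lborel. \<eta> x * ?d (x - s *\<^sub>R e)) =
            - (indicator {0..t} s * (LINT x|lborel. g x * ?f (x - s *\<^sub>R e)))" by simp
      qed
      also have "\<dots> = - (LINT s|lborel. (LINT x|lborel. indicator {0..t} s * g (x + s *\<^sub>R e) * ?f x))"
        by (simp add: shift[symmetric] mult.assoc)
      also have "(LINT s|lborel. (LINT x|lborel. indicator {0..t} s * g (x + s *\<^sub>R e) * ?f x)) =
          (LINT x|lborel. (LINT s|lborel. indicator {0..t} s * g (x + s *\<^sub>R e) * ?f x))"
      proof (rule lborel_pair.Fubini_integral)
        show "integrable (lborel \<Otimes>\<^sub>M lborel) (\<lambda>(x, s). indicator {0..t} s * g (x + s *\<^sub>R e) * ?f x)"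
          using t bd by (intro integrable_slab[OF g, where C = 1 and d = e and t = t])
            (auto simp: abs_mult intro!: mult_left_le split: split_indicator)
      qed
      also have "\<dots> = (LINT x|lborel. G x * ?f x)"
        by (simp add: G_def)
      finally show ?thesis .
    qed
    have "(LINT x|lborel. F x * ?f x) =
        (LINT x|lborel. \<eta> (x + t *\<^sub>R e) * ?f x - \<eta> x * ?f x - G x * ?f x)"
      by (simp add: F_def algebra_simps)
    also have "\<dots> = (LINT x|lborel. \<eta> (x + t *\<^sub>R e) * ?f x) - (LINT x|lborel. \<eta> x * ?f x) - (LINT x|lborel. G x * ?f x)"
      using \<eta> G bd by (simp add: mb integrable_lborel_shift)
    also have "(LINT x|lborel. \<eta> (x + t *\<^sub>R e) * ?f x) = (LINT x|lborel. \<eta> x * ?f (x - t *\<^sub>R e))"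
      by (rule shift) simp
    also have "(LINT x|lborel. \<eta> x * ?f (x - t *\<^sub>R e)) - (LINT x|lborel. \<eta> x * ?f x) - (LINT x|lborel. G x * ?f x) =
        - (LINT x|lborel. \<eta> x * (?f x - ?f (x - t *\<^sub>R e))) - (LINT x|lborel. G x * ?f x)"
    proof -
      have "integrable lborel (\<lambda>x. \<eta> x * ?f (x - t *\<^sub>R e))" "integrable lborel (\<lambda>x. \<eta> x * ?f x)"
        using bd by (intro mb \<eta>; simp)+
      then show ?thesis by (simp add: right_diff_distrib)
    qed
    finally show "(LINT x|lborel. F x * ?f x) = 0" unfolding eq1 by simp
  qed
  then have "(\<integral>\<^sup>+x. ennreal \<bar>\<eta> (x + t *\<^sub>R e) - \<eta> x\<bar> \<partial>lborel) = (\<integral>\<^sup>+x. ennreal \<bar>G x\<bar> \<partial>lborel)"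
    by (intro nn_integral_cong_AE) (auto elim!: eventually_mono simp: F_def)
  also have "\<dots> \<le> (\<integral>\<^sup>+x. (\<integral>\<^sup>+s. ennreal \<bar>g (x + s *\<^sub>R e)\<bar> * indicator {0..t} s \<partial>lborel) \<partial>lborel)"
  proof (intro nn_integral_mono)
    fix x
    have "ennreal \<bar>G x\<bar> \<le> (\<integral>\<^sup>+s. ennreal (norm (indicator {0..t} s * g (x + s *\<^sub>R e))) \<partial>lborel)"
      unfolding G_def real_norm_def[symmetric]
      by (cases "integrable lborel (\<lambda>s. indicator {0..t} s * g (x + s *\<^sub>R e))")
         (auto dest: integral_norm_bound_ennreal simp: not_integrable_integral_eq)
    also have "\<dots> = (\<integral>\<^sup>+s. ennreal \<bar>g (x + s *\<^sub>R e)\<bar> * indicator {0..t} s \<partial>lborel)"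
      by (intro nn_integral_cong) (auto split: split_indicator)
    finally show "ennreal \<bar>G x\<bar> \<le> (\<integral>\<^sup>+s. ennreal \<bar>g (x + s *\<^sub>R e)\<bar> * indicator {0..t} s \<partial>lborel)" .
  qed
  also have "\<dots> = (\<integral>\<^sup>+s. (\<integral>\<^sup>+x. ennreal \<bar>g (x + s *\<^sub>R e)\<bar> * indicator {0..t} s \<partial>lborel) \<partial>lborel)"
    by (rule lborel_pair.Fubini'[symmetric]) measurable
  also have "\<dots> = (\<integral>\<^sup>+s. (\<integral>\<^sup>+x. ennreal \<bar>g (x + s *\<^sub>R e)\<bar> \<partial>lborel) * indicator {0..t} s \<partial>lborel)"
    by (simp add: nn_integral_multc)
  also have "\<dots> = (\<integral>\<^sup>+s. (\<integral>\<^sup>+x. ennreal \<bar>g x\<bar> \<partial>lborel) * indicator {0..t} s \<partial>lborel)"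
    by (subst nn_integral_lborel_shift[where f = "\<lambda>x. ennreal \<bar>g x\<bar>"]) auto
  also have "\<dots> = ennreal t * (\<integral>\<^sup>+x. ennreal \<bar>g x\<bar> \<partial>lborel)"
    using t by (subst nn_integral_cmult) (auto simp: mult.commute)
  finally show ?thesis .
qed

text \<open>The \<open>L\<^sup>1\<close> modulus \<open>T\<close> is subadditive in the shift, so the estimate along the axes adds up.\<close>

lemma L1_translation_le:
  fixes \<eta> :: "'a::euclidean_space \<Rightarrow> real" and g :: "'a \<Rightarrow> 'a \<Rightarrow> real"
  assumes \<eta>: "integrable lborel \<eta>" and g: "\<And>e. e \<in> Basis \<Longrightarrow> integrable lborel (g e)"
    and weak: "\<And>e a b n. e \<in> Basis \<Longrightarrow> (\<And>i. i \<in> Basis \<Longrightarrow> a \<bullet> i < b \<bullet> i) \<Longrightarrow>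
      (LINT x|lborel. \<eta> x * partial_deriv e (bump a b n) x) = - (LINT x|lborel. g e x * bump a b n x)"
  shows "\<exists>M\<ge>0. \<forall>k. (\<integral>\<^sup>+x. ennreal \<bar>\<eta> (x + k) - \<eta> x\<bar> \<partial>lborel) \<le> ennreal (M * norm k)"
proof -
  have [measurable]: "\<eta> \<in> borel_measurable borel" using \<eta> by simp
  define T where "T k = (\<integral>\<^sup>+x. ennreal \<bar>\<eta> (x + k) - \<eta> x\<bar> \<partial>lborel)" for k
  define m where "m e = (LINT x|lborel. \<bar>g e x\<bar>)" for e
  have m: "m e \<ge> 0" for e by (simp add: m_def)
  have pos: "T (t *\<^sub>R e) \<le> ennreal (t * m e)" if "e \<in> Basis" "0 \<le> t" for t e
    using L1_translation_along_axis[OF \<eta> g[OF that(1)] that weak[OF that(1)]] that(2) g[OF that(1)] m[of e]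
    by (simp add: T_def m_def nn_integral_eq_integral ennreal_mult)
  have minus: "T (- k) = T k" for k
    using nn_integral_lborel_shift[of "\<lambda>x. ennreal \<bar>\<eta> (x - k) - \<eta> x\<bar>" k]
    by (simp add: T_def abs_minus_commute)
  have axis: "T (c *\<^sub>R e) \<le> ennreal (\<bar>c\<bar> * m e)" if "e \<in> Basis" for c e
    proof (cases "c \<ge> 0")
    case False
    then have "T (c *\<^sub>R e) = T (\<bar>c\<bar> *\<^sub>R e)" using minus[of "c *\<^sub>R e"] by simp
    then show ?thesis using pos[OF that, of "\<bar>c\<bar>"] by simp
  qed (use pos[OF that, of c] in simp)
  have add: "T (k + l) \<le> T k + T l" for k l
  proof -
    have "T (k + l) \<le> (\<integral>\<^sup>+x. ennreal \<bar>\<eta> (x + k + l) - \<eta> (x + k)\<bar> + ennreal \<bar>\<eta> (x + k) - \<eta> x\<bar> \<partial>lborel)"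
      unfolding T_def
    proof (rule nn_integral_mono)
      fix x
      have "ennreal \<bar>\<eta> (x + (k + l)) - \<eta> x\<bar> \<le> ennreal (\<bar>\<eta> (x + k + l) - \<eta> (x + k)\<bar> + \<bar>\<eta> (x + k) - \<eta> x\<bar>)"
        by (rule ennreal_leI) (simp add: add.assoc)
      then show "ennreal \<bar>\<eta> (x + (k + l)) - \<eta> x\<bar> \<le>
          ennreal \<bar>\<eta> (x + k + l) - \<eta> (x + k)\<bar> + ennreal \<bar>\<eta> (x + k) - \<eta> x\<bar>" by simp
    qed
    also have "\<dots> = (\<integral>\<^sup>+x. ennreal \<bar>\<eta> (x + k + l) - \<eta> (x + k)\<bar> \<partial>lborel) + T k"
      unfolding T_def by (rule nn_integral_add) auto
    also have "(\<integral>\<^sup>+x. ennreal \<bar>\<eta> (x + k + l) - \<eta> (x + k)\<bar> \<partial>lborel) = T l"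
      unfolding T_def by (rule nn_integral_lborel_shift[of "\<lambda>x. ennreal \<bar>\<eta> (x + l) - \<eta> x\<bar>"]) measurable
    finally show ?thesis by (simp add: add.commute)
  qed
  have sum: "T (\<Sum>e\<in>A. (k \<bullet> e) *\<^sub>R e) \<le> ennreal (\<Sum>e\<in>A. \<bar>k \<bullet> e\<bar> * m e)" if "finite A" "A \<subseteq> Basis" for A k
    using that
  proof (induction A rule: finite_induct)
    case empty
    then show ?case by (simp add: T_def)
  next
    case (insert e A)
    have "T (\<Sum>e\<in>insert e A. (k \<bullet> e) *\<^sub>R e) \<le> T ((k \<bullet> e) *\<^sub>R e) + T (\<Sum>e\<in>A. (k \<bullet> e) *\<^sub>R e)"
      using insert by (simp add: add)
    also have "\<dots> \<le> ennreal (\<bar>k \<bullet> e\<bar> * m e) + ennreal (\<Sum>e\<in>A. \<bar>k \<bullet> e\<bar> * m e)"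
      using insert by (intro add_mono axis) auto
    also have "\<dots> = ennreal (\<Sum>e\<in>insert e A. \<bar>k \<bullet> e\<bar> * m e)"
      using insert m by (simp add: sum_nonneg)
    finally show ?case .
  qed
  define M where "M = (\<Sum>e\<in>Basis. m e)"
  have "T k \<le> ennreal (M * norm k)" for k
  proof -
    have "T k \<le> ennreal (\<Sum>e\<in>Basis. \<bar>k \<bullet> e\<bar> * m e)"
      using sum[of Basis k] by (simp add: euclidean_representation)
    also have "(\<Sum>e\<in>Basis. \<bar>k \<bullet> e\<bar> * m e) \<le> (\<Sum>e\<in>Basis. norm k * m e)"
      using m by (intro sum_mono mult_right_mono) (auto simp: Basis_le_norm)
    also have "\<dots> = M * norm k" by (simp add: M_def sum_distrib_left mult.commute)
    finally show ?thesis by (simp add: ennreal_leI)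
  qed
  moreover have "M \<ge> 0" unfolding M_def using m by (intro sum_nonneg)
  ultimately show ?thesis unfolding T_def by blast
qed

lemma sobolev_L1_translation_le:
  fixes \<eta> \<eta>' :: "'a::euclidean_space \<Rightarrow> real"
  assumes "\<eta> \<in> sobolev_W11" and [measurable]: "\<eta>' \<in> borel_measurable borel"
    and ae: "AE x in lebesgue. \<eta> x = \<eta>' x"
  shows "\<exists>M\<ge>0. \<forall>k. (\<integral>\<^sup>+x. ennreal \<bar>\<eta>' (x + k) - \<eta>' x\<bar> \<partial>lborel) \<le> ennreal (M * norm k)"
proof -
  have \<eta>: "integrable lebesgue \<eta>" using assms(1) by (simp add: sobolev_W11_def)
  then have [measurable]: "\<eta> \<in> borel_measurable lebesgue" by simp
  have leb: "\<phi> \<in> borel_measurable lebesgue" if "\<phi> \<in> borel_measurable borel" for \<phi> :: "'a \<Rightarrow> real"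
    using that by (intro measurable_completion) simp
  have \<eta>': "integrable lborel \<eta>'"
  proof -
    have "integrable lebesgue \<eta>'" using \<eta> ae leb[OF assms(2)] by (subst integrable_cong_AE[symmetric]) auto
    then show ?thesis by (simp add: integrable_completion)
  qed
  have "\<exists>g'. integrable lborel g' \<and> (\<forall>a b n. (\<forall>i\<in>Basis. a \<bullet> i < b \<bullet> i) \<longrightarrow>
      (LINT x|lborel. \<eta>' x * partial_deriv e (bump a b n) x) = - (LINT x|lborel. g' x * bump a b n x))"
    if e: "e \<in> Basis" for e
  proof -
    obtain g where g: "integrable lebesgue g" "weak_partial_deriv e \<eta> g"
      using assms(1) e by (auto simp: sobolev_W11_def)
    then have [measurable]: "g \<in> borel_measurable lebesgue" by simp
    obtain g' where g'[measurable]: "g' \<in> borel_measurable lborel" and aeg: "AE x in lborel. g x = g' x"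
      using completion_ex_borel_measurable_real[of g lborel] by auto
    have aeg: "AE x in lebesgue. g x = g' x" using aeg by (rule AE_completion)
    have "integrable lebesgue g'" using g(1) aeg leb[of g'] g' by (subst integrable_cong_AE[symmetric]) auto
    then have ig': "integrable lborel g'" using g' by (simp add: integrable_completion)
    have "(LINT x|lborel. \<eta>' x * partial_deriv e (bump a b n) x) = - (LINT x|lborel. g' x * bump a b n x)"
      if ab: "\<forall>i\<in>Basis. a \<bullet> i < b \<bullet> i" for a b n
    proof -
      note [measurable] = partial_deriv_bump_borel[OF e, of a b n]
      have [measurable]: "bump a b n \<in> borel_measurable lebesgue" "partial_deriv e (bump a b n) \<in> borel_measurable lebesgue"
        by (intro leb bump_borel partial_deriv_bump_borel e)+
      have [measurable]: "g' \<in> borel_measurable lebesgue" "\<eta>' \<in> borel_measurable lebesgue"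
        using g' by (auto intro!: leb)
      have "(LINT x|lborel. \<eta>' x * partial_deriv e (bump a b n) x) = (LINT x|lebesgue. \<eta>' x * partial_deriv e (bump a b n) x)"
        by (rule integral_completion[symmetric]) (simp add: partial_deriv_bump_borel[OF e])
      also have "\<dots> = (LINT x|lebesgue. \<eta> x * partial_deriv e (bump a b n) x)"
        using ae by (intro integral_cong_AE) auto
      also have "\<dots> = - (LINT x|lebesgue. g x * bump a b n x)"
        using g(2) test_fun_bump[of a b n] ab by (auto simp: weak_partial_deriv_def)
      also have "(LINT x|lebesgue. g x * bump a b n x) = (LINT x|lebesgue. g' x * bump a b n x)"
        using aeg by (intro integral_cong_AE) auto
      also have "\<dots> = (LINT x|lborel. g' x * bump a b n x)"
        using g' by (intro integral_completion) measurable
      finally show ?thesis .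
    qed
    with ig' show ?thesis by blast
  qed
  then obtain g' where "\<And>e. e \<in> Basis \<Longrightarrow> integrable lborel (g' e)"
    "\<And>e a b n. e \<in> Basis \<Longrightarrow> (\<forall>i\<in>Basis. a \<bullet> i < b \<bullet> i) \<Longrightarrow>
      (LINT x|lborel. \<eta>' x * partial_deriv e (bump a b n) x) = - (LINT x|lborel. g' e x * bump a b n x)"
    by metis
  then show ?thesis by (intro L1_translation_le[OF \<eta>', of g']) auto
qed

section \<open>Powers of norms and mollification\<close>

text \<open>Convexity of \<open>t \<mapsto> t\<^sup>q\<close> at \<open>s + t = (1 - \<delta>) (s / (1 - \<delta>)) + \<delta> (t / \<delta>)\<close>.\<close>

lemma powr_add_le_split:
  fixes s t q \<delta> :: real
  assumes q: "1 \<le> q" and \<delta>: "0 < \<delta>" "\<delta> < 1" and st: "0 \<le> s" "0 \<le> t"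
  shows "(s + t) powr q \<le> (1 - \<delta>) powr (1 - q) * s powr q + \<delta> powr (1 - q) * t powr q"
proof -
  have ge1: "1 \<le> c powr (1 - q)" if "0 < c" "c < 1" for c :: real
    using powr_mono_both[of 0 "q - 1" c 1] q that
    by (simp add: powr_minus_divide[of c "q - 1", simplified] powr_le1 le_divide_eq)
  have w: "c * (a / c) powr q = c powr (1 - q) * a powr q" if "0 < c" "0 < a" for a c
    using that by (simp add: powr_divide powr_diff)
  consider "s = 0" | "t = 0" | "0 < s" "0 < t" using st by linarith
  then show ?thesis
  proof cases
    case 1
    then show ?thesis using mult_right_mono[OF ge1[of \<delta>], of "t powr q"] \<delta> by simp
  next
    case 2
    then show ?thesis using mult_right_mono[OF ge1[of "1 - \<delta>"], of "s powr q"] \<delta> by simp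
  next
    case 3
    have "((1 - \<delta>) *\<^sub>R (s / (1 - \<delta>)) + \<delta> *\<^sub>R (t / \<delta>)) powr q \<le>
        (1 - \<delta>) * (s / (1 - \<delta>)) powr q + \<delta> * (t / \<delta>) powr q"
      using convex_onD[OF powr_convex[OF q], of \<delta> "s / (1 - \<delta>)" "t / \<delta>"] \<delta> 3 by simp
    then show ?thesis using \<delta> 3 by (simp add: w)
  qed
qed

lemma norm_add_powr_le_split:
  fixes x y :: "'b::real_normed_vector"
  assumes "1 \<le> q" "0 < \<delta>" "\<delta> < 1"
  shows "norm (x + y) powr q \<le> (1 - \<delta>) powr (1 - q) * norm x powr q + \<delta> powr (1 - q) * norm y powr q"
proof -
  have "norm (x + y) powr q \<le> (norm x + norm y) powr q"
    using assms by (intro powr_mono2 norm_triangle_ineq) auto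
  also have "\<dots> \<le> (1 - \<delta>) powr (1 - q) * norm x powr q + \<delta> powr (1 - q) * norm y powr q"
    by (intro powr_add_le_split assms) auto
  finally show ?thesis .
qed

lemma norm_diff_powr_le:
  fixes x y :: "'b::real_normed_vector"
  assumes "1 \<le> q"
  shows "norm (x - y) powr q \<le> 2 powr (q - 1) * (norm x powr q + norm y powr q)"
proof -
  have "(1 / 2) powr (1 - q) = (2::real) powr (q - 1)"
    using powr_minus[of 2 "1 - q"] by (simp add: powr_divide inverse_eq_divide)
  then show ?thesis
    using norm_add_powr_le_split[OF assms, of "1 / 2" x "- y"] by (simp add: algebra_simps)
qed

lemma powr_tangent_le:
  fixes s t q :: real
  assumes "1 \<le> q" "0 < s" "0 \<le> t"
  shows "q * s powr (q - 1) * t \<le> t powr q + (q - 1) * s powr q"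
proof (cases "t = 0")
  case False
  have "(t powr q) powr (1 / q) * (s powr q) powr (1 - 1 / q) \<le> 1 / q * t powr q + (1 - 1 / q) * s powr q"
    using assms False by (intro Youngs_inequality_0) auto
  moreover have "(t powr q) powr (1 / q) = t" using assms False by (simp add: powr_powr)
  moreover have "(s powr q) powr (1 - 1 / q) = s powr (q - 1)"
    using assms by (simp add: powr_powr right_diff_distrib)
  ultimately show ?thesis using assms by (simp add: field_simps)
qed (use assms in simp)

text \<open>Jensen's inequality for the measure with density \<open>|w|\<close>, obtained by integrating the tangent inequality \<open>powr_tangent_le\<close> at the
  mean value \<open>s = I / W\<close>.\<close>

lemma norm_integral_powr_le:
  fixes w :: "'a::euclidean_space \<Rightarrow> real" and f :: "'a \<Rightarrow> 'b::euclidean_space"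
  assumes q: "1 \<le> q" and w: "integrable lborel w" and [measurable]: "f \<in> borel_measurable borel"
  shows "ennreal (norm (LINT z|lborel. w z *\<^sub>R f z) powr q) \<le>
    ennreal ((LINT z|lborel. \<bar>w z\<bar>) powr (q - 1)) * (\<integral>\<^sup>+z. ennreal (\<bar>w z\<bar> * norm (f z) powr q) \<partial>lborel)"
proof -
  have [measurable]: "w \<in> borel_measurable borel" using w by simp
  define W where "W = (LINT z|lborel. \<bar>w z\<bar>)"
  define I where "I = (LINT z|lborel. \<bar>w z\<bar> * norm (f z))"
  define J where "J = (\<integral>\<^sup>+z. ennreal (\<bar>w z\<bar> * norm (f z) powr q) \<partial>lborel)"
  have nI: "norm (LINT z|lborel. w z *\<^sub>R f z) \<le> I"
    using integral_norm_bound[of lborel "\<lambda>z. w z *\<^sub>R f z"] by (simp add: I_def)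
  have W0: "0 \<le> W" by (simp add: W_def)
  have I0: "0 \<le> I" by (simp add: I_def)
  have "ennreal (I powr q) \<le> ennreal (W powr (q - 1)) * J"
  proof (cases "I = 0")
    case False
    then have Ipos: "0 < I" using I0 by simp
    have intI: "integrable lborel (\<lambda>z. \<bar>w z\<bar> * norm (f z))"
      using False unfolding I_def by (metis not_integrable_integral_eq)
    have Wpos: "0 < W"
    proof (rule ccontr)
      assume "\<not> 0 < W"
      then have "(LINT z|lborel. \<bar>w z\<bar>) = 0" using W0 unfolding W_def by linarith
      then have "AE z in lborel. \<bar>w z\<bar> = 0"
        using w by (subst (asm) integral_nonneg_eq_0_iff_AE) auto
      then have "I = (LINT z|(lborel :: 'a measure). 0)"
        unfolding I_def by (intro integral_cong_AE) auto
      then show False using False by simp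
    qed
    define s where "s = I / W"
    have s: "0 < s" using Ipos Wpos by (simp add: s_def)
    have wI: "(\<integral>\<^sup>+z. ennreal (\<bar>w z\<bar> * norm (f z)) \<partial>lborel) = ennreal I"
      unfolding I_def using intI by (intro nn_integral_eq_integral) auto
    have wW: "(\<integral>\<^sup>+z. ennreal \<bar>w z\<bar> \<partial>lborel) = ennreal W"
      unfolding W_def using w by (intro nn_integral_eq_integral) auto
    have "ennreal (q * s powr (q - 1) * I) = (\<integral>\<^sup>+z. ennreal (q * s powr (q - 1)) * ennreal (\<bar>w z\<bar> * norm (f z)) \<partial>lborel)"
      using q I0 wI by (simp add: nn_integral_cmult ennreal_mult)
    also have "\<dots> \<le> (\<integral>\<^sup>+z. ennreal (\<bar>w z\<bar> * norm (f z) powr q) + ennreal ((q - 1) * s powr q) * ennreal \<bar>w z\<bar> \<partial>lborel)"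
    proof (rule nn_integral_mono)
      fix z
      have "\<bar>w z\<bar> * (q * s powr (q - 1) * norm (f z)) \<le> \<bar>w z\<bar> * (norm (f z) powr q + (q - 1) * s powr q)"
        by (intro mult_left_mono powr_tangent_le q s) auto
      then have "ennreal (q * s powr (q - 1) * (\<bar>w z\<bar> * norm (f z))) \<le>
          ennreal (\<bar>w z\<bar> * norm (f z) powr q + (q - 1) * s powr q * \<bar>w z\<bar>)"
        by (intro ennreal_leI) (simp add: algebra_simps)
      then show "ennreal (q * s powr (q - 1)) * ennreal (\<bar>w z\<bar> * norm (f z)) \<le>
          ennreal (\<bar>w z\<bar> * norm (f z) powr q) + ennreal ((q - 1) * s powr q) * ennreal \<bar>w z\<bar>"
        using q by (simp add: ennreal_mult)
    qed
    also have "\<dots> = J + ennreal ((q - 1) * s powr q * W)"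
      using q W0 by (simp add: nn_integral_add nn_integral_cmult wW J_def ennreal_mult)
    finally have le: "ennreal (q * s powr (q - 1) * I) \<le> J + ennreal ((q - 1) * s powr q * W)" .
    show ?thesis
    proof (cases "J = \<infinity>")
      case True
      then show ?thesis using Wpos by (simp add: ennreal_mult_top)
    next
      case False
      define j where "j = enn2real J"
      have j: "J = ennreal j" "0 \<le> j" using False by (auto simp: j_def less_top)
      have "q * s powr (q - 1) * I \<le> j + (q - 1) * s powr q * W"
        using le j q W0 by (simp flip: ennreal_plus add: ennreal_le_iff)
      moreover have "s powr q * W = s powr (q - 1) * I"
        using s Ipos Wpos by (simp add: powr_diff) (simp add: s_def)
      ultimately have "q * (s powr (q - 1) * I) \<le> j + (q - 1) * (s powr (q - 1) * I)"
        by (simp add: mult.assoc)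
      then have "s powr (q - 1) * I \<le> j" by (simp add: algebra_simps)
      then have "W powr (q - 1) * (s powr (q - 1) * I) \<le> W powr (q - 1) * j"
        by (rule mult_left_mono) simp
      moreover have "W powr (q - 1) * s powr (q - 1) = I powr (q - 1)"
        using Ipos Wpos by (simp add: s_def powr_divide)
      moreover have "I powr (q - 1) * I = I powr q" using Ipos by (simp add: powr_diff)
      ultimately have "I powr q \<le> W powr (q - 1) * j" by (simp add: mult.assoc[symmetric])
      then show ?thesis using j by (simp add: ennreal_mult[symmetric] ennreal_leI)
    qed
  qed (use q in simp)
  moreover have "ennreal (norm (LINT z|lborel. w z *\<^sub>R f z) powr q) \<le> ennreal (I powr q)"
    using nI q by (intro ennreal_leI powr_mono2) auto
  ultimately show ?thesis unfolding W_def J_def by (rule order_trans[rotated])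
qed

text \<open>The \<open>q\<close>-th power of the \<open>L\<^sup>q\<close> norm.  Working with powers, and with convexity in place of the triangle inequality, keeps all
  estimates linear in the integrals.\<close>

definition Lq_powr :: "real \<Rightarrow> ('a::euclidean_space \<Rightarrow> 'b::euclidean_space) \<Rightarrow> ennreal"
  where "Lq_powr q f = (\<integral>\<^sup>+x. ennreal (norm (f x) powr q) \<partial>lborel)"

lemma Lq_powr_shift:
  assumes [measurable]: "f \<in> borel_measurable borel"
  shows "Lq_powr q (\<lambda>x. f (x + c)) = Lq_powr q f"
  unfolding Lq_powr_def
  by (rule nn_integral_lborel_shift[of "\<lambda>x. ennreal (norm (f x) powr q)"]) measurable

lemma Lq_powr_diff_le:
  fixes f g :: "'a::euclidean_space \<Rightarrow> 'b::euclidean_space"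
  assumes "1 \<le> q" and [measurable]: "f \<in> borel_measurable borel" "g \<in> borel_measurable borel"
  shows "Lq_powr q (\<lambda>x. f x - g x) \<le> ennreal (2 powr (q - 1)) * (Lq_powr q f + Lq_powr q g)"
proof -
  have "Lq_powr q (\<lambda>x. f x - g x) \<le>
      (\<integral>\<^sup>+x. ennreal (2 powr (q - 1)) * (ennreal (norm (f x) powr q) + ennreal (norm (g x) powr q)) \<partial>lborel)"
    unfolding Lq_powr_def
  proof (rule nn_integral_mono)
    fix x
    have "ennreal (norm (f x - g x) powr q) \<le> ennreal (2 powr (q - 1) * (norm (f x) powr q + norm (g x) powr q))"
      by (intro ennreal_leI norm_diff_powr_le assms)
    then show "ennreal (norm (f x - g x) powr q) \<le>
        ennreal (2 powr (q - 1)) * (ennreal (norm (f x) powr q) + ennreal (norm (g x) powr q))"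
      by (simp add: ennreal_mult)
  qed
  also have "\<dots> = ennreal (2 powr (q - 1)) * (Lq_powr q f + Lq_powr q g)"
    unfolding Lq_powr_def by (simp add: nn_integral_cmult nn_integral_add)
  finally show ?thesis .
qed

lemma Lq_powr_superposition_le:
  fixes w :: "'a::euclidean_space \<Rightarrow> real" and F :: "'a \<Rightarrow> 'a \<Rightarrow> 'b::euclidean_space"
  assumes q: "1 \<le> q" and w: "integrable lborel w"
    and [measurable]: "case_prod F \<in> borel_measurable (borel \<Otimes>\<^sub>M borel)"
  shows "Lq_powr q (\<lambda>x. LINT z|lborel. w z *\<^sub>R F x z) \<le>
    ennreal ((LINT z|lborel. \<bar>w z\<bar>) powr (q - 1)) * (\<integral>\<^sup>+z. ennreal \<bar>w z\<bar> * Lq_powr q (\<lambda>x. F x z) \<partial>lborel)"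
proof -
  have [measurable]: "w \<in> borel_measurable borel" using w by simp
  let ?W = "ennreal ((LINT z|lborel. \<bar>w z\<bar>) powr (q - 1))"
  have "Lq_powr q (\<lambda>x. LINT z|lborel. w z *\<^sub>R F x z) \<le>
      (\<integral>\<^sup>+x. ?W * (\<integral>\<^sup>+z. ennreal (\<bar>w z\<bar> * norm (F x z) powr q) \<partial>lborel) \<partial>lborel)"
    unfolding Lq_powr_def by (intro nn_integral_mono norm_integral_powr_le q w) measurable
  also have "\<dots> = ?W * (\<integral>\<^sup>+x. (\<integral>\<^sup>+z. ennreal (\<bar>w z\<bar> * norm (F x z) powr q) \<partial>lborel) \<partial>lborel)"
    by (rule nn_integral_cmult) measurable
  also have "(\<integral>\<^sup>+x. (\<integral>\<^sup>+z. ennreal (\<bar>w z\<bar> * norm (F x z) powr q) \<partial>lborel) \<partial>lborel) =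
      (\<integral>\<^sup>+z. (\<integral>\<^sup>+x. ennreal (\<bar>w z\<bar> * norm (F x z) powr q) \<partial>lborel) \<partial>lborel)"
    by (rule lborel_pair.Fubini'[symmetric]) measurable
  also have "\<dots> = (\<integral>\<^sup>+z. ennreal \<bar>w z\<bar> * Lq_powr q (\<lambda>x. F x z) \<partial>lborel)"
    unfolding Lq_powr_def
    by (intro nn_integral_cong) (simp add: ennreal_mult nn_integral_cmult)
  finally show ?thesis .
qed

definition mollify :: "('a::euclidean_space \<Rightarrow> real) \<Rightarrow> real \<Rightarrow> ('a \<Rightarrow> 'b::euclidean_space) \<Rightarrow> 'a \<Rightarrow> 'b"
  where "mollify w \<epsilon> f x = (LINT z|lborel. w z *\<^sub>R f (x - \<epsilon> *\<^sub>R z))"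

lemma mollify_borel[measurable]:
  assumes [measurable]: "w \<in> borel_measurable borel" "f \<in> borel_measurable borel"
  shows "mollify w \<epsilon> f \<in> borel_measurable borel"
  unfolding mollify_def[abs_def] by measurable

lemma powr_diff_one_mult:
  fixes W :: real assumes "0 \<le> W" "1 \<le> q" shows "W powr (q - 1) * W = W powr q"
  using assms by (cases "W = 0") (auto simp: powr_diff)

lemma Lq_powr_superposition_const_le:
  fixes w :: "'a::euclidean_space \<Rightarrow> real" and F :: "'a \<Rightarrow> 'a \<Rightarrow> 'b::euclidean_space"
  assumes q: "1 \<le> q" and w: "integrable lborel w"
    and [measurable]: "case_prod F \<in> borel_measurable (borel \<Otimes>\<^sub>M borel)"
    and B: "\<And>z. Lq_powr q (\<lambda>x. F x z) \<le> B"
  shows "Lq_powr q (\<lambda>x. LINT z|lborel. w z *\<^sub>R F x z) \<le> ennreal ((LINT z|lborel. \<bar>w z\<bar>) powr q) * B"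
proof -
  have [measurable]: "w \<in> borel_measurable borel" using w by simp
  let ?W = "LINT z|lborel. \<bar>w z\<bar>"
  have "Lq_powr q (\<lambda>x. LINT z|lborel. w z *\<^sub>R F x z) \<le>
      ennreal (?W powr (q - 1)) * (\<integral>\<^sup>+z. ennreal \<bar>w z\<bar> * Lq_powr q (\<lambda>x. F x z) \<partial>lborel)"
    by (rule Lq_powr_superposition_le[OF q w]) measurable
  also have "\<dots> \<le> ennreal (?W powr (q - 1)) * (\<integral>\<^sup>+z. ennreal \<bar>w z\<bar> * B \<partial>lborel)"
    by (intro mult_left_mono nn_integral_mono B) auto
  also have "(\<integral>\<^sup>+z. ennreal \<bar>w z\<bar> * B \<partial>lborel) = ennreal ?W * B"
    using w by (simp add: nn_integral_multc nn_integral_eq_integral)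
  finally show ?thesis
    using q by (simp add: mult.assoc[symmetric] ennreal_mult[symmetric] powr_diff_one_mult)
qed

lemma Lq_powr_mollify_le:
  fixes f :: "'a::euclidean_space \<Rightarrow> 'b::euclidean_space"
  assumes q: "1 \<le> q" and w: "integrable lborel w" and [measurable]: "f \<in> borel_measurable borel"
  shows "Lq_powr q (mollify w \<epsilon> f) \<le> ennreal ((LINT z|lborel. \<bar>w z\<bar>) powr q) * Lq_powr q f"
proof -
  have "Lq_powr q (\<lambda>x. f (x - \<epsilon> *\<^sub>R z)) = Lq_powr q f" for z
    using Lq_powr_shift[of f q "- (\<epsilon> *\<^sub>R z)"] by simp
  then show ?thesis
    unfolding mollify_def[abs_def]
    by (intro Lq_powr_superposition_const_le[OF q w]) auto
qed

lemma AE_lborel_shift: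
  fixes P :: "'a::euclidean_space \<Rightarrow> bool"
  assumes "AE x in lborel. P x" shows "AE x in lborel. P (x + c)"
proof -
  have "AE x in distr lborel borel ((+) c). P x" using assms by (subst lborel_distr_plus)
  then have "AE x in lborel. P (c + x)" by (rule AE_distrD[rotated]) simp
  then show ?thesis by (simp add: add.commute)
qed

text \<open>By Tonelli \<open>|w(z)| |f(x - \<epsilon> z)|\<^sup>q\<close> is integrable in \<open>z\<close> for almost every \<open>x\<close>, and \<open>t \<le> 1 + t\<^sup>q\<close>.\<close>

lemma AE_mollify_integrable:
  fixes f :: "'a::euclidean_space \<Rightarrow> 'b::euclidean_space"
  assumes q: "1 \<le> q" and w: "integrable lborel w" and [measurable]: "f \<in> borel_measurable borel"
    and fin: "Lq_powr q f < \<infinity>"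
  shows "AE x in lborel. integrable lborel (\<lambda>z. w z *\<^sub>R f (x - \<epsilon> *\<^sub>R z))"
proof -
  have [measurable]: "w \<in> borel_measurable borel" using w by simp
  have wfin: "(\<integral>\<^sup>+z. ennreal \<bar>w z\<bar> \<partial>lborel) < \<infinity>" using w by (simp add: integrable_iff_bounded)
  have shift: "Lq_powr q (\<lambda>x. f (x - \<epsilon> *\<^sub>R z)) = Lq_powr q f" for z
    using Lq_powr_shift[of f q "- (\<epsilon> *\<^sub>R z)"] by simp
  have "(\<integral>\<^sup>+x. (\<integral>\<^sup>+z. ennreal \<bar>w z\<bar> * ennreal (norm (f (x - \<epsilon> *\<^sub>R z)) powr q) \<partial>lborel) \<partial>lborel) =
      (\<integral>\<^sup>+z. (\<integral>\<^sup>+x. ennreal \<bar>w z\<bar> * ennreal (norm (f (x - \<epsilon> *\<^sub>R z)) powr q) \<partial>lborel) \<partial>lborel)"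
    by (rule lborel_pair.Fubini'[symmetric]) measurable
  also have "\<dots> = (\<integral>\<^sup>+z. ennreal \<bar>w z\<bar> * Lq_powr q f \<partial>lborel)"
    using shift by (intro nn_integral_cong) (simp add: nn_integral_cmult Lq_powr_def)
  also have "\<dots> = (\<integral>\<^sup>+z. ennreal \<bar>w z\<bar> \<partial>lborel) * Lq_powr q f"
    by (rule nn_integral_multc) measurable
  also have "\<dots> < \<infinity>" using wfin fin by (simp add: ennreal_mult_less_top)
  finally have "AE x in lborel. (\<integral>\<^sup>+z. ennreal \<bar>w z\<bar> * ennreal (norm (f (x - \<epsilon> *\<^sub>R z)) powr q) \<partial>lborel) \<noteq> \<infinity>"
    by (intro nn_integral_PInf_AE) auto
  then show ?thesis
  proof eventually_elim
    case (elim x)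
    show ?case
    proof (rule integrableI_bounded)
      have "(\<integral>\<^sup>+z. ennreal (norm (w z *\<^sub>R f (x - \<epsilon> *\<^sub>R z))) \<partial>lborel) \<le>
          (\<integral>\<^sup>+z. ennreal \<bar>w z\<bar> + ennreal \<bar>w z\<bar> * ennreal (norm (f (x - \<epsilon> *\<^sub>R z)) powr q) \<partial>lborel)"
      proof (rule nn_integral_mono)
        fix z
        have "norm y \<le> 1 + norm y powr q" for y :: 'b
          using powr_mono[of 1 q "norm y"] q by (cases "norm y \<le> 1") (auto intro: add_increasing2)
        then have "\<bar>w z\<bar> * norm (f (x - \<epsilon> *\<^sub>R z)) \<le> \<bar>w z\<bar> * (1 + norm (f (x - \<epsilon> *\<^sub>R z)) powr q)"
          by (intro mult_left_mono) auto
        then have "ennreal (norm (w z *\<^sub>R f (x - \<epsilon> *\<^sub>R z))) \<le> ennreal (\<bar>w z\<bar> + \<bar>w z\<bar> * norm (f (x - \<epsilon> *\<^sub>R z)) powr q)"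
          by (intro ennreal_leI) (simp add: algebra_simps)
        then show "ennreal (norm (w z *\<^sub>R f (x - \<epsilon> *\<^sub>R z))) \<le>
            ennreal \<bar>w z\<bar> + ennreal \<bar>w z\<bar> * ennreal (norm (f (x - \<epsilon> *\<^sub>R z)) powr q)"
          by (simp add: ennreal_mult)
      qed
      also have "\<dots> = (\<integral>\<^sup>+z. ennreal \<bar>w z\<bar> \<partial>lborel) +
          (\<integral>\<^sup>+z. ennreal \<bar>w z\<bar> * ennreal (norm (f (x - \<epsilon> *\<^sub>R z)) powr q) \<partial>lborel)"
        by (rule nn_integral_add) auto
      also have "\<dots> < \<infinity>" using wfin elim by (simp add: less_top)
      finally show "(\<integral>\<^sup>+z. ennreal (norm (w z *\<^sub>R f (x - \<epsilon> *\<^sub>R z))) \<partial>lborel) < \<infinity>" .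
    qed measurable
  qed
qed

definition fdiff :: "'a::ab_group_add \<Rightarrow> ('a \<Rightarrow> 'b::ab_group_add) \<Rightarrow> 'a \<Rightarrow> 'b"
  where "fdiff h f x = f (x + h) - f x"

lemma fdiff_borel[measurable]:
  fixes f :: "'a::euclidean_space \<Rightarrow> 'b::euclidean_space"
  assumes [measurable]: "f \<in> borel_measurable borel"
  shows "fdiff h f \<in> borel_measurable borel"
  unfolding fdiff_def[abs_def] by measurable

lemma Lq_powr_fdiff_le:
  fixes f :: "'a::euclidean_space \<Rightarrow> 'b::euclidean_space"
  assumes "1 \<le> q" and [measurable]: "f \<in> borel_measurable borel"
  shows "Lq_powr q (fdiff h f) \<le> ennreal (2 powr q) * Lq_powr q f"
proof -
  have "Lq_powr q (fdiff h f) \<le> ennreal (2 powr (q - 1)) * (Lq_powr q (\<lambda>x. f (x + h)) + Lq_powr q f)"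
    unfolding fdiff_def[abs_def] by (intro Lq_powr_diff_le assms) measurable
  also have "\<dots> = ennreal (2 powr (q - 1)) * (ennreal 2 * Lq_powr q f)"
    by (simp add: Lq_powr_shift mult_2)
  also have "\<dots> = ennreal (2 powr q) * Lq_powr q f"
  proof -
    have "ennreal (2 powr (q - 1)) * ennreal 2 = ennreal (2 powr q)"
      unfolding ennreal_mult[OF powr_ge_zero zero_le_numeral, symmetric] by (simp add: powr_diff)
    then show ?thesis by (simp add: mult.assoc[symmetric])
  qed
  finally show ?thesis .
qed

lemma AE_fdiff_mollify:
  fixes f :: "'a::euclidean_space \<Rightarrow> 'b::euclidean_space"
  assumes q: "1 \<le> q" and w: "integrable lborel w" and [measurable]: "f \<in> borel_measurable borel"
    and fin: "Lq_powr q f < \<infinity>"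
  shows "AE x in lborel. fdiff h (mollify w \<epsilon> f) x = mollify w \<epsilon> (fdiff h f) x"
proof -
  have "AE x in lborel. integrable lborel (\<lambda>z. w z *\<^sub>R f (x - \<epsilon> *\<^sub>R z))"
    by (rule AE_mollify_integrable[OF q w _ fin]) measurable
  moreover from this have "AE x in lborel. integrable lborel (\<lambda>z. w z *\<^sub>R f (x + h - \<epsilon> *\<^sub>R z))"
    by (rule AE_lborel_shift)
  ultimately show ?thesis
  proof eventually_elim
    case (elim x)
    have eq: "x - \<epsilon> *\<^sub>R z + h = x + h - \<epsilon> *\<^sub>R z" for z by simp
    show ?case using elim
      by (simp add: fdiff_def mollify_def scaleR_diff_right eq)
  qed
qed

lemma Lq_powr_cong_AE: "AE x in lborel. f x = g x \<Longrightarrow> Lq_powr q f = Lq_powr q g"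
  unfolding Lq_powr_def by (intro nn_integral_cong_AE) (auto elim: eventually_mono)

lemma Lq_powr_fdiff_mollify_le:
  fixes f :: "'a::euclidean_space \<Rightarrow> 'b::euclidean_space"
  assumes q: "1 \<le> q" and w: "integrable lborel w" and [measurable]: "f \<in> borel_measurable borel"
    and fin: "Lq_powr q f < \<infinity>"
  shows "Lq_powr q (fdiff h (mollify w \<epsilon> f)) \<le> ennreal ((LINT z|lborel. \<bar>w z\<bar>) powr q) * Lq_powr q (fdiff h f)"
  using Lq_powr_cong_AE[OF AE_fdiff_mollify[OF assms], of q h \<epsilon>] Lq_powr_mollify_le[OF q w, of "fdiff h f" \<epsilon>]
  by simp

text \<open>A translation of the convolution can be moved to the kernel, where it becomes a translation by \<open>h / \<epsilon>\<close>.\<close>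

lemma AE_fdiff_mollify_kernel:
  fixes f :: "'a::euclidean_space \<Rightarrow> 'b::euclidean_space"
  assumes q: "1 \<le> q" and w: "integrable lborel w" and [measurable]: "f \<in> borel_measurable borel"
    and fin: "Lq_powr q f < \<infinity>" and \<epsilon>: "0 < \<epsilon>"
  shows "AE x in lborel. fdiff h (mollify w \<epsilon> f) x = mollify (fdiff (h /\<^sub>R \<epsilon>) w) \<epsilon> f x"
proof -
  have [measurable]: "w \<in> borel_measurable borel" using w by simp
  have int: "AE x in lborel. integrable lborel (\<lambda>z. w z *\<^sub>R f (x - \<epsilon> *\<^sub>R z))"
    by (rule AE_mollify_integrable[OF q w _ fin]) measurable
  moreover from this have "AE x in lborel. integrable lborel (\<lambda>z. w z *\<^sub>R f (x + h - \<epsilon> *\<^sub>R z))"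
    by (rule AE_lborel_shift)
  ultimately show ?thesis
  proof eventually_elim
    case (elim x)
    have eq: "x + h - \<epsilon> *\<^sub>R (z + h /\<^sub>R \<epsilon>) = x - \<epsilon> *\<^sub>R z" for z
      using \<epsilon> by (simp add: scaleR_add_right)
    have "mollify w \<epsilon> f (x + h) = (LINT z|lborel. w (z + h /\<^sub>R \<epsilon>) *\<^sub>R f (x + h - \<epsilon> *\<^sub>R (z + h /\<^sub>R \<epsilon>)))"
      unfolding mollify_def
      by (rule integral_lborel_shift[of "\<lambda>z. w z *\<^sub>R f (x + h - \<epsilon> *\<^sub>R z)", symmetric]) measurable
    moreover have "integrable lborel (\<lambda>z. w (z + h /\<^sub>R \<epsilon>) *\<^sub>R f (x - \<epsilon> *\<^sub>R z))"
      using integrable_lborel_shift[OF elim(2), of "h /\<^sub>R \<epsilon>"] by (simp only: eq)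
    ultimately show ?case using elim(1)
      unfolding eq by (simp add: fdiff_def mollify_def scaleR_diff_left)
  qed
qed

text \<open>One difference falls on the kernel and one on the function.\<close>

lemma Lq_powr_second_fdiff_mollify_le:
  fixes f :: "'a::euclidean_space \<Rightarrow> 'b::euclidean_space"
  assumes q: "1 \<le> q" and w: "integrable lborel w" and [measurable]: "f \<in> borel_measurable borel"
    and fin: "Lq_powr q f < \<infinity>" and \<epsilon>: "0 < \<epsilon>"
    and M: "0 \<le> M" "\<And>k. (\<integral>\<^sup>+x. ennreal \<bar>w (x + k) - w x\<bar> \<partial>lborel) \<le> ennreal (M * norm k)"
  shows "Lq_powr q (fdiff h (fdiff h (mollify w \<epsilon> f))) \<le> ennreal ((M * (norm h / \<epsilon>)) powr q) * Lq_powr q (fdiff h f)"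
proof -
  have [measurable]: "w \<in> borel_measurable borel" using w by simp
  let ?k = "h /\<^sub>R \<epsilon>"
  have fin': "Lq_powr q (fdiff h f) < \<infinity>"
    using Lq_powr_fdiff_le[OF q, of f h] fin by (auto simp: ennreal_mult_less_top intro: le_less_trans)
  have wk: "integrable lborel (fdiff ?k w)"
    unfolding fdiff_def[abs_def] by (intro Bochner_Integration.integrable_diff integrable_lborel_shift w)
  have "ennreal (LINT z|lborel. \<bar>fdiff ?k w z\<bar>) \<le> ennreal (M * norm ?k)"
    using M(2)[of ?k] nn_integral_eq_integral[OF integrable_abs[OF wk]] by (simp add: fdiff_def)
  then have le: "(LINT z|lborel. \<bar>fdiff ?k w z\<bar>) \<le> M * (norm h / \<epsilon>)"
    using M(1) \<epsilon> by (simp add: divide_inverse mult.commute)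
  have "AE x in lborel. fdiff h (mollify w \<epsilon> f) x = mollify w \<epsilon> (fdiff h f) x"
    by (rule AE_fdiff_mollify[OF q w _ fin]) measurable
  moreover from this have "AE x in lborel. fdiff h (mollify w \<epsilon> f) (x + h) = mollify w \<epsilon> (fdiff h f) (x + h)"
    by (rule AE_lborel_shift)
  moreover have "AE x in lborel. fdiff h (mollify w \<epsilon> (fdiff h f)) x = mollify (fdiff ?k w) \<epsilon> (fdiff h f) x"
    by (rule AE_fdiff_mollify_kernel[OF q w _ fin' \<epsilon>]) measurable
  ultimately have "AE x in lborel. fdiff h (fdiff h (mollify w \<epsilon> f)) x = mollify (fdiff ?k w) \<epsilon> (fdiff h f) x"
  proof eventually_elim
    case (elim x)
    then show ?case by (simp add: fdiff_def[of h "fdiff h (mollify w \<epsilon> f)"] fdiff_def[of h "mollify w \<epsilon> (fdiff h f)"])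
  qed
  then have "Lq_powr q (fdiff h (fdiff h (mollify w \<epsilon> f))) = Lq_powr q (mollify (fdiff ?k w) \<epsilon> (fdiff h f))"
    by (rule Lq_powr_cong_AE)
  also have "\<dots> \<le> ennreal ((LINT z|lborel. \<bar>fdiff ?k w z\<bar>) powr q) * Lq_powr q (fdiff h f)"
    by (rule Lq_powr_mollify_le[OF q wk]) measurable
  also have "\<dots> \<le> ennreal ((M * (norm h / \<epsilon>)) powr q) * Lq_powr q (fdiff h f)"
    using le q by (intro mult_right_mono ennreal_leI powr_mono2) auto
  finally show ?thesis .
qed

section \<open>Increments of a mollified Besov function\<close>

text \<open>Lets the loss \<open>(1 - \<delta>)\<^sup>1\<^sup>-\<^sup>q\<close> of the convexity estimate be absorbed by any strict inequality.\<close>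

lemma powr_factor_near_one:
  fixes a b q :: real
  assumes "a < b"
  shows "\<exists>\<delta>. 0 < \<delta> \<and> \<delta> < 1 \<and> (1 - \<delta>) powr (1 - q) * a < b"
proof -
  have "((\<lambda>\<delta>. (1 - \<delta>) powr (1 - q) * a) \<longlongrightarrow> (1 - 0) powr (1 - q) * a) (at_right 0)"
    by (intro tendsto_intros) auto
  then have "eventually (\<lambda>\<delta>. (1 - \<delta>) powr (1 - q) * a < b) (at_right 0)"
    using assms by (intro order_tendstoD(2)) auto
  moreover have "eventually (\<lambda>\<delta>::real. \<delta> \<in> {0<..<1}) (at_right 0)"
    by (rule eventually_at_right_real) simp
  ultimately have "eventually (\<lambda>\<delta>. 0 < \<delta> \<and> \<delta> < 1 \<and> (1 - \<delta>) powr (1 - q) * a < b) (at_right 0)"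
    by eventually_elim auto
  then show ?thesis by (rule eventually_happens'[rotated]) (simp add: trivial_limit_at_right_real)
qed

text \<open>Doubling \<open>h\<close> multiplies the claimed bound by \<open>2\<^sup>p\<^sup>+\<^sup>\<alpha>\<close>, which is less than \<open>1 / \<nu>\<close>.  So the bound propagates from the scale
  \<open>2 h\<close> to \<open>h\<close>, starting at \<open>\<epsilon> / 2 < |h| \<le> \<epsilon>\<close>, where it is the trivial bound.\<close>

lemma dyadic_decay:
  fixes A :: "'a::real_normed_vector \<Rightarrow> ennreal"
  assumes B: "0 \<le> B" and \<mu>: "0 \<le> \<mu>" and \<nu>: "0 \<le> \<nu>" "\<nu> * 2 powr (p + \<alpha>) < 1" and \<alpha>: "0 < \<alpha>" "\<alpha> \<le> q" and \<epsilon>: "0 < \<epsilon>"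
    and A1: "\<And>h. A h \<le> ennreal (B * norm h powr p)"
    and A2: "\<And>h. A h \<le> ennreal \<nu> * A (2 *\<^sub>R h) + ennreal (\<mu> * (norm h / \<epsilon>) powr q * norm h powr p)"
    and K: "B * 2 powr \<alpha> \<le> K" "\<mu> \<le> K * (1 - \<nu> * 2 powr (p + \<alpha>))"
    and h: "h \<noteq> 0" "norm h \<le> \<epsilon>"
  shows "A h \<le> ennreal (K * norm h powr p * (norm h / \<epsilon>) powr \<alpha>)"
proof -
  have K0: "0 \<le> K" using B K(1) by (meson mult_nonneg_nonneg order_trans powr_ge_zero)
  have upper: "A h \<le> ennreal (K * norm h powr p * (norm h / \<epsilon>) powr \<alpha>)"
    if "\<epsilon> / 2 < norm h" "norm h \<le> \<epsilon>" for h
  proof -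
    have "2 powr - \<alpha> = (1 / 2) powr \<alpha>" by (simp add: powr_minus powr_divide inverse_eq_divide)
    also have "\<dots> \<le> (norm h / \<epsilon>) powr \<alpha>" using that \<epsilon> \<alpha> by (intro powr_mono2) (auto simp: field_simps)
    finally have "2 powr - \<alpha> \<le> (norm h / \<epsilon>) powr \<alpha>" .
    then have "B * 2 powr \<alpha> * 2 powr - \<alpha> \<le> K * (norm h / \<epsilon>) powr \<alpha>"
      using K B K0 by (intro mult_mono) auto
    moreover have "2 powr \<alpha> * 2 powr - \<alpha> = (1 :: real)" by (simp flip: powr_add)
    ultimately have "B \<le> K * (norm h / \<epsilon>) powr \<alpha>" by (simp only: mult.assoc mult_1_right)
    then have "B * norm h powr p \<le> K * (norm h / \<epsilon>) powr \<alpha> * norm h powr p"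
      by (rule mult_right_mono) simp
    then show ?thesis using A1[of h] by (auto intro!: ennreal_leI elim!: order_trans simp: ac_simps)
  qed
  have step: "A h \<le> ennreal (K * norm h powr p * (norm h / \<epsilon>) powr \<alpha>)"
    if IH: "A (2 *\<^sub>R h) \<le> ennreal (K * norm (2 *\<^sub>R h) powr p * (norm (2 *\<^sub>R h) / \<epsilon>) powr \<alpha>)"
      and h: "norm h \<le> \<epsilon>" for h
  proof -
    let ?X = "norm h powr p * (norm h / \<epsilon>) powr \<alpha>"
    have X: "0 \<le> ?X" by simp
    have two: "K * norm (2 *\<^sub>R h) powr p * (norm (2 *\<^sub>R h) / \<epsilon>) powr \<alpha> = 2 powr (p + \<alpha>) * K * ?X"
    proof -
      have "norm (2 *\<^sub>R h) powr p = 2 powr p * norm h powr p" by (simp add: powr_mult)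
      moreover have "(norm (2 *\<^sub>R h) / \<epsilon>) powr \<alpha> = 2 powr \<alpha> * (norm h / \<epsilon>) powr \<alpha>"
        using \<epsilon> powr_mult[of 2 "norm h / \<epsilon>" \<alpha>] by simp
      ultimately show ?thesis by (simp add: powr_add)
    qed
    have "(norm h / \<epsilon>) powr q \<le> (norm h / \<epsilon>) powr \<alpha>"
    proof (cases "h = 0")
      case False
      then show ?thesis using h \<epsilon> \<alpha> by (intro powr_mono') auto
    qed (use \<alpha> in simp)
    then have "\<mu> * (norm h / \<epsilon>) powr q * norm h powr p \<le> \<mu> * (norm h / \<epsilon>) powr \<alpha> * norm h powr p"
      using \<mu> by (intro mult_right_mono mult_left_mono) auto
    then have mu: "\<mu> * (norm h / \<epsilon>) powr q * norm h powr p \<le> \<mu> * ?X" by (simp add: ac_simps)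
    have "A h \<le> ennreal \<nu> * A (2 *\<^sub>R h) + ennreal (\<mu> * (norm h / \<epsilon>) powr q * norm h powr p)"
      by (rule A2)
    also have "\<dots> \<le> ennreal \<nu> * ennreal (2 powr (p + \<alpha>) * K * ?X) + ennreal (\<mu> * ?X)"
      using IH mu unfolding two by (intro add_mono mult_left_mono ennreal_leI) auto
    also have "\<dots> = ennreal (\<nu> * (2 powr (p + \<alpha>) * K * ?X) + \<mu> * ?X)"
      using \<nu>(1) K0 \<mu> X by (simp add: ennreal_mult[symmetric])
    also have "\<nu> * (2 powr (p + \<alpha>) * K * ?X) + \<mu> * ?X = (\<nu> * 2 powr (p + \<alpha>) * K + \<mu>) * ?X"
      by (simp add: algebra_simps)
    also have "\<dots> \<le> K * ?X"
      using K(2) X by (intro mult_right_mono) (auto simp: algebra_simps)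
    finally show ?thesis by (simp add: ennreal_leI mult.assoc)
  qed
  have "\<forall>h::'a. \<epsilon> / 2 ^ Suc n < norm h \<and> norm h \<le> \<epsilon> \<longrightarrow>
      A h \<le> ennreal (K * norm h powr p * (norm h / \<epsilon>) powr \<alpha>)" for n
  proof (induction n)
    case 0
    then show ?case using upper by simp
  next
    case (Suc n)
    show ?case
    proof safe
      fix h :: 'a assume h: "\<epsilon> / 2 ^ Suc (Suc n) < norm h" "norm h \<le> \<epsilon>"
      show "A h \<le> ennreal (K * norm h powr p * (norm h / \<epsilon>) powr \<alpha>)"
      proof (cases "\<epsilon> / 2 < norm h")
        case False
        have "\<epsilon> / 2 ^ Suc n < norm (2 *\<^sub>R h) \<and> norm (2 *\<^sub>R h) \<le> \<epsilon>"
          using False h \<epsilon> by (simp add: divide_less_eq mult.commute)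
        then show ?thesis using Suc h(2) by (intro step[OF mp[OF spec[OF Suc.IH]]])
      qed (use upper h in auto)
    qed
  qed
  moreover obtain n where "(1 / 2) ^ n < norm h / \<epsilon>"
    using real_arch_pow_inv[of "norm h / \<epsilon>" "1 / 2"] h \<epsilon> by auto
  then have "\<epsilon> / 2 ^ Suc n < norm h"
  proof -
    have "\<epsilon> / 2 ^ Suc n \<le> \<epsilon> * (1 / 2) ^ n" using \<epsilon> by (simp add: field_simps power_divide)
    also have "\<dots> < norm h" using \<open>(1 / 2) ^ n < norm h / \<epsilon>\<close> \<epsilon> by (simp add: less_divide_eq mult.commute)
    finally show ?thesis .
  qed
  with calculation show ?thesis using h by blast
qed

text \<open>Here \<open>C\<close> is the Besov constant of \<open>u\<close> and \<open>M\<close> bounds the \<open>L\<^sup>1\<close> modulus of continuity of \<open>\<eta>\<close>, the form in which membership in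
  \<open>W\<^sup>1\<^sup>,\<^sup>1\<close> is used.\<close>

locale mollified_besov =
  fixes q r C M :: real and u :: "'a::euclidean_space \<Rightarrow> 'b::euclidean_space" and \<eta> :: "'a \<Rightarrow> real"
  assumes q: "1 \<le> q" and r: "0 < r" "r < 1"
    and u_borel[measurable]: "u \<in> borel_measurable borel"
    and u_fin: "Lq_powr q u < \<infinity>"
    and C: "0 \<le> C" and besov: "\<And>h. Lq_powr q (fdiff h u) \<le> ennreal (C * norm h powr (r * q))"
    and \<eta>: "integrable lborel \<eta>"
    and M: "0 \<le> M" and L1_mod: "\<And>k. (\<integral>\<^sup>+x. ennreal \<bar>\<eta> (x + k) - \<eta> x\<bar> \<partial>lborel) \<le> ennreal (M * norm k)"
begin

abbreviation W :: real where "W \<equiv> LINT z|lborel. \<bar>\<eta> z\<bar>"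

lemma \<eta>_borel[measurable]: "\<eta> \<in> borel_measurable borel"
  using \<eta> by simp

lemma W_nonneg: "0 \<le> W" by simp

lemma Lq_powr_fdiff_mollify_besov:
  "Lq_powr q (fdiff h (mollify \<eta> \<epsilon> u)) \<le> ennreal (W powr q * C * norm h powr (r * q))"
proof -
  have "Lq_powr q (fdiff h (mollify \<eta> \<epsilon> u)) \<le> ennreal (W powr q) * Lq_powr q (fdiff h u)"
    by (rule Lq_powr_fdiff_mollify_le[OF q \<eta> u_borel u_fin])
  also have "\<dots> \<le> ennreal (W powr q) * ennreal (C * norm h powr (r * q))"
    by (intro mult_left_mono besov) simp
  finally show ?thesis using C by (simp add: ennreal_mult[symmetric] mult.assoc)
qed

lemma Lq_powr_fdiff_mollify_bounded:
  "\<exists>K\<ge>0. \<forall>\<epsilon> h. Lq_powr q (fdiff h (mollify \<eta> \<epsilon> u)) \<le> ennreal K"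
proof -
  define U where "U = enn2real (Lq_powr q u)"
  have U: "Lq_powr q u = ennreal U" "0 \<le> U" using u_fin by (auto simp: U_def less_top)
  have "Lq_powr q (fdiff h (mollify \<eta> \<epsilon> u)) \<le> ennreal (W powr q * (2 powr q * U))" for \<epsilon> h
  proof -
    have "Lq_powr q (fdiff h (mollify \<eta> \<epsilon> u)) \<le> ennreal (W powr q) * Lq_powr q (fdiff h u)"
      by (rule Lq_powr_fdiff_mollify_le[OF q \<eta> u_borel u_fin])
    also have "\<dots> \<le> ennreal (W powr q) * (ennreal (2 powr q) * Lq_powr q u)"
      by (intro mult_left_mono Lq_powr_fdiff_le q u_borel) simp
    finally show ?thesis using U by (simp add: ennreal_mult)
  qed
  moreover have "0 \<le> W powr q * (2 powr q * U)" using U by simp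
  ultimately show ?thesis by blast
qed

text \<open>Twice the increment over \<open>h\<close> is the increment over \<open>2 h\<close> minus the second difference.\<close>

lemma Lq_powr_fdiff_double:
  fixes f :: "'a \<Rightarrow> 'b"
  assumes \<delta>: "0 < \<delta>" "\<delta> < 1" and [measurable]: "f \<in> borel_measurable borel"
  shows "Lq_powr q (fdiff h f) \<le> ennreal ((1 - \<delta>) powr (1 - q) * 2 powr - q) * Lq_powr q (fdiff (2 *\<^sub>R h) f)
    + ennreal (\<delta> powr (1 - q) * 2 powr - q) * Lq_powr q (fdiff h (fdiff h f))"
proof -
  have id: "fdiff h f x = (1 / 2) *\<^sub>R fdiff (2 *\<^sub>R h) f x + (1 / 2) *\<^sub>R (- fdiff h (fdiff h f) x)" for x
  proof -
    have "fdiff (2 *\<^sub>R h) f x - fdiff h (fdiff h f) x = 2 *\<^sub>R fdiff h f x"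
      by (simp add: fdiff_def scaleR_2 add.assoc)
    then have "fdiff h f x = (1 / 2) *\<^sub>R (fdiff (2 *\<^sub>R h) f x - fdiff h (fdiff h f) x)"
      by simp
    then show ?thesis by (simp add: scaleR_diff_right)
  qed
  have half: "norm ((1 / 2) *\<^sub>R y) powr q = 2 powr - q * norm y powr q" for y :: 'b
    by (simp add: powr_divide powr_minus_divide)
  have "Lq_powr q (fdiff h f) \<le> (\<integral>\<^sup>+x. ennreal ((1 - \<delta>) powr (1 - q) * 2 powr - q) * ennreal (norm (fdiff (2 *\<^sub>R h) f x) powr q)
      + ennreal (\<delta> powr (1 - q) * 2 powr - q) * ennreal (norm (fdiff h (fdiff h f) x) powr q) \<partial>lborel)"
    unfolding Lq_powr_def
  proof (rule nn_integral_mono)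
    fix x
    have "norm (fdiff h f x) powr q \<le> (1 - \<delta>) powr (1 - q) * norm ((1 / 2) *\<^sub>R fdiff (2 *\<^sub>R h) f x) powr q
        + \<delta> powr (1 - q) * norm ((1 / 2) *\<^sub>R (- fdiff h (fdiff h f) x)) powr q"
      by (subst id) (rule norm_add_powr_le_split[OF q \<delta>])
    then have "ennreal (norm (fdiff h f x) powr q) \<le>
        ennreal ((1 - \<delta>) powr (1 - q) * 2 powr - q * norm (fdiff (2 *\<^sub>R h) f x) powr q
        + \<delta> powr (1 - q) * 2 powr - q * norm (fdiff h (fdiff h f) x) powr q)"
      unfolding half norm_minus_cancel by (intro ennreal_leI) (simp add: mult.assoc)
    then show "ennreal (norm (fdiff h f x) powr q) \<le>
        ennreal ((1 - \<delta>) powr (1 - q) * 2 powr - q) * ennreal (norm (fdiff (2 *\<^sub>R h) f x) powr q)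
        + ennreal (\<delta> powr (1 - q) * 2 powr - q) * ennreal (norm (fdiff h (fdiff h f) x) powr q)"
      by (simp add: ennreal_mult)
  qed
  also have "\<dots> = ennreal ((1 - \<delta>) powr (1 - q) * 2 powr - q) * Lq_powr q (fdiff (2 *\<^sub>R h) f)
    + ennreal (\<delta> powr (1 - q) * 2 powr - q) * Lq_powr q (fdiff h (fdiff h f))"
    unfolding Lq_powr_def by (simp add: nn_integral_add nn_integral_cmult)
  finally show ?thesis .
qed

text \<open>The exponent \<open>\<alpha> = (1 - r) q / 2\<close> lies strictly between \<open>0\<close> and the exponent \<open>(1 - r) q\<close> at which the doubling factor
  \<open>2\<^sup>-\<^sup>q 2\<^sup>p\<^sup>+\<^sup>\<alpha>\<close> reaches \<open>1\<close>; this leaves room for the factor \<open>(1 - \<delta>)\<^sup>1\<^sup>-\<^sup>q\<close>.\<close>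

lemma Lq_powr_fdiff_mollify_small:
  "\<exists>K\<ge>0. \<exists>\<alpha>>0. \<forall>\<epsilon>>0. \<forall>h. h \<noteq> 0 \<longrightarrow> norm h \<le> \<epsilon> \<longrightarrow>
    Lq_powr q (fdiff h (mollify \<eta> \<epsilon> u)) \<le> ennreal (K * norm h powr (r * q) * (norm h / \<epsilon>) powr \<alpha>)"
proof -
  define p where "p = r * q"
  define \<alpha> where "\<alpha> = (1 - r) * q / 2"
  have \<alpha>: "0 < \<alpha>" "\<alpha> \<le> q" using q r by (auto simp: \<alpha>_def field_simps)
  have "2 powr - q * 2 powr (p + \<alpha>) = 2 powr - \<alpha>"
  proof -
    have "- q + (p + \<alpha>) = - \<alpha>" by (simp add: p_def \<alpha>_def field_simps)
    then show ?thesis by (simp only: powr_add[symmetric])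
  qed
  also have "\<dots> < 1" using \<alpha> powr_less_mono[of "- \<alpha>" 0 2] by simp
  finally obtain \<delta> where \<delta>: "0 < \<delta>" "\<delta> < 1" "(1 - \<delta>) powr (1 - q) * (2 powr - q * 2 powr (p + \<alpha>)) < 1"
    using powr_factor_near_one by blast
  define \<nu> where "\<nu> = (1 - \<delta>) powr (1 - q) * 2 powr - q"
  have \<nu>: "0 \<le> \<nu>" "\<nu> * 2 powr (p + \<alpha>) < 1" using \<delta>(3) by (auto simp: \<nu>_def mult.assoc)
  define \<mu> where "\<mu> = \<delta> powr (1 - q) * 2 powr - q * (M powr q * C)"
  have \<mu>: "0 \<le> \<mu>" using C by (simp add: \<mu>_def)
  define B where "B = W powr q * C"
  have B: "0 \<le> B" using C by (simp add: B_def)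
  \<comment> \<open>The first entry starts the dyadic induction and the second closes its step.\<close>
  define K where "K = max (B * 2 powr \<alpha>) (\<mu> / (1 - \<nu> * 2 powr (p + \<alpha>)))"
  have K: "B * 2 powr \<alpha> \<le> K" "\<mu> \<le> K * (1 - \<nu> * 2 powr (p + \<alpha>))"
    using \<nu>(2) by (auto simp: K_def simp flip: pos_divide_le_eq)
  have K0: "0 \<le> K" using B by (auto simp: K_def le_max_iff_disj)
  have "Lq_powr q (fdiff h (mollify \<eta> \<epsilon> u)) \<le> ennreal (K * norm h powr p * (norm h / \<epsilon>) powr \<alpha>)"
    if \<epsilon>: "0 < \<epsilon>" and h: "h \<noteq> 0" "norm h \<le> \<epsilon>" for \<epsilon> h
  proof (rule dyadic_decay[where A = "\<lambda>h. Lq_powr q (fdiff h (mollify \<eta> \<epsilon> u))", OF B \<mu> \<nu> \<alpha> \<epsilon> _ _ K h])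
    fix h
    show "Lq_powr q (fdiff h (mollify \<eta> \<epsilon> u)) \<le> ennreal (B * norm h powr p)"
      unfolding B_def p_def by (rule Lq_powr_fdiff_mollify_besov)
    have second: "Lq_powr q (fdiff h (fdiff h (mollify \<eta> \<epsilon> u))) \<le>
        ennreal ((M * (norm h / \<epsilon>)) powr q) * ennreal (C * norm h powr p)"
      using Lq_powr_second_fdiff_mollify_le[OF q \<eta> u_borel u_fin \<epsilon> M L1_mod, of h]
        mult_left_mono[OF besov[of h], of "ennreal ((M * (norm h / \<epsilon>)) powr q)"]
      unfolding p_def by (auto intro: order_trans)
    have "Lq_powr q (fdiff h (mollify \<eta> \<epsilon> u)) \<le> ennreal \<nu> * Lq_powr q (fdiff (2 *\<^sub>R h) (mollify \<eta> \<epsilon> u))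
      + ennreal (\<delta> powr (1 - q) * 2 powr - q) * Lq_powr q (fdiff h (fdiff h (mollify \<eta> \<epsilon> u)))"
      unfolding \<nu>_def by (rule Lq_powr_fdiff_double[OF \<delta>(1,2)]) measurable
    also have "\<dots> \<le> ennreal \<nu> * Lq_powr q (fdiff (2 *\<^sub>R h) (mollify \<eta> \<epsilon> u))
      + ennreal (\<delta> powr (1 - q) * 2 powr - q) * (ennreal ((M * (norm h / \<epsilon>)) powr q) * ennreal (C * norm h powr p))"
      by (intro add_left_mono mult_left_mono second) simp
    also have "ennreal (\<delta> powr (1 - q) * 2 powr - q) * (ennreal ((M * (norm h / \<epsilon>)) powr q) * ennreal (C * norm h powr p))
        = ennreal (\<mu> * (norm h / \<epsilon>) powr q * norm h powr p)"
      using C M \<epsilon> powr_mult[of M "norm h / \<epsilon>" q] by (simp add: ennreal_mult[symmetric] \<mu>_def ac_simps)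
    finally show "Lq_powr q (fdiff h (mollify \<eta> \<epsilon> u)) \<le> ennreal \<nu> * Lq_powr q (fdiff (2 *\<^sub>R h) (mollify \<eta> \<epsilon> u))
      + ennreal (\<mu> * (norm h / \<epsilon>) powr q * norm h powr p)" .
  qed
  then show ?thesis using K0 \<alpha>(1) unfolding p_def by blast
qed

definition tail :: "real \<Rightarrow> real"
  where "tail s = (LINT z|(lborel :: 'a measure). \<bar>\<eta> z\<bar> * min 1 (norm z / s) powr (r * q))"

lemma tail_integrable: "0 < s \<Longrightarrow> integrable lborel (\<lambda>z. \<bar>\<eta> z\<bar> * min 1 (norm z / s) powr (r * q))"
  using q r by (intro Bochner_Integration.integrable_bound[OF \<eta>]) (auto simp: abs_mult intro!: mult_left_le powr_le1)

lemma tail_nonneg: "0 \<le> tail s"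
  unfolding tail_def by (intro Bochner_Integration.integral_nonneg) simp

lemma tail_le: "0 < s \<Longrightarrow> tail s \<le> W"
  unfolding tail_def using q r \<eta>
  by (intro integral_mono tail_integrable) (auto intro!: mult_left_le powr_le1)

lemma tail_borel[measurable]: "tail \<in> borel_measurable borel"
  unfolding tail_def[abs_def] by measurable

lemma tail_tendsto_0: "(tail \<longlongrightarrow> 0) at_top"
proof -
  have "((\<lambda>s. LINT z|(lborel :: 'a measure). \<bar>\<eta> z\<bar> * min 1 (norm z / s) powr (r * q)) \<longlongrightarrow> (LINT z|(lborel :: 'a measure). 0)) at_top"
  proof (rule integral_dominated_convergence_at_top[where w = "\<lambda>z. \<bar>\<eta> z\<bar>"])
    show "AE z in lborel. ((\<lambda>s. \<bar>\<eta> z\<bar> * min 1 (norm z / s) powr (r * q)) \<longlongrightarrow> 0) at_top"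
    proof (rule AE_I2)
      fix z :: 'a
      have "((\<lambda>s. min 1 (norm z / s)) \<longlongrightarrow> min 1 0) at_top"
        by (intro tendsto_min tendsto_const real_tendsto_divide_at_top[OF tendsto_const filterlim_ident])
      then have lim: "((\<lambda>s. min 1 (norm z / s)) \<longlongrightarrow> 0) at_top" by simp
      have "((\<lambda>s. min 1 (norm z / s) powr (r * q)) \<longlongrightarrow> 0 powr (r * q)) at_top"
      proof (rule tendsto_powr'[OF lim tendsto_const])
        have "eventually (\<lambda>s. 0 \<le> min 1 (norm z / s)) at_top"
          using eventually_gt_at_top[of 0] by eventually_elim simp
        then show "0 \<noteq> (0::real) \<or> 0 < r * q \<and> (\<forall>\<^sub>F s in at_top. 0 \<le> min 1 (norm z / s))"
          using q r by simp
      qed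
      from tendsto_mult[OF tendsto_const this, of "\<bar>\<eta> z\<bar>"]
      show "((\<lambda>s. \<bar>\<eta> z\<bar> * min 1 (norm z / s) powr (r * q)) \<longlongrightarrow> 0) at_top" by simp
    qed
    show "\<forall>\<^sub>F s in at_top. AE z in lborel. norm (\<bar>\<eta> z\<bar> * min 1 (norm z / s) powr (r * q)) \<le> \<bar>\<eta> z\<bar>"
      using eventually_gt_at_top[of 0]
    proof eventually_elim
      case (elim s)
      then show ?case using q r by (intro AE_I2) (auto simp: abs_mult intro!: mult_left_le powr_le1)
    qed
  qed (use \<eta> in auto)
  then show ?thesis by (simp add: tail_def[abs_def])
qed

text \<open>The error is a superposition, with weight \<open>\<eta>(z)\<close>, of \<open>F x z\<close>, the increment of \<open>u\<close> over \<open>h\<close> at \<open>x - \<epsilon> z\<close> minus that at \<open>x\<close>.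
  Exchanging the roles of the two steps, \<open>F x z\<close> is also the increment over \<open>- \<epsilon> z\<close> at \<open>x + h\<close> minus that at \<open>x\<close>.  The Besov bound
  is used for the shorter of the two.\<close>

lemma Lq_powr_fdiff_error:
  assumes \<epsilon>: "0 < \<epsilon>" and h: "h \<noteq> 0"
  shows "Lq_powr q (\<lambda>x. fdiff h (mollify \<eta> \<epsilon> u) x - (LINT z|lborel. \<eta> z) *\<^sub>R fdiff h u x) \<le>
    ennreal (W powr (q - 1) * (2 powr q * C) * norm h powr (r * q) * tail (norm h / \<epsilon>))"
proof -
  let ?m = "LINT z|lborel. \<eta> z"
  define F where "F x z = fdiff h u (x - \<epsilon> *\<^sub>R z) - fdiff h u x" for x z
  have [measurable]: "case_prod F \<in> borel_measurable (borel \<Otimes>\<^sub>M borel)"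
    unfolding F_def by measurable
  have fin: "Lq_powr q (fdiff h u) < \<infinity>"
    using besov[of h] by (auto intro: le_less_trans)
  have "AE x in lborel. fdiff h (mollify \<eta> \<epsilon> u) x = mollify \<eta> \<epsilon> (fdiff h u) x"
    by (rule AE_fdiff_mollify[OF q \<eta> u_borel u_fin])
  moreover have "AE x in lborel. integrable lborel (\<lambda>z. \<eta> z *\<^sub>R fdiff h u (x - \<epsilon> *\<^sub>R z))"
    by (rule AE_mollify_integrable[OF q \<eta> _ fin]) measurable
  ultimately have "AE x in lborel. fdiff h (mollify \<eta> \<epsilon> u) x - ?m *\<^sub>R fdiff h u x = (LINT z|lborel. \<eta> z *\<^sub>R F x z)"
  proof eventually_elim
    case (elim x)
    then show ?case using \<eta> by (simp add: F_def mollify_def scaleR_diff_right)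
  qed
  then have "Lq_powr q (\<lambda>x. fdiff h (mollify \<eta> \<epsilon> u) x - ?m *\<^sub>R fdiff h u x) = Lq_powr q (\<lambda>x. LINT z|lborel. \<eta> z *\<^sub>R F x z)"
    by (rule Lq_powr_cong_AE)
  also have "\<dots> \<le> ennreal (W powr (q - 1)) * (\<integral>\<^sup>+z. ennreal \<bar>\<eta> z\<bar> * Lq_powr q (\<lambda>x. F x z) \<partial>lborel)"
    by (rule Lq_powr_superposition_le[OF q \<eta>]) measurable
  also have "\<dots> \<le> ennreal (W powr (q - 1)) * (\<integral>\<^sup>+z. ennreal (2 powr q * C * norm h powr (r * q)) *
      ennreal (\<bar>\<eta> z\<bar> * min 1 (norm z / (norm h / \<epsilon>)) powr (r * q)) \<partial>lborel)"
  proof (intro mult_left_mono nn_integral_mono)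
    fix z
    have two: "ennreal (2 powr (q - 1)) * (ennreal a + ennreal a) = ennreal (2 powr q * a)" if "0 \<le> a" for a
    proof -
      have "ennreal (2 powr (q - 1)) * (ennreal a + ennreal a) = ennreal (2 powr (q - 1) * (a + a))"
        using that by (simp only: ennreal_plus[symmetric] ennreal_mult[symmetric] add_nonneg_nonneg powr_ge_zero)
      also have "2 powr (q - 1) * (a + a) = 2 powr q * a" by (simp add: powr_diff)
      finally show ?thesis .
    qed
    have via: "Lq_powr q (\<lambda>x. F x z) \<le> ennreal (2 powr q * (C * norm k powr (r * q)))"
      if F: "(\<lambda>x. F x z) = (\<lambda>x. fdiff k u (x + l) - fdiff k u x)" for k l
    proof -
      have "Lq_powr q (\<lambda>x. F x z) \<le> ennreal (2 powr (q - 1)) * (Lq_powr q (\<lambda>x. fdiff k u (x + l)) + Lq_powr q (fdiff k u))"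
        unfolding F by (intro Lq_powr_diff_le q) measurable
      also have "Lq_powr q (\<lambda>x. fdiff k u (x + l)) = Lq_powr q (fdiff k u)"
        by (rule Lq_powr_shift) measurable
      also have "ennreal (2 powr (q - 1)) * (Lq_powr q (fdiff k u) + Lq_powr q (fdiff k u)) \<le>
          ennreal (2 powr (q - 1)) * (ennreal (C * norm k powr (r * q)) + ennreal (C * norm k powr (r * q)))"
        by (intro mult_left_mono add_mono besov) simp
      also have "\<dots> = ennreal (2 powr q * (C * norm k powr (r * q)))"
        using C by (intro two) simp
      finally show ?thesis .
    qed
    have 1: "Lq_powr q (\<lambda>x. F x z) \<le> ennreal (2 powr q * (C * norm h powr (r * q)))"
      by (rule via[of h "- (\<epsilon> *\<^sub>R z)"]) (simp add: F_def)
    have 2: "Lq_powr q (\<lambda>x. F x z) \<le> ennreal (2 powr q * (C * norm (- (\<epsilon> *\<^sub>R z)) powr (r * q)))"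
      by (rule via[of "- (\<epsilon> *\<^sub>R z)" h]) (simp add: F_def fdiff_def algebra_simps)
    have "Lq_powr q (\<lambda>x. F x z) \<le> ennreal (2 powr q * C * norm h powr (r * q) * min 1 (norm z / (norm h / \<epsilon>)) powr (r * q))"
    proof (cases "1 \<le> norm z / (norm h / \<epsilon>)")
      case True
      then show ?thesis using 1 by (simp add: min_def mult.assoc)
    next
      case False
      have "norm h powr (r * q) * (norm z / (norm h / \<epsilon>)) powr (r * q) = norm (- (\<epsilon> *\<^sub>R z)) powr (r * q)"
        using h \<epsilon> powr_mult[of "norm h" "norm z / (norm h / \<epsilon>)" "r * q"] by (simp add: mult.commute)
      then show ?thesis using 2 False by (simp add: min_def mult.assoc)
    qed
    then have "ennreal \<bar>\<eta> z\<bar> * Lq_powr q (\<lambda>x. F x z) \<le>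
        ennreal \<bar>\<eta> z\<bar> * ennreal (2 powr q * C * norm h powr (r * q) * min 1 (norm z / (norm h / \<epsilon>)) powr (r * q))"
      by (rule mult_left_mono) simp
    also have "\<dots> = ennreal (2 powr q * C * norm h powr (r * q)) *
        ennreal (\<bar>\<eta> z\<bar> * min 1 (norm z / (norm h / \<epsilon>)) powr (r * q))"
      using C by (simp add: ennreal_mult[symmetric] ac_simps)
    finally show "ennreal \<bar>\<eta> z\<bar> * Lq_powr q (\<lambda>x. F x z) \<le> ennreal (2 powr q * C * norm h powr (r * q)) *
        ennreal (\<bar>\<eta> z\<bar> * min 1 (norm z / (norm h / \<epsilon>)) powr (r * q))" .
  qed simp
  also have "\<dots> = ennreal (W powr (q - 1)) * (ennreal (2 powr q * C * norm h powr (r * q)) * ennreal (tail (norm h / \<epsilon>)))"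
  proof -
    have "(\<integral>\<^sup>+z. ennreal (\<bar>\<eta> z\<bar> * min 1 (norm z / (norm h / \<epsilon>)) powr (r * q)) \<partial>lborel) = ennreal (tail (norm h / \<epsilon>))"
      unfolding tail_def using h \<epsilon> by (intro nn_integral_eq_integral tail_integrable) auto
    then show ?thesis by (subst nn_integral_cmult) auto
  qed
  also have "\<dots> = ennreal (W powr (q - 1) * (2 powr q * C) * norm h powr (r * q) * tail (norm h / \<epsilon>))"
    using C tail_nonneg by (simp add: ennreal_mult[symmetric] ac_simps)
  finally show ?thesis .
qed

end

section \<open>Logarithmic averages\<close>

lemma le_enn2realI: "ennreal a \<le> x \<Longrightarrow> x < \<infinity> \<Longrightarrow> a \<le> enn2real x"
  by (cases x rule: ennreal_cases) (auto simp: ennreal_le_iff2)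

lemma nn_integral_inverse_interval:
  fixes a b c :: real
  assumes "0 < a" "a \<le> b" "0 \<le> c"
  shows "(\<integral>\<^sup>+\<rho>. ennreal (c / \<rho>) * indicator {a<..<b} \<rho> \<partial>lborel) = ennreal (c * (ln b - ln a))"
proof -
  have "(\<integral>\<^sup>+\<rho>. ennreal (c / \<rho>) * indicator {a<..<b} \<rho> \<partial>lborel) = (\<integral>\<^sup>+\<rho>. ennreal (c / \<rho>) * indicator {a..b} \<rho> \<partial>lborel)"
    using AE_lborel_singleton[of a] AE_lborel_singleton[of b]
    by (intro nn_integral_cong_AE, eventually_elim) (auto split: split_indicator)
  also have "\<dots> = ennreal (c * ln b - c * ln a)"
    using assms by (intro nn_integral_FTC_Icc) (auto intro!: derivative_eq_intros)
  finally show ?thesis by (simp add: right_diff_distrib)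
qed

lemma nn_integral_powr_near_0:
  fixes \<alpha> \<epsilon> :: real
  assumes "0 < \<alpha>" "0 < \<epsilon>"
  shows "(\<integral>\<^sup>+\<rho>. ennreal (\<rho> powr (\<alpha> - 1)) * indicator {0<..\<epsilon>} \<rho> \<partial>lborel) = ennreal (\<epsilon> powr \<alpha> / \<alpha>)"
proof -
  have "((\<lambda>\<rho>. \<rho> powr (\<alpha> - 1)) has_integral (\<epsilon> powr \<alpha> / \<alpha>)) {0..\<epsilon>}"
    using has_integral_powr_from_0[of "\<alpha> - 1" \<epsilon>] assms by simp
  then have "(\<integral>\<^sup>+\<rho>. indicator {0..\<epsilon>} \<rho> * ennreal (\<rho> powr (\<alpha> - 1)) \<partial>lborel) = ennreal (\<epsilon> powr \<alpha> / \<alpha>)"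
    using nn_integral_has_integral_lebesgue[of "{0..\<epsilon>}" "\<lambda>\<rho>. \<rho> powr (\<alpha> - 1)"]
    by (simp add: indicator_mult_ennreal)
  moreover have "(\<integral>\<^sup>+\<rho>. ennreal (\<rho> powr (\<alpha> - 1)) * indicator {0<..\<epsilon>} \<rho> \<partial>lborel) =
      (\<integral>\<^sup>+\<rho>. indicator {0..\<epsilon>} \<rho> * ennreal (\<rho> powr (\<alpha> - 1)) \<partial>lborel)"
    by (intro nn_integral_cong) (auto split: split_indicator)
  ultimately show ?thesis by simp
qed

lemma nn_integral_powr_at_infinity:
  fixes p :: real
  assumes "0 < p"
  shows "(\<integral>\<^sup>+\<rho>. ennreal (\<rho> powr (- 1 - p)) * indicator {1..} \<rho> \<partial>lborel) = ennreal (1 / p)"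
proof -
  have "((\<lambda>\<rho>. \<rho> powr (- 1 - p)) has_integral (1 / p)) {1..}"
    using has_integral_powr_to_inf[of "- 1 - p" 1] assms by simp
  then have "(\<integral>\<^sup>+\<rho>. indicator {1..} \<rho> * ennreal (\<rho> powr (- 1 - p)) \<partial>lborel) = ennreal (1 / p)"
    using nn_integral_has_integral_lebesgue[of "{1..}" "\<lambda>\<rho>. \<rho> powr (- 1 - p)"]
    by (simp add: indicator_mult_ennreal)
  then show ?thesis by (simp add: mult.commute)
qed

lemma nn_integral_power_near_0:
  fixes \<epsilon> :: real
  assumes "0 < N" "0 < \<epsilon>"
  shows "(\<integral>\<^sup>+\<rho>. ennreal (\<rho> ^ (N - 1)) * indicator {0<..<\<epsilon>} \<rho> \<partial>lborel) = ennreal (\<epsilon> ^ N / real N)"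
proof -
  have "(\<integral>\<^sup>+\<rho>. ennreal (\<rho> ^ (N - 1)) * indicator {0<..<\<epsilon>} \<rho> \<partial>lborel) = (\<integral>\<^sup>+\<rho>. ennreal (\<rho> ^ (N - 1)) * indicator {0..\<epsilon>} \<rho> \<partial>lborel)"
    using AE_lborel_singleton[of "0::real"] AE_lborel_singleton[of \<epsilon>]
    by (intro nn_integral_cong_AE, eventually_elim) (auto split: split_indicator)
  also have "\<dots> = ennreal (\<epsilon> ^ N / real N - 0 ^ N / real N)"
    using assms by (intro nn_integral_FTC_Icc) (auto intro!: derivative_eq_intros)
  finally show ?thesis using assms by (simp add: zero_power)
qed

lemma filterlim_minus_ln_at_right_0: "filterlim (\<lambda>\<epsilon>::real. - ln \<epsilon>) at_top (at_right 0)"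
  using filterlim_compose[OF filterlim_uminus_at_top_at_bot ln_at_0] .

lemma tendsto_over_minus_ln: "((\<lambda>\<epsilon>::real. c / - ln \<epsilon>) \<longlongrightarrow> 0) (at_right 0)"
  by (rule real_tendsto_divide_at_top[OF tendsto_const filterlim_minus_ln_at_right_0])

lemma eventually_at_right_0_unit: "eventually (\<lambda>\<epsilon>::real. 0 < \<epsilon> \<and> \<epsilon> < 1) (at_right 0)"
  using eventually_at_right_real[of 0 "1::real"] by (auto elim: eventually_mono)

definition log_integral :: "(real \<Rightarrow> real) \<Rightarrow> real \<Rightarrow> real \<Rightarrow> ennreal"
  where "log_integral f a b = (\<integral>\<^sup>+\<rho>. ennreal (f \<rho> / \<rho>) * indicator {a<..<b} \<rho> \<partial>lborel)"

lemma log_integral_le_const: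
  assumes "0 < a" "a \<le> b" "0 \<le> c" "\<And>\<rho>. a < \<rho> \<Longrightarrow> \<rho> < b \<Longrightarrow> f \<rho> \<le> c"
  shows "log_integral f a b \<le> ennreal (c * (ln b - ln a))"
proof -
  have "log_integral f a b \<le> (\<integral>\<^sup>+\<rho>. ennreal (c / \<rho>) * indicator {a<..<b} \<rho> \<partial>lborel)"
    unfolding log_integral_def using assms
    by (intro nn_integral_mono) (auto split: split_indicator intro!: ennreal_leI divide_right_mono)
  then show ?thesis using nn_integral_inverse_interval[OF assms(1-3)] by simp
qed

lemma log_integral_ge_const:
  assumes "0 < a" "a \<le> b" "0 \<le> c" "\<And>\<rho>. a < \<rho> \<Longrightarrow> \<rho> < b \<Longrightarrow> c \<le> f \<rho>"
  shows "ennreal (c * (ln b - ln a)) \<le> log_integral f a b"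
proof -
  have "(\<integral>\<^sup>+\<rho>. ennreal (c / \<rho>) * indicator {a<..<b} \<rho> \<partial>lborel) \<le> log_integral f a b"
    unfolding log_integral_def using assms
    by (intro nn_integral_mono) (auto split: split_indicator intro!: ennreal_leI divide_right_mono)
  then show ?thesis using nn_integral_inverse_interval[OF assms(1-3)] by simp
qed

lemma log_integral_split:
  assumes [measurable]: "f \<in> borel_measurable borel" and "a \<le> b" "b \<le> c"
  shows "log_integral f a c = log_integral f a b + log_integral f b c"
proof -
  have "log_integral f a c = (\<integral>\<^sup>+\<rho>. ennreal (f \<rho> / \<rho>) * indicator {a<..<b} \<rho> + ennreal (f \<rho> / \<rho>) * indicator {b<..<c} \<rho> \<partial>lborel)"
    unfolding log_integral_def
    by (intro nn_integral_cong_AE, use AE_lborel_singleton[of b] in eventually_elim)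
       (use assms(2,3) in \<open>auto split: split_indicator\<close>)
  also have "\<dots> = log_integral f a b + log_integral f b c"
    unfolding log_integral_def by (intro nn_integral_add) auto
  finally show ?thesis .
qed

text \<open>A fixed initial part of the interval near \<open>1\<close> contributes a bounded amount, and on the rest \<open>f\<close> is close to \<open>L\<close>.\<close>

lemma log_average_at_0:
  fixes f :: "real \<Rightarrow> real"
  assumes [measurable]: "f \<in> borel_measurable borel"
    and B: "\<And>\<rho>. 0 < \<rho> \<Longrightarrow> f \<rho> \<le> B" and f0: "\<And>\<rho>. 0 \<le> f \<rho>"
    and lim: "(f \<longlongrightarrow> L) (at_right 0)"
  shows "((\<lambda>\<epsilon>. enn2real (log_integral f \<epsilon> 1) / - ln \<epsilon>) \<longlongrightarrow> L) (at_right 0)"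
proof -
  have B0: "0 \<le> B" using B[of 1] f0[of 1] by simp
  have L0: "0 \<le> L" using lim f0 by (intro tendsto_lowerbound[OF lim]) auto
  have fin: "log_integral f \<epsilon> 1 \<le> ennreal (B * (ln 1 - ln \<epsilon>))" if "0 < \<epsilon>" "\<epsilon> < 1" for \<epsilon>
    using that B B0 by (intro log_integral_le_const) auto
  have near: "\<exists>a. 0 < a \<and> a < 1 \<and> (\<forall>\<rho>. 0 < \<rho> \<and> \<rho> < a \<longrightarrow> P (f \<rho>))" if ev: "eventually (\<lambda>\<rho>. P (f \<rho>)) (at_right 0)" for P
  proof -
    obtain b where b: "0 < b" "\<And>\<rho>. 0 < \<rho> \<Longrightarrow> \<rho> < b \<Longrightarrow> P (f \<rho>)"
      using ev by (auto simp: eventually_at_right_field)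
    then show ?thesis by (intro exI[of _ "min b (1 / 2)"]) auto
  qed
  show ?thesis
  proof (rule order_tendstoI)
    fix y assume y: "L < y"
    define e where "e = (y - L) / 2"
    have e: "0 < e" "L + e + e = y" using y by (auto simp: e_def field_simps)
    have "eventually (\<lambda>\<rho>. f \<rho> \<le> L + e) (at_right 0)"
      using order_tendstoD(2)[OF lim, of "L + e"] e by (auto elim: eventually_mono)
    then obtain a where a: "0 < a" "a < 1" "\<And>\<rho>. 0 < \<rho> \<Longrightarrow> \<rho> < a \<Longrightarrow> f \<rho> \<le> L + e" using near by meson
    have "eventually (\<lambda>\<epsilon>. 0 < \<epsilon> \<and> \<epsilon> < a) (at_right 0)"
      using eventually_at_right_real[OF a(1)] by (auto elim: eventually_mono)
    moreover have "eventually (\<lambda>\<epsilon>. (B * - ln a) / - ln \<epsilon> < e) (at_right 0)"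
      using order_tendstoD(2)[OF tendsto_over_minus_ln e(1)] .
    ultimately show "eventually (\<lambda>\<epsilon>. enn2real (log_integral f \<epsilon> 1) / - ln \<epsilon> < y) (at_right 0)"
    proof eventually_elim
      case (elim \<epsilon>)
      have l: "0 < - ln \<epsilon>" using elim a by simp
      have "log_integral f \<epsilon> 1 = log_integral f \<epsilon> a + log_integral f a 1"
        using elim a by (intro log_integral_split) auto
      also have "\<dots> \<le> ennreal ((L + e) * (ln a - ln \<epsilon>)) + ennreal (B * (ln 1 - ln a))"
        using elim a B B0 L0 e by (intro add_mono log_integral_le_const) auto
      also have "\<dots> \<le> ennreal ((L + e) * - ln \<epsilon>) + ennreal (B * - ln a)"
      proof (intro add_mono ennreal_leI)
        show "(L + e) * (ln a - ln \<epsilon>) \<le> (L + e) * - ln \<epsilon>"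
          using L0 e a by (intro mult_left_mono) auto
      qed simp
      also have "\<dots> = ennreal ((L + e) * - ln \<epsilon> + B * - ln a)"
        by (rule ennreal_plus[symmetric]; intro mult_nonneg_nonneg) (use L0 e B0 a l in auto)
      finally have "enn2real (log_integral f \<epsilon> 1) \<le> (L + e) * - ln \<epsilon> + B * - ln a"
        using L0 e B0 a l by (intro enn2real_leI add_nonneg_nonneg mult_nonneg_nonneg) auto
      then have "enn2real (log_integral f \<epsilon> 1) / - ln \<epsilon> \<le> ((L + e) * - ln \<epsilon> + B * - ln a) / - ln \<epsilon>"
        using l by (intro divide_right_mono) auto
      also have "\<dots> = L + e + (B * - ln a) / - ln \<epsilon>" using l by (simp add: field_simps)
      also have "\<dots> < y" using elim(2) e(2) by linarith
      finally show ?case .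
    qed
  next
    fix y assume y: "y < L"
    show "eventually (\<lambda>\<epsilon>. y < enn2real (log_integral f \<epsilon> 1) / - ln \<epsilon>) (at_right 0)"
    proof (cases "y < 0")
      case True
      show ?thesis using eventually_at_right_0_unit
      proof eventually_elim
        case (elim \<epsilon>)
        then have "0 \<le> enn2real (log_integral f \<epsilon> 1) / - ln \<epsilon>"
          by (intro divide_nonneg_nonneg) auto
        then show ?case using True by linarith
      qed
    next
      case False
      define e where "e = (L - y) / 2"
      have e: "0 < e" "L - e - e = y" "0 \<le> L - e" using y False by (auto simp: e_def field_simps)
      have "eventually (\<lambda>\<rho>. L - e \<le> f \<rho>) (at_right 0)"
        using order_tendstoD(1)[OF lim, of "L - e"] e by (auto elim: eventually_mono)
      then obtain a where a: "0 < a" "a < 1" "\<And>\<rho>. 0 < \<rho> \<Longrightarrow> \<rho> < a \<Longrightarrow> L - e \<le> f \<rho>" using near by meson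
      have "eventually (\<lambda>\<epsilon>. 0 < \<epsilon> \<and> \<epsilon> < a) (at_right 0)"
        using eventually_at_right_real[OF a(1)] by (auto elim: eventually_mono)
      moreover have "eventually (\<lambda>\<epsilon>. ((L - e) * - ln a) / - ln \<epsilon> < e) (at_right 0)"
        using order_tendstoD(2)[OF tendsto_over_minus_ln e(1)] .
      ultimately show "eventually (\<lambda>\<epsilon>. y < enn2real (log_integral f \<epsilon> 1) / - ln \<epsilon>) (at_right 0)"
      proof eventually_elim
        case (elim \<epsilon>)
        have l: "0 < - ln \<epsilon>" using elim a by simp
        have "ennreal ((L - e) * (ln a - ln \<epsilon>)) \<le> log_integral f \<epsilon> a"
          using elim a e by (intro log_integral_ge_const) auto
        also have "\<dots> \<le> log_integral f \<epsilon> 1"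
          using log_integral_split[of f \<epsilon> a 1] elim a by simp
        finally have "(L - e) * (ln a - ln \<epsilon>) \<le> enn2real (log_integral f \<epsilon> 1)"
          by (rule le_enn2realI) (use fin[of \<epsilon>] elim a in \<open>auto intro: le_less_trans\<close>)
        then have "((L - e) * (ln a - ln \<epsilon>)) / - ln \<epsilon> \<le> enn2real (log_integral f \<epsilon> 1) / - ln \<epsilon>"
          using l by (intro divide_right_mono) auto
        moreover have "((L - e) * (ln a - ln \<epsilon>)) / - ln \<epsilon> = (L - e) - ((L - e) * - ln a) / - ln \<epsilon>"
          using l by (simp add: field_simps)
        ultimately show ?case using elim(2) e(2) by linarith
      qed
    qed
  qed
qed

text \<open>The part \<open>\<rho> \<le> K \<epsilon>\<close> contributes at most \<open>B ln K\<close>, uniformly in \<open>\<epsilon>\<close>, and on the rest \<open>g\<close> is small.\<close>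

lemma log_average_tail:
  fixes g :: "real \<Rightarrow> real"
  assumes [measurable]: "g \<in> borel_measurable borel"
    and B: "\<And>s. 0 < s \<Longrightarrow> g s \<le> B" and g0: "\<And>s. 0 \<le> g s"
    and lim: "(g \<longlongrightarrow> 0) at_top"
  shows "((\<lambda>\<epsilon>. enn2real (log_integral (\<lambda>\<rho>. g (\<rho> / \<epsilon>)) \<epsilon> 1) / - ln \<epsilon>) \<longlongrightarrow> 0) (at_right 0)"
proof (rule order_tendstoI)
  have B0: "0 \<le> B" using B[of 1] g0[of 1] by simp
  fix y :: real assume y: "0 < y"
  define e where "e = y / 2"
  have e: "0 < e" "e + e = y" using y by (auto simp: e_def)
  have "eventually (\<lambda>s. g s \<le> e) at_top"
    using order_tendstoD(2)[OF lim e(1)] by (auto elim: eventually_mono)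
  then obtain K0 where "\<And>s. K0 \<le> s \<Longrightarrow> g s \<le> e" by (auto simp: eventually_at_top_linorder)
  then obtain K where K: "1 < K" "\<And>s. K \<le> s \<Longrightarrow> g s \<le> e"
    by (metis less_add_one max.bounded_iff max.cobounded1 max_less_iff_conj order_less_le_trans zero_less_one_class.zero_less_one gt_ex)
  have "eventually (\<lambda>\<epsilon>. 0 < \<epsilon> \<and> \<epsilon> < 1 / K) (at_right 0)"
    using eventually_at_right_real[of 0 "1 / K"] K by (auto elim: eventually_mono)
  moreover have "eventually (\<lambda>\<epsilon>. (B * ln K) / - ln \<epsilon> < e) (at_right 0)"
    using order_tendstoD(2)[OF tendsto_over_minus_ln e(1)] .
  ultimately show "eventually (\<lambda>\<epsilon>. enn2real (log_integral (\<lambda>\<rho>. g (\<rho> / \<epsilon>)) \<epsilon> 1) / - ln \<epsilon> < y) (at_right 0)"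
  proof eventually_elim
    case (elim \<epsilon>)
    let ?f = "\<lambda>\<rho>. g (\<rho> / \<epsilon>)"
    have K\<epsilon>: "K * \<epsilon> < 1" "\<epsilon> \<le> K * \<epsilon>" using elim K by (auto simp: field_simps)
    have "1 / K \<le> 1" using K by simp
    then have l: "0 < - ln \<epsilon>" using elim by (simp add: ln_less_zero_iff)
    have lnK: "ln (K * \<epsilon>) = ln K + ln \<epsilon>" "0 < ln K" using elim K by (auto simp: ln_mult)
    have "log_integral ?f \<epsilon> 1 = log_integral ?f \<epsilon> (K * \<epsilon>) + log_integral ?f (K * \<epsilon>) 1"
      using K\<epsilon> by (intro log_integral_split) auto
    also have "\<dots> \<le> ennreal (B * (ln (K * \<epsilon>) - ln \<epsilon>)) + ennreal (e * (ln 1 - ln (K * \<epsilon>)))"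
      using elim K K\<epsilon> B B0 e by (intro add_mono log_integral_le_const K(2)) (auto simp: field_simps)
    also have "\<dots> \<le> ennreal (B * ln K) + ennreal (e * - ln \<epsilon>)"
    proof (intro add_mono ennreal_leI)
      show "B * (ln (K * \<epsilon>) - ln \<epsilon>) \<le> B * ln K" by (simp add: lnK(1))
      show "e * (ln 1 - ln (K * \<epsilon>)) \<le> e * - ln \<epsilon>"
        using e lnK by (intro mult_left_mono) auto
    qed
    also have "\<dots> = ennreal (B * ln K + e * - ln \<epsilon>)"
      by (rule ennreal_plus[symmetric]; intro mult_nonneg_nonneg) (use lnK l B0 e in auto)
    finally have "enn2real (log_integral ?f \<epsilon> 1) \<le> B * ln K + e * - ln \<epsilon>"
      using l lnK e B0 by (intro enn2real_leI add_nonneg_nonneg mult_nonneg_nonneg) auto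
    then have "enn2real (log_integral ?f \<epsilon> 1) / - ln \<epsilon> \<le> (B * ln K + e * - ln \<epsilon>) / - ln \<epsilon>"
      using l by (intro divide_right_mono) auto
    also have "\<dots> = (B * ln K) / - ln \<epsilon> + e" using l by (simp add: field_simps)
    also have "\<dots> < y" using elim(2) e(2) by linarith
    finally show ?case .
  qed
next
  fix y :: real assume "y < 0"
  show "eventually (\<lambda>\<epsilon>. y < enn2real (log_integral (\<lambda>\<rho>. g (\<rho> / \<epsilon>)) \<epsilon> 1) / - ln \<epsilon>) (at_right 0)"
    using eventually_at_right_0_unit
  proof eventually_elim
    case (elim \<epsilon>)
    then have "0 \<le> enn2real (log_integral (\<lambda>\<rho>. g (\<rho> / \<epsilon>)) \<epsilon> 1) / - ln \<epsilon>"
      by (intro divide_nonneg_nonneg) auto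
    then show ?case using \<open>y < 0\<close> by linarith
  qed
qed

text \<open>First \<open>\<epsilon> \<rightarrow> 0\<close> with \<open>\<delta>\<close> fixed, which removes the error terms, then \<open>\<delta> \<rightarrow> 0\<close>.\<close>

lemma tendsto_of_split_bounds:
  fixes x t v :: "real \<Rightarrow> real"
  assumes t: "(t \<longlongrightarrow> \<Lambda>) F" and v: "(v \<longlongrightarrow> 0) F" and a: "(a \<longlongrightarrow> 0) F" and m: "0 \<le> m"
    and upper: "\<And>\<delta>. 0 < \<delta> \<Longrightarrow> \<delta> < 1 \<Longrightarrow> eventually (\<lambda>\<epsilon>. x \<epsilon> \<le> a \<epsilon> + (1 - \<delta>) powr (1 - q) * (m * t \<epsilon>) + \<delta> powr (1 - q) * v \<epsilon>) F"
    and lower: "\<And>\<delta>. 0 < \<delta> \<Longrightarrow> \<delta> < 1 \<Longrightarrow> eventually (\<lambda>\<epsilon>. m * t \<epsilon> \<le> (1 - \<delta>) powr (1 - q) * x \<epsilon> + \<delta> powr (1 - q) * v \<epsilon>) F"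
  shows "(x \<longlongrightarrow> m * \<Lambda>) F"
proof (rule order_tendstoI)
  fix y assume "m * \<Lambda> < y"
  then obtain \<delta> where \<delta>: "0 < \<delta>" "\<delta> < 1" "(1 - \<delta>) powr (1 - q) * (m * \<Lambda>) < y"
    using powr_factor_near_one by blast
  have "((\<lambda>\<epsilon>. a \<epsilon> + (1 - \<delta>) powr (1 - q) * (m * t \<epsilon>) + \<delta> powr (1 - q) * v \<epsilon>) \<longlongrightarrow>
      0 + (1 - \<delta>) powr (1 - q) * (m * \<Lambda>) + \<delta> powr (1 - q) * 0) F"
    by (intro tendsto_intros a t v)
  then have "eventually (\<lambda>\<epsilon>. a \<epsilon> + (1 - \<delta>) powr (1 - q) * (m * t \<epsilon>) + \<delta> powr (1 - q) * v \<epsilon> < y) F"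
    using \<delta>(3) by (intro order_tendstoD(2)) auto
  with upper[OF \<delta>(1,2)] show "eventually (\<lambda>\<epsilon>. x \<epsilon> < y) F"
    by eventually_elim simp
next
  fix y assume y: "y < m * \<Lambda>"
  then obtain \<delta> where \<delta>: "0 < \<delta>" "\<delta> < 1" "(1 - \<delta>) powr (1 - q) * y < m * \<Lambda>"
    using powr_factor_near_one by blast
  have "((\<lambda>\<epsilon>. m * t \<epsilon> - \<delta> powr (1 - q) * v \<epsilon>) \<longlongrightarrow> m * \<Lambda> - \<delta> powr (1 - q) * 0) F"
    by (intro tendsto_intros t v)
  then have "eventually (\<lambda>\<epsilon>. (1 - \<delta>) powr (1 - q) * y < m * t \<epsilon> - \<delta> powr (1 - q) * v \<epsilon>) F"
    using \<delta>(3) by (intro order_tendstoD(1)) auto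
  with lower[OF \<delta>(1,2)] show "eventually (\<lambda>\<epsilon>. y < x \<epsilon>) F"
  proof eventually_elim
    case (elim \<epsilon>)
    then have "(1 - \<delta>) powr (1 - q) * y < (1 - \<delta>) powr (1 - q) * x \<epsilon>" by linarith
    then show ?case using \<delta> by (simp add: mult_less_cancel_left_pos)
  qed
qed

section \<open>Pair energies and the limit on balls\<close>

definition pair_energy :: "real \<Rightarrow> 'a::euclidean_space set \<Rightarrow> ('a \<Rightarrow> 'b::euclidean_space) \<Rightarrow> 'a \<Rightarrow> ennreal"
  where "pair_energy q E v h =
    (\<integral>\<^sup>+x. ennreal (indicat_real E x * indicat_real E (x + h) * norm (v (x + h) - v x) powr q) \<partial>lborel)"

lemma pair_energy_borel[measurable]:
  fixes v :: "'a::euclidean_space \<Rightarrow> 'b::euclidean_space"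
  assumes [measurable]: "E \<in> sets borel" "v \<in> borel_measurable borel"
  shows "pair_energy q E v \<in> borel_measurable borel"
  unfolding pair_energy_def[abs_def] by measurable

lemma pair_energy_le_Lq_powr: "pair_energy q E v h \<le> Lq_powr q (fdiff h v)"
  unfolding pair_energy_def Lq_powr_def fdiff_def
  by (intro nn_integral_mono ennreal_leI) (auto split: split_indicator)

lemma pair_energy_scaleR:
  fixes v :: "'a::euclidean_space \<Rightarrow> 'b::euclidean_space"
  assumes [measurable]: "E \<in> sets borel" "v \<in> borel_measurable borel"
  shows "pair_energy q E (\<lambda>x. m *\<^sub>R v x) h = ennreal (\<bar>m\<bar> powr q) * pair_energy q E v h"
proof -
  have "pair_energy q E (\<lambda>x. m *\<^sub>R v x) h = (\<integral>\<^sup>+x. ennreal (\<bar>m\<bar> powr q) *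
      ennreal (indicat_real E x * indicat_real E (x + h) * norm (v (x + h) - v x) powr q) \<partial>lborel)"
    unfolding pair_energy_def
  proof (rule nn_integral_cong)
    fix x
    have "norm (m *\<^sub>R v (x + h) - m *\<^sub>R v x) powr q = \<bar>m\<bar> powr q * norm (v (x + h) - v x) powr q"
      unfolding scaleR_diff_right[symmetric] by (simp add: powr_mult)
    then show "ennreal (indicat_real E x * indicat_real E (x + h) * norm (m *\<^sub>R v (x + h) - m *\<^sub>R v x) powr q) =
        ennreal (\<bar>m\<bar> powr q) * ennreal (indicat_real E x * indicat_real E (x + h) * norm (v (x + h) - v x) powr q)"
      by (simp add: ennreal_mult[symmetric] ac_simps)
  qed
  also have "\<dots> = ennreal (\<bar>m\<bar> powr q) * pair_energy q E v h"
    unfolding pair_energy_def by (rule nn_integral_cmult) measurable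
  finally show ?thesis .
qed

text \<open>The increments of \<open>v\<close> and \<open>w\<close> are compared on \<open>E\<close>, but the error is measured on the whole space, where translations act.\<close>

lemma pair_energy_split:
  fixes v w :: "'a::euclidean_space \<Rightarrow> 'b::euclidean_space"
  assumes q: "1 \<le> q" and \<delta>: "0 < \<delta>" "\<delta> < 1"
    and [measurable]: "E \<in> sets borel" "v \<in> borel_measurable borel" "w \<in> borel_measurable borel"
  shows "pair_energy q E v h \<le> ennreal ((1 - \<delta>) powr (1 - q)) * pair_energy q E w h +
    ennreal (\<delta> powr (1 - q)) * Lq_powr q (\<lambda>x. fdiff h v x - fdiff h w x)"
proof -
  let ?c = "(1 - \<delta>) powr (1 - q)" and ?d = "\<delta> powr (1 - q)"
  let ?I = "\<lambda>x. indicat_real E x * indicat_real E (x + h)"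
  have "pair_energy q E v h \<le> (\<integral>\<^sup>+x. ennreal ?c * ennreal (?I x * norm (w (x + h) - w x) powr q) +
      ennreal ?d * ennreal (norm (fdiff h v x - fdiff h w x) powr q) \<partial>lborel)"
    unfolding pair_energy_def
  proof (rule nn_integral_mono)
    fix x
    have I: "0 \<le> ?I x" "?I x \<le> 1" by (auto split: split_indicator)
    have "norm (v (x + h) - v x) powr q = norm (fdiff h w x + (fdiff h v x - fdiff h w x)) powr q"
      by (simp add: fdiff_def)
    also have "\<dots> \<le> ?c * norm (fdiff h w x) powr q + ?d * norm (fdiff h v x - fdiff h w x) powr q"
      by (rule norm_add_powr_le_split[OF q \<delta>])
    finally have "?I x * norm (v (x + h) - v x) powr q \<le>
        ?I x * (?c * norm (fdiff h w x) powr q) + ?I x * (?d * norm (fdiff h v x - fdiff h w x) powr q)"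
      using I(1) by (metis distrib_left mult_left_mono)
    also have "\<dots> \<le> ?I x * (?c * norm (fdiff h w x) powr q) + ?d * norm (fdiff h v x - fdiff h w x) powr q"
      using I by (intro add_left_mono mult_left_le_one_le) auto
    finally have "ennreal (?I x * norm (v (x + h) - v x) powr q) \<le>
        ennreal (?c * (?I x * norm (w (x + h) - w x) powr q) + ?d * norm (fdiff h v x - fdiff h w x) powr q)"
      by (intro ennreal_leI) (simp add: fdiff_def ac_simps)
    then show "ennreal (?I x * norm (v (x + h) - v x) powr q) \<le> ennreal ?c * ennreal (?I x * norm (w (x + h) - w x) powr q) +
        ennreal ?d * ennreal (norm (fdiff h v x - fdiff h w x) powr q)"
      using I(1) by (simp add: ennreal_mult[symmetric] ennreal_plus[symmetric] del: ennreal_plus)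
  qed
  also have "\<dots> = ennreal ?c * pair_energy q E w h + ennreal ?d * Lq_powr q (\<lambda>x. fdiff h v x - fdiff h w x)"
    unfolding pair_energy_def Lq_powr_def by (simp add: nn_integral_add nn_integral_cmult)
  finally show ?thesis .
qed

lemma Lq_powr_minus_commute: "Lq_powr q (\<lambda>x. f x - g x) = Lq_powr q (\<lambda>x. g x - f x)"
  unfolding Lq_powr_def by (simp add: norm_minus_commute)

lemma AE_hausdorff_sphere_norm: "AE n in (hausdorff_sphere :: 'a::euclidean_space measure). norm n = 1"
proof -
  have "- sphere (0::'a) 1 \<in> sets borel" by measurable
  then have "emeasure hausdorff_sphere (- sphere (0::'a) 1) = 0"
    by (simp add: emeasure_hausdorff_sphere hausdorff_outer_empty del: sphere_def)
  then show ?thesis by (intro AE_I[of _ _ "- sphere (0::'a) 1"]) auto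
qed

definition sphere_energy :: "real \<Rightarrow> real \<Rightarrow> 'a::euclidean_space set \<Rightarrow> ('a \<Rightarrow> 'b::euclidean_space) \<Rightarrow> real \<Rightarrow> ennreal"
  where "sphere_energy r q E u \<rho> = ennreal (1 / \<rho> powr (r * q)) * (\<integral>\<^sup>+n. pair_energy q E u (\<rho> *\<^sub>R n) \<partial>hausdorff_sphere)"

definition ball_energy :: "real \<Rightarrow> real \<Rightarrow> 'a::euclidean_space set \<Rightarrow> ('a \<Rightarrow> 'b::euclidean_space) \<Rightarrow> real \<Rightarrow> ennreal"
  where "ball_energy r q E u \<epsilon> = (\<integral>\<^sup>+h. pair_energy q E u h *
    (ennreal (1 / \<epsilon> ^ (DIM('a)) * (1 / norm h powr (r * q))) * indicator (ball 0 \<epsilon>) h) \<partial>lborel)"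

definition gagliardo_energy :: "real \<Rightarrow> real \<Rightarrow> 'a::euclidean_space set \<Rightarrow> 'a set \<Rightarrow> ('a \<Rightarrow> 'b::euclidean_space) \<Rightarrow> ennreal"
  where "gagliardo_energy r q E S v = (\<integral>\<^sup>+h. pair_energy q E v h *
    (ennreal (1 / norm h powr (real (DIM('a)) + r * q)) * indicator S h) \<partial>lborel)"

lemma space_hausdorff_sphere: "space (hausdorff_sphere :: 'a::euclidean_space measure) = UNIV"
  using sets_eq_imp_space_eq[OF sets_hausdorff_sphere[where 'a='a]] by simp

lemma (in mollified_besov) sphere_energy_bounded:
  assumes \<rho>: "0 < \<rho>"
  shows "sphere_energy r q E u \<rho> \<le> ennreal C * emeasure (hausdorff_sphere :: 'a measure) UNIV"
proof -
  have "(\<integral>\<^sup>+n. pair_energy q E u (\<rho> *\<^sub>R n) \<partial>hausdorff_sphere) \<le> (\<integral>\<^sup>+n. ennreal (C * \<rho> powr (r * q)) \<partial>(hausdorff_sphere :: 'a measure))"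
  proof (rule nn_integral_mono_AE, use AE_hausdorff_sphere_norm[where 'a='a] in eventually_elim)
    fix n :: 'a assume "norm n = 1"
    then show "pair_energy q E u (\<rho> *\<^sub>R n) \<le> ennreal (C * \<rho> powr (r * q))"
      using order_trans[OF pair_energy_le_Lq_powr besov, of E "\<rho> *\<^sub>R n"] \<rho> by simp
  qed
  also have "\<dots> = ennreal (C * \<rho> powr (r * q)) * emeasure (hausdorff_sphere :: 'a measure) UNIV"
    by (simp add: space_hausdorff_sphere)
  finally have "sphere_energy r q E u \<rho> \<le> ennreal (1 / \<rho> powr (r * q)) *
      (ennreal (C * \<rho> powr (r * q)) * emeasure (hausdorff_sphere :: 'a measure) UNIV)"
    unfolding sphere_energy_def by (rule mult_left_mono) simp
  also have "\<dots> = ennreal C * emeasure (hausdorff_sphere :: 'a measure) UNIV"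
    using \<rho> C by (simp add: mult.assoc[symmetric] ennreal_mult[symmetric])
  finally show ?thesis .
qed

text \<open>The constant \<open>\<kappa>\<close> is that of \<open>nn_integral_polar\<close>.\<close>

locale besov_energy = mollified_besov q r C M u \<eta>
  for q r C M :: real and u :: "'a::euclidean_space \<Rightarrow> 'b::euclidean_space" and \<eta> :: "'a \<Rightarrow> real" +
  fixes E :: "'a set" and \<kappa> L :: real
  assumes E[measurable]: "E \<in> sets borel"
    and \<kappa>: "0 < \<kappa>" and polar: "\<And>f :: 'a \<Rightarrow> ennreal. f \<in> borel_measurable borel \<Longrightarrow> (\<integral>\<^sup>+x. f x \<partial>lborel) =
      (\<integral>\<^sup>+\<rho>. (\<integral>\<^sup>+n. f (\<rho> *\<^sub>R n) \<partial>hausdorff_sphere) * (ennreal (\<kappa> * \<rho> ^ (DIM('a) - 1)) * indicator {0<..} \<rho>) \<partial>lborel)"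
    and L: "0 \<le> L" and sphere_lim: "(sphere_energy r q E u \<longlongrightarrow> ennreal L) (at_right 0)"
begin

abbreviation p :: real where "p \<equiv> r * q"
abbreviation k :: "'a \<Rightarrow> ennreal" where "k h \<equiv> ennreal (1 / norm h powr (real (DIM('a)) + p))"
abbreviation m :: real where "m \<equiv> \<bar>LINT z|lborel. \<eta> z\<bar> powr q"
abbreviation v :: "real \<Rightarrow> 'a \<Rightarrow> 'b" where "v \<epsilon> \<equiv> mollify \<eta> \<epsilon> u"

lemma p_pos: "0 < p" using q r by simp

definition H :: real where "H = measure (hausdorff_sphere :: 'a measure) UNIV"

lemma H: "emeasure (hausdorff_sphere :: 'a measure) UNIV = ennreal H" "0 \<le> H"
proof -
  interpret finite_measure "hausdorff_sphere :: 'a measure" by (rule finite_hausdorff_sphere)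
  show "emeasure (hausdorff_sphere :: 'a measure) UNIV = ennreal H" "0 \<le> H"
    by (auto simp: H_def emeasure_eq_measure)
qed

lemma kernel_power: "0 < \<rho> \<Longrightarrow> \<rho> ^ (DIM('a) - 1) * (1 / \<rho> powr (real (DIM('a)) + p)) = \<rho> powr (- 1 - p)"
proof -
  assume \<rho>: "0 < \<rho>"
  have "\<rho> ^ (DIM('a) - 1) = \<rho> powr (real (DIM('a)) - 1)"
    using \<rho> by (simp add: powr_realpow[symmetric] of_nat_diff Suc_leI)
  then have "\<rho> ^ (DIM('a) - 1) * (1 / \<rho> powr (real (DIM('a)) + p)) = \<rho> powr (real (DIM('a)) - 1) * \<rho> powr - (real (DIM('a)) + p)"
    using powr_minus_divide[of \<rho> "real (DIM('a)) + p"] by simp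
  also have "\<dots> = \<rho> powr (- 1 - p)" unfolding powr_add[symmetric] by simp
  finally show ?thesis .
qed

lemma polar_radial:
  assumes [measurable]: "\<phi> \<in> borel_measurable borel"
  shows "(\<integral>\<^sup>+h. \<phi> (norm h) \<partial>(lborel :: 'a measure)) = (\<integral>\<^sup>+\<rho>. ennreal (\<kappa> * H * \<rho> ^ (DIM('a) - 1)) * \<phi> \<rho> * indicator {0<..} \<rho> \<partial>lborel)"
proof -
  have "(\<integral>\<^sup>+h. \<phi> (norm h) \<partial>(lborel :: 'a measure)) = (\<integral>\<^sup>+\<rho>. (\<integral>\<^sup>+n. \<phi> (norm (\<rho> *\<^sub>R n)) \<partial>(hausdorff_sphere :: 'a measure)) *
      (ennreal (\<kappa> * \<rho> ^ (DIM('a) - 1)) * indicator {0<..} \<rho>) \<partial>lborel)"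
    by (rule polar) measurable
  also have "\<dots> = (\<integral>\<^sup>+\<rho>. ennreal (\<kappa> * H * \<rho> ^ (DIM('a) - 1)) * \<phi> \<rho> * indicator {0<..} \<rho> \<partial>lborel)"
  proof (rule nn_integral_cong)
    fix \<rho> :: real
    show "(\<integral>\<^sup>+n. \<phi> (norm (\<rho> *\<^sub>R n)) \<partial>(hausdorff_sphere :: 'a measure)) * (ennreal (\<kappa> * \<rho> ^ (DIM('a) - 1)) * indicator {0<..} \<rho>) =
        ennreal (\<kappa> * H * \<rho> ^ (DIM('a) - 1)) * \<phi> \<rho> * indicator {0<..} \<rho>"
    proof (cases "0 < \<rho>")
      case True
      have "(\<integral>\<^sup>+n. \<phi> (norm (\<rho> *\<^sub>R n)) \<partial>(hausdorff_sphere :: 'a measure)) = (\<integral>\<^sup>+n. \<phi> \<rho> \<partial>(hausdorff_sphere :: 'a measure))"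
        using AE_hausdorff_sphere_norm[where 'a='a] True
        by (intro nn_integral_cong_AE) (auto elim!: eventually_mono)
      also have "\<dots> = \<phi> \<rho> * ennreal H" by (simp add: H space_hausdorff_sphere)
      finally show ?thesis using True \<kappa> H(2) by (simp add: ennreal_mult ac_simps)
    qed simp
  qed
  finally show ?thesis .
qed

lemma polar_energy:
  assumes [measurable]: "\<phi> \<in> borel_measurable borel"
  shows "(\<integral>\<^sup>+h. pair_energy q E u h * \<phi> (norm h) \<partial>(lborel :: 'a measure)) =
    (\<integral>\<^sup>+\<rho>. (\<integral>\<^sup>+n. pair_energy q E u (\<rho> *\<^sub>R n) \<partial>hausdorff_sphere) * \<phi> \<rho> * (ennreal (\<kappa> * \<rho> ^ (DIM('a) - 1)) * indicator {0<..} \<rho>) \<partial>lborel)"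
proof -
  have "(\<integral>\<^sup>+h. pair_energy q E u h * \<phi> (norm h) \<partial>(lborel :: 'a measure)) =
    (\<integral>\<^sup>+\<rho>. (\<integral>\<^sup>+n. pair_energy q E u (\<rho> *\<^sub>R n) * \<phi> (norm (\<rho> *\<^sub>R n)) \<partial>hausdorff_sphere) * (ennreal (\<kappa> * \<rho> ^ (DIM('a) - 1)) * indicator {0<..} \<rho>) \<partial>lborel)"
    by (rule polar) measurable
  also have "\<dots> = (\<integral>\<^sup>+\<rho>. (\<integral>\<^sup>+n. pair_energy q E u (\<rho> *\<^sub>R n) \<partial>hausdorff_sphere) * \<phi> \<rho> * (ennreal (\<kappa> * \<rho> ^ (DIM('a) - 1)) * indicator {0<..} \<rho>) \<partial>lborel)"
  proof (rule nn_integral_cong)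
    fix \<rho> :: real
    have "(\<integral>\<^sup>+n. pair_energy q E u (\<rho> *\<^sub>R n) * \<phi> (norm (\<rho> *\<^sub>R n)) \<partial>hausdorff_sphere) =
        (\<integral>\<^sup>+n. pair_energy q E u (\<rho> *\<^sub>R n) * \<phi> \<rho> \<partial>hausdorff_sphere)" if "0 < \<rho>"
      using AE_hausdorff_sphere_norm[where 'a='a] that
      by (intro nn_integral_cong_AE) (auto elim!: eventually_mono)
    moreover have "(\<integral>\<^sup>+n. pair_energy q E u (\<rho> *\<^sub>R n) * \<phi> \<rho> \<partial>hausdorff_sphere) =
        (\<integral>\<^sup>+n. pair_energy q E u (\<rho> *\<^sub>R n) \<partial>hausdorff_sphere) * \<phi> \<rho>"
      by (rule nn_integral_multc) measurable
    ultimately show "(\<integral>\<^sup>+n. pair_energy q E u (\<rho> *\<^sub>R n) * \<phi> (norm (\<rho> *\<^sub>R n)) \<partial>hausdorff_sphere) * (ennreal (\<kappa> * \<rho> ^ (DIM('a) - 1)) * indicator {0<..} \<rho>) =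
      (\<integral>\<^sup>+n. pair_energy q E u (\<rho> *\<^sub>R n) \<partial>hausdorff_sphere) * \<phi> \<rho> * (ennreal (\<kappa> * \<rho> ^ (DIM('a) - 1)) * indicator {0<..} \<rho>)"
      by (cases "0 < \<rho>") auto
  qed
  finally show ?thesis .
qed

definition S :: "real \<Rightarrow> real" where "S \<rho> = enn2real (sphere_energy r q E u \<rho>)"

lemma sphere_energy_le: "0 < \<rho> \<Longrightarrow> sphere_energy r q E u \<rho> \<le> ennreal (C * H)"
  using sphere_energy_bounded[of \<rho> E] C H by (simp add: ennreal_mult)

lemma S_eq: "0 < \<rho> \<Longrightarrow> sphere_energy r q E u \<rho> = ennreal (S \<rho>)"
  using sphere_energy_le[of \<rho>] by (simp add: S_def less_top le_less_trans)

lemma S_nonneg: "0 \<le> S \<rho>" by (simp add: S_def)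

lemma S_le: "0 < \<rho> \<Longrightarrow> S \<rho> \<le> C * H"
  unfolding S_def using C H by (intro enn2real_leI sphere_energy_le) auto

lemma S_borel[measurable]: "S \<in> borel_measurable borel"
proof -
  interpret finite_measure "hausdorff_sphere :: 'a measure" by (rule finite_hausdorff_sphere)
  show ?thesis unfolding S_def[abs_def] sphere_energy_def by measurable
qed

lemma S_lim: "(S \<longlongrightarrow> L) (at_right 0)"
  unfolding S_def using L sphere_lim by (intro tendsto_enn2real) auto

lemma sphere_integral: "0 < \<rho> \<Longrightarrow> (\<integral>\<^sup>+n. pair_energy q E u (\<rho> *\<^sub>R n) \<partial>hausdorff_sphere) = ennreal (\<rho> powr p * S \<rho>)"
proof -
  assume \<rho>: "0 < \<rho>"
  have "(\<integral>\<^sup>+n. pair_energy q E u (\<rho> *\<^sub>R n) \<partial>hausdorff_sphere) =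
      ennreal (\<rho> powr p) * ennreal (1 / \<rho> powr p) * (\<integral>\<^sup>+n. pair_energy q E u (\<rho> *\<^sub>R n) \<partial>hausdorff_sphere)"
    using \<rho> by (simp add: ennreal_mult[symmetric])
  also have "\<dots> = ennreal (\<rho> powr p) * sphere_energy r q E u \<rho>"
    by (simp add: sphere_energy_def mult.assoc)
  finally show ?thesis using \<rho> S_nonneg by (simp add: S_eq ennreal_mult)
qed

lemma ball_energy_eq:
  assumes \<epsilon>: "0 < \<epsilon>"
  shows "ball_energy r q E u \<epsilon> = (\<integral>\<^sup>+\<rho>. ennreal (\<kappa> / \<epsilon> ^ (DIM('a)) * S \<rho>) * (ennreal (\<rho> ^ (DIM('a) - 1)) * indicator {0<..<\<epsilon>} \<rho>) \<partial>lborel)"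
proof -
  define \<phi> where "\<phi> \<rho> = ennreal (1 / \<epsilon> ^ (DIM('a)) * (1 / \<rho> powr p)) * indicator {..<\<epsilon>} \<rho>" for \<rho> :: real
  have [measurable]: "\<phi> \<in> borel_measurable borel" unfolding \<phi>_def by measurable
  have "ball_energy r q E u \<epsilon> = (\<integral>\<^sup>+h. pair_energy q E u h * \<phi> (norm h) \<partial>lborel)"
    unfolding ball_energy_def by (intro nn_integral_cong) (auto simp: \<phi>_def split: split_indicator)
  also have "\<dots> = (\<integral>\<^sup>+\<rho>. (\<integral>\<^sup>+n. pair_energy q E u (\<rho> *\<^sub>R n) \<partial>hausdorff_sphere) * \<phi> \<rho> * (ennreal (\<kappa> * \<rho> ^ (DIM('a) - 1)) * indicator {0<..} \<rho>) \<partial>lborel)"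
    by (rule polar_energy) measurable
  also have "\<dots> = (\<integral>\<^sup>+\<rho>. ennreal (\<kappa> / \<epsilon> ^ (DIM('a)) * S \<rho>) * (ennreal (\<rho> ^ (DIM('a) - 1)) * indicator {0<..<\<epsilon>} \<rho>) \<partial>lborel)"
  proof (rule nn_integral_cong)
    fix \<rho> :: real
    show "(\<integral>\<^sup>+n. pair_energy q E u (\<rho> *\<^sub>R n) \<partial>hausdorff_sphere) * \<phi> \<rho> * (ennreal (\<kappa> * \<rho> ^ (DIM('a) - 1)) * indicator {0<..} \<rho>) =
        ennreal (\<kappa> / \<epsilon> ^ (DIM('a)) * S \<rho>) * (ennreal (\<rho> ^ (DIM('a) - 1)) * indicator {0<..<\<epsilon>} \<rho>)"
    proof (cases "0 < \<rho> \<and> \<rho> < \<epsilon>")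
      case True
      then have "ennreal (\<rho> powr p * S \<rho>) * ennreal (1 / \<epsilon> ^ (DIM('a)) * (1 / \<rho> powr p)) * ennreal (\<kappa> * \<rho> ^ (DIM('a) - 1)) =
          ennreal ((\<rho> powr p * S \<rho>) * (1 / \<epsilon> ^ (DIM('a)) * (1 / \<rho> powr p)) * (\<kappa> * \<rho> ^ (DIM('a) - 1)))"
      proof -
        have "0 \<le> \<rho> powr p * S \<rho>" "0 \<le> 1 / \<epsilon> ^ DIM('a) * (1 / \<rho> powr p)" "0 \<le> \<kappa> * \<rho> ^ (DIM('a) - 1)"
          using True S_nonneg[of \<rho>] \<kappa> \<epsilon> by auto
        then show ?thesis by (simp only: ennreal_mult[symmetric] mult_nonneg_nonneg)
      qed
      also have "(\<rho> powr p * S \<rho>) * (1 / \<epsilon> ^ (DIM('a)) * (1 / \<rho> powr p)) * (\<kappa> * \<rho> ^ (DIM('a) - 1)) = (\<kappa> / \<epsilon> ^ (DIM('a)) * S \<rho>) * \<rho> ^ (DIM('a) - 1)"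
        using True by simp
      also have "ennreal \<dots> = ennreal (\<kappa> / \<epsilon> ^ (DIM('a)) * S \<rho>) * ennreal (\<rho> ^ (DIM('a) - 1))"
        using True S_nonneg[of \<rho>] \<kappa> \<epsilon> by (intro ennreal_mult) auto
      finally show ?thesis using True by (simp add: sphere_integral \<phi>_def)
    qed (auto simp: \<phi>_def split: split_indicator)
  qed
  finally show ?thesis .
qed

lemma ball_energy_const:
  assumes "0 < \<epsilon>" "0 \<le> c"
  shows "(\<integral>\<^sup>+\<rho>. ennreal (\<kappa> / \<epsilon> ^ (DIM('a)) * c) * (ennreal (\<rho> ^ (DIM('a) - 1)) * indicator {0<..<\<epsilon>} \<rho>) \<partial>lborel) = ennreal (\<kappa> * c / real (DIM('a)))"
proof -
  have "(\<integral>\<^sup>+\<rho>. ennreal (\<kappa> / \<epsilon> ^ (DIM('a)) * c) * (ennreal (\<rho> ^ (DIM('a) - 1)) * indicator {0<..<\<epsilon>} \<rho>) \<partial>lborel) =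
      ennreal (\<kappa> / \<epsilon> ^ (DIM('a)) * c) * ennreal (\<epsilon> ^ (DIM('a)) / real (DIM('a)))"
    using nn_integral_power_near_0[of "DIM('a)" \<epsilon>] assms by (subst nn_integral_cmult) auto
  also have "\<dots> = ennreal (\<kappa> * c / real (DIM('a)))"
    using assms \<kappa> by (simp add: ennreal_mult[symmetric])
  finally show ?thesis .
qed

lemma ball_energy_lim: "(ball_energy r q E u \<longlongrightarrow> ennreal (\<kappa> * L / real (DIM('a)))) (at_right 0)"
proof -
  have N: "0 < real (DIM('a))" by simp
  have near: "\<exists>a>0. \<forall>\<rho>. 0 < \<rho> \<and> \<rho> < a \<longrightarrow> P (S \<rho>)" if ev: "eventually (\<lambda>\<rho>. P (S \<rho>)) (at_right 0)" for P
    using ev by (auto simp: eventually_at_right_field)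
  have le: "ball_energy r q E u \<epsilon> \<le> ennreal (\<kappa> * c / real (DIM('a)))" if "0 < \<epsilon>" "0 \<le> c" "\<And>\<rho>. 0 < \<rho> \<Longrightarrow> \<rho> < \<epsilon> \<Longrightarrow> S \<rho> \<le> c" for \<epsilon> c
    unfolding ball_energy_eq[OF that(1)] ball_energy_const[OF that(1,2), symmetric]
    using that \<kappa> by (intro nn_integral_mono) (auto split: split_indicator intro!: mult_right_mono ennreal_leI mult_left_mono divide_right_mono)
  have ge: "ennreal (\<kappa> * c / real (DIM('a))) \<le> ball_energy r q E u \<epsilon>" if "0 < \<epsilon>" "0 \<le> c" "\<And>\<rho>. 0 < \<rho> \<Longrightarrow> \<rho> < \<epsilon> \<Longrightarrow> c \<le> S \<rho>" for \<epsilon> c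
    unfolding ball_energy_eq[OF that(1)] ball_energy_const[OF that(1,2), symmetric]
    using that \<kappa> by (intro nn_integral_mono) (auto split: split_indicator intro!: mult_right_mono ennreal_leI mult_left_mono divide_right_mono)
  have fin: "ball_energy r q E u \<epsilon> < \<infinity>" if "0 < \<epsilon>" for \<epsilon>
    using le[OF that, of "C * H"] C H S_le by (auto intro: le_less_trans)
  have "((\<lambda>\<epsilon>. enn2real (ball_energy r q E u \<epsilon>)) \<longlongrightarrow> \<kappa> * L / real (DIM('a))) (at_right 0)"
  proof (rule order_tendstoI)
    fix y assume y: "\<kappa> * L / real (DIM('a)) < y"
    \<comment> \<open>Halfway between \<open>L\<close> and the value that corresponds to \<open>y\<close>.\<close>
    define c where "c = (L + y * real (DIM('a)) / \<kappa>) / 2"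
    have c: "L < c" "\<kappa> * c / real (DIM('a)) < y" using y \<kappa> N by (auto simp: c_def field_simps)
    have "eventually (\<lambda>\<rho>. S \<rho> \<le> c) (at_right 0)"
      using order_tendstoD(2)[OF S_lim c(1)] by (auto elim: eventually_mono)
    then obtain a where a: "0 < a" "\<And>\<rho>. 0 < \<rho> \<Longrightarrow> \<rho> < a \<Longrightarrow> S \<rho> \<le> c" using near by meson
    have "eventually (\<lambda>\<epsilon>. \<epsilon> \<in> {0<..<a}) (at_right 0)" by (rule eventually_at_right_real[OF a(1)])
    then show "eventually (\<lambda>\<epsilon>. enn2real (ball_energy r q E u \<epsilon>) < y) (at_right 0)"
    proof eventually_elim
      case (elim \<epsilon>)
      then have "enn2real (ball_energy r q E u \<epsilon>) \<le> \<kappa> * c / real (DIM('a))"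
        using a L c \<kappa> by (intro enn2real_leI le) auto
      then show ?case using c(2) by linarith
    qed
  next
    fix y assume y: "y < \<kappa> * L / real (DIM('a))"
    show "eventually (\<lambda>\<epsilon>. y < enn2real (ball_energy r q E u \<epsilon>)) (at_right 0)"
    proof (cases "y < 0")
      case True
      then show ?thesis by (intro always_eventually allI) (auto intro: less_le_trans)
    next
      case False
      define c where "c = (L + y * real (DIM('a)) / \<kappa>) / 2"
      have c: "c < L" "y < \<kappa> * c / real (DIM('a))" "0 \<le> c" using y \<kappa> N L False by (auto simp: c_def field_simps)
      have "eventually (\<lambda>\<rho>. c \<le> S \<rho>) (at_right 0)"
        using order_tendstoD(1)[OF S_lim c(1)] by (auto elim: eventually_mono)
      then obtain a where a: "0 < a" "\<And>\<rho>. 0 < \<rho> \<Longrightarrow> \<rho> < a \<Longrightarrow> c \<le> S \<rho>" using near by meson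
      have "eventually (\<lambda>\<epsilon>. \<epsilon> \<in> {0<..<a}) (at_right 0)" by (rule eventually_at_right_real[OF a(1)])
      then show ?thesis
      proof eventually_elim
        case (elim \<epsilon>)
        then have "\<kappa> * c / real (DIM('a)) \<le> enn2real (ball_energy r q E u \<epsilon>)"
          using a c by (intro le_enn2realI ge fin) auto
        then show ?case using c(2) by linarith
      qed
    qed
  qed
  then have "((\<lambda>\<epsilon>. ennreal (enn2real (ball_energy r q E u \<epsilon>))) \<longlongrightarrow> ennreal (\<kappa> * L / real (DIM('a)))) (at_right 0)"
    by (rule tendsto_ennrealI)
  moreover have "eventually (\<lambda>\<epsilon>. ennreal (enn2real (ball_energy r q E u \<epsilon>)) = ball_energy r q E u \<epsilon>) (at_right 0)"
    using eventually_at_right_0_unit by eventually_elim (use fin in \<open>auto simp: less_top\<close>)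
  ultimately show ?thesis by (rule Lim_transform_eventually)
qed

end

section \<open>The Gagliardo energy of a mollification\<close>

context besov_energy
begin

text \<open>The Besov weight \<open>|h|\<^sup>p\<close> cancels against the Gagliardo weight and leaves \<open>|h|\<^sup>-\<^sup>N\<close>, which becomes \<open>1 / \<rho>\<close> in polar
  coordinates.\<close>

lemma radial_energy:
  assumes [measurable]: "\<psi> \<in> borel_measurable borel" "I \<in> sets borel"
    and I: "I \<subseteq> {0<..}" and \<psi>: "\<And>\<rho>. \<rho> \<in> I \<Longrightarrow> 0 \<le> \<psi> \<rho>"
  shows "(\<integral>\<^sup>+h. ennreal (\<psi> (norm h) * norm h powr p) * (k h * indicator {h. norm h \<in> I} h) \<partial>(lborel :: 'a measure)) =
    ennreal (\<kappa> * H) * (\<integral>\<^sup>+\<rho>. ennreal (\<psi> \<rho> / \<rho>) * indicator I \<rho> \<partial>lborel)"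
proof -
  define \<phi> where "\<phi> \<rho> = ennreal (\<psi> \<rho> * \<rho> powr p) * (ennreal (1 / \<rho> powr (real (DIM('a)) + p)) * indicator I \<rho>)" for \<rho>
  have [measurable]: "\<phi> \<in> borel_measurable borel" unfolding \<phi>_def by measurable
  have "(\<integral>\<^sup>+h. ennreal (\<psi> (norm h) * norm h powr p) * (k h * indicator {h. norm h \<in> I} h) \<partial>(lborel :: 'a measure)) =
      (\<integral>\<^sup>+h. \<phi> (norm h) \<partial>(lborel :: 'a measure))"
    by (intro nn_integral_cong) (auto simp: \<phi>_def split: split_indicator)
  also have "\<dots> = (\<integral>\<^sup>+\<rho>. ennreal (\<kappa> * H * \<rho> ^ (DIM('a) - 1)) * \<phi> \<rho> * indicator {0<..} \<rho> \<partial>lborel)"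
    by (rule polar_radial) measurable
  also have "\<dots> = (\<integral>\<^sup>+\<rho>. ennreal (\<kappa> * H) * (ennreal (\<psi> \<rho> / \<rho>) * indicator I \<rho>) \<partial>lborel)"
  proof (rule nn_integral_cong)
    fix \<rho> :: real
    show "ennreal (\<kappa> * H * \<rho> ^ (DIM('a) - 1)) * \<phi> \<rho> * indicator {0<..} \<rho> = ennreal (\<kappa> * H) * (ennreal (\<psi> \<rho> / \<rho>) * indicator I \<rho>)"
    proof (cases "\<rho> \<in> I")
      case True
      then have \<rho>: "0 < \<rho>" using I by auto
      have nn: "0 \<le> \<kappa> * H" "0 \<le> \<psi> \<rho>" "0 \<le> \<rho> ^ (DIM('a) - 1)" "0 \<le> 1 / \<rho> powr (real (DIM('a)) + p)"
        using \<kappa> H(2) \<psi>[OF True] \<rho> by auto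
      have "\<rho> powr p * \<rho> powr (- 1 - p) = \<rho> powr (- 1)" by (simp flip: powr_add)
      also have "\<dots> = 1 / \<rho>" using \<rho> by (simp add: powr_minus_divide)
      finally have pw: "\<rho> powr p * (\<rho> ^ (DIM('a) - 1) * (1 / \<rho> powr (real (DIM('a)) + p))) = 1 / \<rho>"
        using kernel_power[OF \<rho>] by simp
      have "ennreal (\<kappa> * H * \<rho> ^ (DIM('a) - 1)) * (ennreal (\<psi> \<rho> * \<rho> powr p) * ennreal (1 / \<rho> powr (real (DIM('a)) + p))) =
          ennreal (\<kappa> * H * \<rho> ^ (DIM('a) - 1) * (\<psi> \<rho> * \<rho> powr p * (1 / \<rho> powr (real (DIM('a)) + p))))"
        using nn by (simp only: ennreal_mult[symmetric] mult_nonneg_nonneg powr_ge_zero)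
      also have "\<kappa> * H * \<rho> ^ (DIM('a) - 1) * (\<psi> \<rho> * \<rho> powr p * (1 / \<rho> powr (real (DIM('a)) + p))) =
          \<kappa> * H * (\<psi> \<rho> * (\<rho> powr p * (\<rho> ^ (DIM('a) - 1) * (1 / \<rho> powr (real (DIM('a)) + p)))))"
        by (simp only: ac_simps)
      also have "\<dots> = \<kappa> * H * (\<psi> \<rho> / \<rho>)" unfolding pw by simp
      also have "ennreal \<dots> = ennreal (\<kappa> * H) * ennreal (\<psi> \<rho> / \<rho>)"
        using nn \<rho> by (intro ennreal_mult) auto
      finally show ?thesis using True \<rho> by (simp add: \<phi>_def)
    qed (simp add: \<phi>_def)
  qed
  also have "\<dots> = ennreal (\<kappa> * H) * (\<integral>\<^sup>+\<rho>. ennreal (\<psi> \<rho> / \<rho>) * indicator I \<rho> \<partial>lborel)"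
    by (rule nn_integral_cmult) measurable
  finally show ?thesis .
qed

lemma gagliardo_energy_radial_le:
  assumes [measurable]: "\<psi> \<in> borel_measurable borel" "I \<in> sets borel"
    and I: "I \<subseteq> {0<..}" and \<psi>: "\<And>\<rho>. \<rho> \<in> I \<Longrightarrow> 0 \<le> \<psi> \<rho>"
    and le: "\<And>h. norm h \<in> I \<Longrightarrow> Lq_powr q (fdiff h w) \<le> ennreal (\<psi> (norm h) * norm h powr p)"
  shows "gagliardo_energy r q E {h. norm h \<in> I} w \<le> ennreal (\<kappa> * H) * (\<integral>\<^sup>+\<rho>. ennreal (\<psi> \<rho> / \<rho>) * indicator I \<rho> \<partial>lborel)"
proof -
  have "gagliardo_energy r q E {h. norm h \<in> I} w \<le>
      (\<integral>\<^sup>+h. ennreal (\<psi> (norm h) * norm h powr p) * (k h * indicator {h. norm h \<in> I} h) \<partial>(lborel :: 'a measure))"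
    unfolding gagliardo_energy_def
  proof (rule nn_integral_mono)
    fix h :: 'a
    show "pair_energy q E w h * (k h * indicator {h. norm h \<in> I} h) \<le>
        ennreal (\<psi> (norm h) * norm h powr p) * (k h * indicator {h. norm h \<in> I} h)"
      using order_trans[OF pair_energy_le_Lq_powr le, of h E]
      by (cases "norm h \<in> I") (auto intro: mult_right_mono)
  qed
  then show ?thesis by (simp only: radial_energy[OF assms(1,2) I \<psi>])
qed

lemma gagliardo_energy_split:
  fixes w w' :: "'a \<Rightarrow> 'b"
  assumes [measurable]: "w \<in> borel_measurable borel" "w' \<in> borel_measurable borel"
    "\<psi> \<in> borel_measurable borel" "I \<in> sets borel"
    and I: "I \<subseteq> {0<..}" and \<psi>: "\<And>\<rho>. \<rho> \<in> I \<Longrightarrow> 0 \<le> \<psi> \<rho>" and \<delta>: "0 < \<delta>" "\<delta> < 1"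
    and le: "\<And>h. norm h \<in> I \<Longrightarrow> Lq_powr q (\<lambda>x. fdiff h w x - fdiff h w' x) \<le> ennreal (\<psi> (norm h) * norm h powr p)"
  shows "gagliardo_energy r q E {h. norm h \<in> I} w \<le> ennreal ((1 - \<delta>) powr (1 - q)) * gagliardo_energy r q E {h. norm h \<in> I} w' +
    ennreal (\<delta> powr (1 - q)) * (ennreal (\<kappa> * H) * (\<integral>\<^sup>+\<rho>. ennreal (\<psi> \<rho> / \<rho>) * indicator I \<rho> \<partial>lborel))"
proof -
  let ?c = "ennreal ((1 - \<delta>) powr (1 - q))" and ?d = "ennreal (\<delta> powr (1 - q))"
  let ?k = "\<lambda>h. k h * indicator {h. norm h \<in> I} h"
  have "gagliardo_energy r q E {h. norm h \<in> I} w \<le>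
      (\<integral>\<^sup>+h. ?c * (pair_energy q E w' h * ?k h) + ?d * (ennreal (\<psi> (norm h) * norm h powr p) * ?k h) \<partial>(lborel :: 'a measure))"
    unfolding gagliardo_energy_def
  proof (rule nn_integral_mono)
    fix h :: 'a
    show "pair_energy q E w h * ?k h \<le> ?c * (pair_energy q E w' h * ?k h) + ?d * (ennreal (\<psi> (norm h) * norm h powr p) * ?k h)"
    proof (cases "norm h \<in> I")
      case True
      have "pair_energy q E w h \<le> ?c * pair_energy q E w' h + ?d * Lq_powr q (\<lambda>x. fdiff h w x - fdiff h w' x)"
        by (rule pair_energy_split[OF q \<delta>]) measurable
      also have "\<dots> \<le> ?c * pair_energy q E w' h + ?d * ennreal (\<psi> (norm h) * norm h powr p)"
        by (intro add_left_mono mult_left_mono le True) simp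
      finally have "pair_energy q E w h * ?k h \<le> (?c * pair_energy q E w' h + ?d * ennreal (\<psi> (norm h) * norm h powr p)) * ?k h"
        by (rule mult_right_mono) simp
      then show ?thesis by (simp only: distrib_right mult.assoc)
    qed simp
  qed
  also have "\<dots> = ?c * gagliardo_energy r q E {h. norm h \<in> I} w' +
      ?d * (\<integral>\<^sup>+h. ennreal (\<psi> (norm h) * norm h powr p) * ?k h \<partial>(lborel :: 'a measure))"
    unfolding gagliardo_energy_def by (simp add: nn_integral_add nn_integral_cmult)
  finally show ?thesis by (simp only: radial_energy[OF assms(3,4) I \<psi>])
qed

lemma gagliardo_energy_annulus:
  assumes \<epsilon>: "0 < \<epsilon>"
  shows "gagliardo_energy r q E {h. norm h \<in> {\<epsilon><..<1}} u = ennreal \<kappa> * log_integral S \<epsilon> 1"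
proof -
  define \<phi> where "\<phi> \<rho> = ennreal (1 / \<rho> powr (real (DIM('a)) + p)) * indicator {\<epsilon><..<1} \<rho>" for \<rho> :: real
  have [measurable]: "\<phi> \<in> borel_measurable borel" unfolding \<phi>_def by measurable
  have "gagliardo_energy r q E {h. norm h \<in> {\<epsilon><..<1}} u = (\<integral>\<^sup>+h. pair_energy q E u h * \<phi> (norm h) \<partial>(lborel :: 'a measure))"
    unfolding gagliardo_energy_def by (intro nn_integral_cong) (auto simp: \<phi>_def split: split_indicator)
  also have "\<dots> = (\<integral>\<^sup>+\<rho>. (\<integral>\<^sup>+n. pair_energy q E u (\<rho> *\<^sub>R n) \<partial>hausdorff_sphere) * \<phi> \<rho> *
      (ennreal (\<kappa> * \<rho> ^ (DIM('a) - 1)) * indicator {0<..} \<rho>) \<partial>lborel)"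
    by (rule polar_energy) measurable
  also have "\<dots> = (\<integral>\<^sup>+\<rho>. ennreal \<kappa> * (ennreal (S \<rho> / \<rho>) * indicator {\<epsilon><..<1} \<rho>) \<partial>lborel)"
  proof (rule nn_integral_cong)
    fix \<rho> :: real
    show "(\<integral>\<^sup>+n. pair_energy q E u (\<rho> *\<^sub>R n) \<partial>hausdorff_sphere) * \<phi> \<rho> * (ennreal (\<kappa> * \<rho> ^ (DIM('a) - 1)) * indicator {0<..} \<rho>) =
        ennreal \<kappa> * (ennreal (S \<rho> / \<rho>) * indicator {\<epsilon><..<1} \<rho>)"
    proof (cases "\<rho> \<in> {\<epsilon><..<1}")
      case True
      then have \<rho>: "0 < \<rho>" using \<epsilon> by auto
      have nn: "0 \<le> \<kappa>" "0 \<le> S \<rho>" "0 \<le> \<rho> ^ (DIM('a) - 1)" "0 \<le> 1 / \<rho> powr (real (DIM('a)) + p)"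
        using \<kappa> S_nonneg[of \<rho>] \<rho> by auto
      have "\<rho> powr p * \<rho> powr (- 1 - p) = \<rho> powr (- 1)" by (simp flip: powr_add)
      also have "\<dots> = 1 / \<rho>" using \<rho> by (simp add: powr_minus_divide)
      finally have pw: "\<rho> powr p * (\<rho> ^ (DIM('a) - 1) * (1 / \<rho> powr (real (DIM('a)) + p))) = 1 / \<rho>"
        using kernel_power[OF \<rho>] by simp
      have "ennreal (\<rho> powr p * S \<rho>) * ennreal (1 / \<rho> powr (real (DIM('a)) + p)) * ennreal (\<kappa> * \<rho> ^ (DIM('a) - 1)) =
          ennreal (\<rho> powr p * S \<rho> * (1 / \<rho> powr (real (DIM('a)) + p)) * (\<kappa> * \<rho> ^ (DIM('a) - 1)))"
        using nn by (simp only: ennreal_mult[symmetric] mult_nonneg_nonneg powr_ge_zero)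
      also have "\<rho> powr p * S \<rho> * (1 / \<rho> powr (real (DIM('a)) + p)) * (\<kappa> * \<rho> ^ (DIM('a) - 1)) =
          \<kappa> * (S \<rho> * (\<rho> powr p * (\<rho> ^ (DIM('a) - 1) * (1 / \<rho> powr (real (DIM('a)) + p)))))"
        by (simp only: ac_simps)
      also have "\<dots> = \<kappa> * (S \<rho> / \<rho>)" unfolding pw by simp
      also have "ennreal \<dots> = ennreal \<kappa> * ennreal (S \<rho> / \<rho>)"
        using nn \<rho> by (intro ennreal_mult) auto
      finally show ?thesis using True \<rho> by (simp add: \<phi>_def sphere_integral)
    qed (auto simp: \<phi>_def)
  qed
  also have "\<dots> = ennreal \<kappa> * log_integral S \<epsilon> 1"
    unfolding log_integral_def by (rule nn_integral_cmult) measurable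
  finally show ?thesis .
qed

lemma gagliardo_energy_decompose:
  assumes \<epsilon>: "0 < \<epsilon>" "\<epsilon> < 1" and [measurable]: "w \<in> borel_measurable borel"
  shows "gagliardo_energy r q E UNIV w = gagliardo_energy r q E {h. norm h \<in> {0<..\<epsilon>}} w +
    gagliardo_energy r q E {h. norm h \<in> {\<epsilon><..<1}} w + gagliardo_energy r q E {h. norm h \<in> {1..}} w"
proof -
  \<comment> \<open>At \<open>h = 0\<close> the weight is \<open>1 / 0 = 0\<close>, so the three regions exhaust the integral.\<close>
  have "gagliardo_energy r q E UNIV w = (\<integral>\<^sup>+h. pair_energy q E w h * (k h * indicator {h. norm h \<in> {0<..\<epsilon>}} h) +
      pair_energy q E w h * (k h * indicator {h. norm h \<in> {\<epsilon><..<1}} h) +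
      pair_energy q E w h * (k h * indicator {h. norm h \<in> {1..}} h) \<partial>(lborel :: 'a measure))"
    unfolding gagliardo_energy_def using \<epsilon>
    by (intro nn_integral_cong) (auto split: split_indicator)
  also have "\<dots> = gagliardo_energy r q E {h. norm h \<in> {0<..\<epsilon>}} w +
    gagliardo_energy r q E {h. norm h \<in> {\<epsilon><..<1}} w + gagliardo_energy r q E {h. norm h \<in> {1..}} w"
    unfolding gagliardo_energy_def by (simp add: nn_integral_add)
  finally show ?thesis .
qed

lemma gagliardo_energy_small:
  "\<exists>c\<ge>0. \<forall>\<epsilon>>0. gagliardo_energy r q E {h. norm h \<in> {0<..\<epsilon>}} (v \<epsilon>) \<le> ennreal c"
proof -
  obtain K \<alpha> where K: "0 \<le> K" and \<alpha>: "0 < \<alpha>" and le: "\<And>\<epsilon> h. 0 < \<epsilon> \<Longrightarrow> h \<noteq> 0 \<Longrightarrow> norm h \<le> \<epsilon> \<Longrightarrow>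
      Lq_powr q (fdiff h (v \<epsilon>)) \<le> ennreal (K * norm h powr p * (norm h / \<epsilon>) powr \<alpha>)"
    using Lq_powr_fdiff_mollify_small by blast
  have "gagliardo_energy r q E {h. norm h \<in> {0<..\<epsilon>}} (v \<epsilon>) \<le> ennreal (\<kappa> * H * (K / \<alpha>))" if \<epsilon>: "0 < \<epsilon>" for \<epsilon>
  proof -
    have "gagliardo_energy r q E {h. norm h \<in> {0<..\<epsilon>}} (v \<epsilon>) \<le>
        ennreal (\<kappa> * H) * (\<integral>\<^sup>+\<rho>. ennreal (K * (\<rho> / \<epsilon>) powr \<alpha> / \<rho>) * indicator {0<..\<epsilon>} \<rho> \<partial>lborel)"
    proof (rule gagliardo_energy_radial_le[where \<psi> = "\<lambda>\<rho>. K * (\<rho> / \<epsilon>) powr \<alpha>"])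
      fix h :: 'a assume "norm h \<in> {0<..\<epsilon>}"
      then show "Lq_powr q (fdiff h (v \<epsilon>)) \<le> ennreal (K * (norm h / \<epsilon>) powr \<alpha> * norm h powr p)"
        using le[OF \<epsilon>, of h] by (simp add: ac_simps)
    qed (use K in auto)
    also have "(\<integral>\<^sup>+\<rho>. ennreal (K * (\<rho> / \<epsilon>) powr \<alpha> / \<rho>) * indicator {0<..\<epsilon>} \<rho> \<partial>lborel) =
        (\<integral>\<^sup>+\<rho>. ennreal (K / \<epsilon> powr \<alpha>) * (ennreal (\<rho> powr (\<alpha> - 1)) * indicator {0<..\<epsilon>} \<rho>) \<partial>lborel)"
    proof (rule nn_integral_cong)
      fix \<rho> :: real
      show "ennreal (K * (\<rho> / \<epsilon>) powr \<alpha> / \<rho>) * indicator {0<..\<epsilon>} \<rho> = ennreal (K / \<epsilon> powr \<alpha>) * (ennreal (\<rho> powr (\<alpha> - 1)) * indicator {0<..\<epsilon>} \<rho>)"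
        using K \<epsilon> by (auto simp: ennreal_mult[symmetric] powr_divide powr_diff split: split_indicator)
    qed
    also have "\<dots> = ennreal (K / \<epsilon> powr \<alpha>) * ennreal (\<epsilon> powr \<alpha> / \<alpha>)"
      by (subst nn_integral_cmult) (auto simp: nn_integral_powr_near_0[OF \<alpha> \<epsilon>])
    also have "\<dots> = ennreal (K / \<alpha>)" using K \<epsilon> \<alpha> by (simp add: ennreal_mult[symmetric])
    also have "ennreal (\<kappa> * H) * ennreal (K / \<alpha>) = ennreal (\<kappa> * H * (K / \<alpha>))"
      using K \<alpha> \<kappa> H by (intro ennreal_mult[symmetric]) auto
    finally show ?thesis .
  qed
  moreover have "0 \<le> \<kappa> * H * (K / \<alpha>)" using K \<alpha> \<kappa> H by auto
  ultimately show ?thesis by blast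
qed

lemma gagliardo_energy_large:
  "\<exists>c\<ge>0. \<forall>\<epsilon>. gagliardo_energy r q E {h. norm h \<in> {1..}} (v \<epsilon>) \<le> ennreal c"
proof -
  obtain K where K: "0 \<le> K" and le: "\<And>\<epsilon> h. Lq_powr q (fdiff h (v \<epsilon>)) \<le> ennreal K"
    using Lq_powr_fdiff_mollify_bounded by blast
  have "gagliardo_energy r q E {h. norm h \<in> {1..}} (v \<epsilon>) \<le> ennreal (\<kappa> * H * (K * (1 / p)))" for \<epsilon>
  proof -
    have "gagliardo_energy r q E {h. norm h \<in> {1..}} (v \<epsilon>) \<le>
        ennreal (\<kappa> * H) * (\<integral>\<^sup>+\<rho>. ennreal (K / \<rho> powr p / \<rho>) * indicator {1..} \<rho> \<partial>lborel)"
    proof (rule gagliardo_energy_radial_le[where \<psi> = "\<lambda>\<rho>. K / \<rho> powr p"])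
      fix h :: 'a assume "norm h \<in> {1..}"
      then have "norm h powr p \<noteq> 0" by auto
      then show "Lq_powr q (fdiff h (v \<epsilon>)) \<le> ennreal (K / norm h powr p * norm h powr p)"
        using le[of h \<epsilon>] by simp
    qed (use K in auto)
    also have "(\<integral>\<^sup>+\<rho>. ennreal (K / \<rho> powr p / \<rho>) * indicator {1..} \<rho> \<partial>lborel) =
        (\<integral>\<^sup>+\<rho>. ennreal K * (ennreal (\<rho> powr (- 1 - p)) * indicator {1..} \<rho>) \<partial>lborel)"
    proof (rule nn_integral_cong)
      fix \<rho> :: real
      have "K / \<rho> powr p / \<rho> = K * \<rho> powr (- 1 - p)" if "1 \<le> \<rho>"
        using that powr_add[of \<rho> "- 1" "- p"] by (simp add: powr_minus divide_inverse)
      then show "ennreal (K / \<rho> powr p / \<rho>) * indicator {1..} \<rho> = ennreal K * (ennreal (\<rho> powr (- 1 - p)) * indicator {1..} \<rho>)"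
        using K by (auto simp: ennreal_mult[symmetric] split: split_indicator)
    qed
    also have "\<dots> = ennreal K * ennreal (1 / p)"
      by (subst nn_integral_cmult) (auto simp: nn_integral_powr_at_infinity[OF p_pos])
    also have "\<dots> = ennreal (K * (1 / p))" using K p_pos by (intro ennreal_mult[symmetric]) auto
    also have "ennreal (\<kappa> * H) * ennreal (K * (1 / p)) = ennreal (\<kappa> * H * (K * (1 / p)))"
      using K p_pos \<kappa> H by (intro ennreal_mult[symmetric]) auto
    finally show ?thesis .
  qed
  moreover have "0 \<le> \<kappa> * H * (K * (1 / p))" using K p_pos \<kappa> H by auto
  ultimately show ?thesis by blast
qed

lemma gagliardo_energy_scaleR:
  "gagliardo_energy r q E A (\<lambda>x. c *\<^sub>R u x) = ennreal (\<bar>c\<bar> powr q) * gagliardo_energy r q E A u"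
  if [measurable]: "A \<in> sets borel"
  unfolding gagliardo_energy_def
  by (subst nn_integral_cmult[symmetric]) (auto simp: pair_energy_scaleR mult.assoc)

lemma gagliardo_energy_mono: "A \<subseteq> B \<Longrightarrow> gagliardo_energy r q E A w \<le> gagliardo_energy r q E B w"
  unfolding gagliardo_energy_def by (intro nn_integral_mono mult_left_mono) (auto split: split_indicator)

text \<open>The annulus \<open>\<epsilon> < |h| < 1\<close> carries the logarithm: \<open>IS\<close> is the integral of \<open>S(\<rho>) / \<rho>\<close> and \<open>IG\<close> that of the error bound.
  The other two regions enter only through the constants \<open>c1\<close> and \<open>c2\<close>.\<close>

lemma gagliardo_energy_lim:
  "((\<lambda>\<epsilon>. ennreal (1 / \<bar>ln \<epsilon>\<bar>) * gagliardo_energy r q E UNIV (v \<epsilon>)) \<longlongrightarrow> ennreal (m * (\<kappa> * L))) (at_right 0)"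
proof -
  let ?m0 = "LINT z|lborel. \<eta> z"
  let ?B = "\<lambda>\<epsilon>. {h::'a. norm h \<in> {\<epsilon><..<1}}"
  define G where "G \<epsilon> = gagliardo_energy r q E UNIV (v \<epsilon>)" for \<epsilon>
  obtain c1 where c1: "0 \<le> c1" "\<And>\<epsilon>. 0 < \<epsilon> \<Longrightarrow> gagliardo_energy r q E {h. norm h \<in> {0<..\<epsilon>}} (v \<epsilon>) \<le> ennreal c1"
    using gagliardo_energy_small by blast
  obtain c2 where c2: "0 \<le> c2" "\<And>\<epsilon>. gagliardo_energy r q E {h. norm h \<in> {1..}} (v \<epsilon>) \<le> ennreal c2"
    using gagliardo_energy_large by blast
  define c0 where "c0 = W powr (q - 1) * (2 powr q * C)"
  have c0: "0 \<le> c0" using C by (simp add: c0_def)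
  define g where "g s = c0 * tail s" for s
  have [measurable]: "g \<in> borel_measurable borel" unfolding g_def[abs_def] by measurable
  have g: "0 \<le> g s" "0 < s \<Longrightarrow> g s \<le> c0 * W" for s
    using c0 tail_nonneg[of s] tail_le[of s] by (auto simp: g_def intro: mult_left_mono)
  have g_lim: "(g \<longlongrightarrow> 0) at_top"
    unfolding g_def[abs_def] using tendsto_mult[OF tendsto_const tail_tendsto_0, of c0] by simp
  define IS where "IS \<epsilon> = enn2real (log_integral S \<epsilon> 1)" for \<epsilon>
  define IG where "IG \<epsilon> = enn2real (log_integral (\<lambda>\<rho>. g (\<rho> / \<epsilon>)) \<epsilon> 1)" for \<epsilon>
  have IS: "log_integral S \<epsilon> 1 = ennreal (IS \<epsilon>)" if "0 < \<epsilon>" "\<epsilon> < 1" for \<epsilon>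
  proof -
    have "log_integral S \<epsilon> 1 \<le> ennreal (C * H * (ln 1 - ln \<epsilon>))"
      using that C H S_le by (intro log_integral_le_const) auto
    then show ?thesis by (simp add: IS_def less_top le_less_trans)
  qed
  have IG: "log_integral (\<lambda>\<rho>. g (\<rho> / \<epsilon>)) \<epsilon> 1 = ennreal (IG \<epsilon>)" if "0 < \<epsilon>" "\<epsilon> < 1" for \<epsilon>
  proof -
    have "log_integral (\<lambda>\<rho>. g (\<rho> / \<epsilon>)) \<epsilon> 1 \<le> ennreal (c0 * W * (ln 1 - ln \<epsilon>))"
      using that c0 W_nonneg by (intro log_integral_le_const g(2) mult_nonneg_nonneg) auto
    then show ?thesis by (simp add: IG_def less_top le_less_trans)
  qed
  have nn: "0 \<le> IS \<epsilon>" "0 \<le> IG \<epsilon>" "0 \<le> m" "0 \<le> \<kappa>" "0 \<le> \<kappa> * H" for \<epsilon>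
    using \<kappa> H by (auto simp: IS_def IG_def)
  have annulus: "gagliardo_energy r q E (?B \<epsilon>) (\<lambda>x. ?m0 *\<^sub>R u x) = ennreal (m * (\<kappa> * IS \<epsilon>))" if "0 < \<epsilon>" "\<epsilon> < 1" for \<epsilon>
  proof -
    have "gagliardo_energy r q E (?B \<epsilon>) (\<lambda>x. ?m0 *\<^sub>R u x) = ennreal m * (ennreal \<kappa> * ennreal (IS \<epsilon>))"
      using that by (simp add: gagliardo_energy_scaleR gagliardo_energy_annulus IS del: greaterThanLessThan_iff)
    also have "\<dots> = ennreal (m * (\<kappa> * IS \<epsilon>))"
      using nn by (simp only: ennreal_mult[symmetric] mult_nonneg_nonneg)
    finally show ?thesis .
  qed
  have err: "Lq_powr q (\<lambda>x. fdiff h (v \<epsilon>) x - fdiff h (\<lambda>x. ?m0 *\<^sub>R u x) x) \<le> ennreal (g (norm h / \<epsilon>) * norm h powr p)"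
    if "0 < \<epsilon>" "norm h \<in> {\<epsilon><..<1}" for \<epsilon> h
  proof -
    have "fdiff h (\<lambda>x. ?m0 *\<^sub>R u x) x = ?m0 *\<^sub>R fdiff h u x" for x by (simp add: fdiff_def scaleR_diff_right)
    moreover have "h \<noteq> 0" using that by auto
    ultimately show ?thesis
      using Lq_powr_fdiff_error[of \<epsilon> h] that by (auto simp: g_def c0_def ac_simps)
  qed
  have upper: "G \<epsilon> \<le> ennreal (c1 + c2 + (1 - \<delta>) powr (1 - q) * (m * (\<kappa> * IS \<epsilon>)) + \<delta> powr (1 - q) * (\<kappa> * H * IG \<epsilon>))"
    if \<epsilon>: "0 < \<epsilon>" "\<epsilon> < 1" and \<delta>: "0 < \<delta>" "\<delta> < 1" for \<epsilon> \<delta>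
  proof -
    have "gagliardo_energy r q E (?B \<epsilon>) (v \<epsilon>) \<le> ennreal ((1 - \<delta>) powr (1 - q)) * gagliardo_energy r q E (?B \<epsilon>) (\<lambda>x. ?m0 *\<^sub>R u x) +
        ennreal (\<delta> powr (1 - q)) * (ennreal (\<kappa> * H) * log_integral (\<lambda>\<rho>. g (\<rho> / \<epsilon>)) \<epsilon> 1)"
      unfolding log_integral_def using \<epsilon> \<delta> err g by (intro gagliardo_energy_split) auto
    also have "\<dots> = ennreal ((1 - \<delta>) powr (1 - q) * (m * (\<kappa> * IS \<epsilon>)) + \<delta> powr (1 - q) * (\<kappa> * H * IG \<epsilon>))"
      unfolding annulus[OF \<epsilon>] IG[OF \<epsilon>]
      using nn by (simp only: ennreal_mult[symmetric] ennreal_plus[symmetric] mult_nonneg_nonneg powr_ge_zero)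
    finally have mid: "gagliardo_energy r q E (?B \<epsilon>) (v \<epsilon>) \<le> \<dots>" .
    have "G \<epsilon> = gagliardo_energy r q E {h. norm h \<in> {0<..\<epsilon>}} (v \<epsilon>) + gagliardo_energy r q E (?B \<epsilon>) (v \<epsilon>) +
        gagliardo_energy r q E {h. norm h \<in> {1..}} (v \<epsilon>)"
      unfolding G_def using \<epsilon> by (intro gagliardo_energy_decompose) measurable
    also have "\<dots> \<le> ennreal c1 + ennreal ((1 - \<delta>) powr (1 - q) * (m * (\<kappa> * IS \<epsilon>)) + \<delta> powr (1 - q) * (\<kappa> * H * IG \<epsilon>)) + ennreal c2"
      by (intro add_mono c1(2) c2(2) mid \<epsilon>)
    also have "\<dots> = ennreal (c1 + ((1 - \<delta>) powr (1 - q) * (m * (\<kappa> * IS \<epsilon>)) + \<delta> powr (1 - q) * (\<kappa> * H * IG \<epsilon>)) + c2)"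
      using nn c1(1) c2(1) by (simp only: ennreal_plus[symmetric] mult_nonneg_nonneg powr_ge_zero add_nonneg_nonneg)
    finally show ?thesis by (simp only: ac_simps)
  qed
  have fin: "G \<epsilon> = ennreal (enn2real (G \<epsilon>))" if "0 < \<epsilon>" "\<epsilon> < 1" for \<epsilon>
    using upper[OF that, of "1 / 2"] by (simp add: less_top le_less_trans)
  have lower: "m * (\<kappa> * IS \<epsilon>) \<le> (1 - \<delta>) powr (1 - q) * enn2real (G \<epsilon>) + \<delta> powr (1 - q) * (\<kappa> * H * IG \<epsilon>)"
    if \<epsilon>: "0 < \<epsilon>" "\<epsilon> < 1" and \<delta>: "0 < \<delta>" "\<delta> < 1" for \<epsilon> \<delta>
  proof -
    have err': "Lq_powr q (\<lambda>x. fdiff h (\<lambda>x. ?m0 *\<^sub>R u x) x - fdiff h (v \<epsilon>) x) \<le> ennreal (g (norm h / \<epsilon>) * norm h powr p)"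
      if "norm h \<in> {\<epsilon><..<1}" for h
      using err[OF \<epsilon>(1) that] by (subst Lq_powr_minus_commute)
    have "ennreal (m * (\<kappa> * IS \<epsilon>)) \<le> ennreal ((1 - \<delta>) powr (1 - q)) * gagliardo_energy r q E (?B \<epsilon>) (v \<epsilon>) +
        ennreal (\<delta> powr (1 - q)) * (ennreal (\<kappa> * H) * log_integral (\<lambda>\<rho>. g (\<rho> / \<epsilon>)) \<epsilon> 1)"
      unfolding log_integral_def annulus[OF \<epsilon>, symmetric] using \<epsilon> \<delta> err' g by (intro gagliardo_energy_split) auto
    also have "\<dots> \<le> ennreal ((1 - \<delta>) powr (1 - q)) * ennreal (enn2real (G \<epsilon>)) +
        ennreal (\<delta> powr (1 - q)) * (ennreal (\<kappa> * H) * ennreal (IG \<epsilon>))"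
    proof -
      have "gagliardo_energy r q E (?B \<epsilon>) (v \<epsilon>) \<le> G \<epsilon>"
        unfolding G_def by (rule gagliardo_energy_mono) simp
      then show ?thesis
        unfolding IG[OF \<epsilon>] fin[OF \<epsilon>, symmetric] by (intro add_right_mono mult_left_mono) simp_all
    qed
    also have "\<dots> = ennreal ((1 - \<delta>) powr (1 - q) * enn2real (G \<epsilon>) + \<delta> powr (1 - q) * (\<kappa> * H * IG \<epsilon>))"
      using nn by (simp only: ennreal_mult[symmetric] ennreal_plus[symmetric] mult_nonneg_nonneg powr_ge_zero enn2real_nonneg)
    finally show ?thesis
      using nn by (subst (asm) ennreal_le_iff) (auto intro!: add_nonneg_nonneg mult_nonneg_nonneg)
  qed
  have lim: "((\<lambda>\<epsilon>. enn2real (G \<epsilon>) / - ln \<epsilon>) \<longlongrightarrow> m * (\<kappa> * L)) (at_right 0)"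
  proof (rule tendsto_of_split_bounds[where q = q and a = "\<lambda>\<epsilon>. (c1 + c2) / - ln \<epsilon>" and t = "\<lambda>\<epsilon>. \<kappa> * (IS \<epsilon> / - ln \<epsilon>)"
        and v = "\<lambda>\<epsilon>. \<kappa> * H * (IG \<epsilon> / - ln \<epsilon>)"])
    show "((\<lambda>\<epsilon>. (c1 + c2) / - ln \<epsilon>) \<longlongrightarrow> 0) (at_right 0)" by (rule tendsto_over_minus_ln)
    show "((\<lambda>\<epsilon>. \<kappa> * (IS \<epsilon> / - ln \<epsilon>)) \<longlongrightarrow> \<kappa> * L) (at_right 0)"
      unfolding IS_def using S_le S_nonneg S_lim by (intro tendsto_mult tendsto_const log_average_at_0) auto
    have "((\<lambda>\<epsilon>. IG \<epsilon> / - ln \<epsilon>) \<longlongrightarrow> 0) (at_right 0)"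
      unfolding IG_def using g g_lim by (intro log_average_tail[where B = "c0 * W"]) auto
    from tendsto_mult[OF tendsto_const this, of "\<kappa> * H"]
    show "((\<lambda>\<epsilon>. \<kappa> * H * (IG \<epsilon> / - ln \<epsilon>)) \<longlongrightarrow> 0) (at_right 0)" by simp
  next
    fix \<delta> :: real assume \<delta>: "0 < \<delta>" "\<delta> < 1"
    show "eventually (\<lambda>\<epsilon>. enn2real (G \<epsilon>) / - ln \<epsilon> \<le> (c1 + c2) / - ln \<epsilon> + (1 - \<delta>) powr (1 - q) * (m * (\<kappa> * (IS \<epsilon> / - ln \<epsilon>))) +
        \<delta> powr (1 - q) * (\<kappa> * H * (IG \<epsilon> / - ln \<epsilon>))) (at_right 0)"
      using eventually_at_right_0_unit
    proof eventually_elim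
      case (elim \<epsilon>)
      then have "enn2real (G \<epsilon>) \<le> c1 + c2 + (1 - \<delta>) powr (1 - q) * (m * (\<kappa> * IS \<epsilon>)) + \<delta> powr (1 - q) * (\<kappa> * H * IG \<epsilon>)"
        using nn H(2) c1(1) c2(1) by (intro enn2real_leI upper \<delta> add_nonneg_nonneg mult_nonneg_nonneg) auto
      then have "enn2real (G \<epsilon>) / - ln \<epsilon> \<le> (c1 + c2 + (1 - \<delta>) powr (1 - q) * (m * (\<kappa> * IS \<epsilon>)) + \<delta> powr (1 - q) * (\<kappa> * H * IG \<epsilon>)) / - ln \<epsilon>"
        using elim by (intro divide_right_mono) auto
      then show ?case by (simp only: add_divide_distrib times_divide_eq_right)
    qed
    show "eventually (\<lambda>\<epsilon>. m * (\<kappa> * (IS \<epsilon> / - ln \<epsilon>)) \<le> (1 - \<delta>) powr (1 - q) * (enn2real (G \<epsilon>) / - ln \<epsilon>) +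
        \<delta> powr (1 - q) * (\<kappa> * H * (IG \<epsilon> / - ln \<epsilon>))) (at_right 0)"
      using eventually_at_right_0_unit
    proof eventually_elim
      case (elim \<epsilon>)
      then have "(m * (\<kappa> * IS \<epsilon>)) / - ln \<epsilon> \<le> ((1 - \<delta>) powr (1 - q) * enn2real (G \<epsilon>) + \<delta> powr (1 - q) * (\<kappa> * H * IG \<epsilon>)) / - ln \<epsilon>"
        using lower[of \<epsilon> \<delta>] \<delta> by (intro divide_right_mono) auto
      then show ?case by (simp only: add_divide_distrib times_divide_eq_right)
    qed
  qed simp
  have "((\<lambda>\<epsilon>. ennreal (enn2real (G \<epsilon>) / - ln \<epsilon>)) \<longlongrightarrow> ennreal (m * (\<kappa> * L))) (at_right 0)"
    by (rule tendsto_ennrealI[OF lim])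
  moreover have "eventually (\<lambda>\<epsilon>. ennreal (enn2real (G \<epsilon>) / - ln \<epsilon>) = ennreal (1 / \<bar>ln \<epsilon>\<bar>) * G \<epsilon>) (at_right 0)"
    using eventually_at_right_0_unit
  proof eventually_elim
    case (elim \<epsilon>)
    then have l: "ln \<epsilon> < 0" by simp
    have "ennreal (1 / \<bar>ln \<epsilon>\<bar>) * G \<epsilon> = ennreal (1 / \<bar>ln \<epsilon>\<bar>) * ennreal (enn2real (G \<epsilon>))"
      using fin[of \<epsilon>] elim by simp
    also have "\<dots> = ennreal (1 / \<bar>ln \<epsilon>\<bar> * enn2real (G \<epsilon>))" by (intro ennreal_mult[symmetric]) auto
    also have "1 / \<bar>ln \<epsilon>\<bar> * enn2real (G \<epsilon>) = enn2real (G \<epsilon>) / - ln \<epsilon>" using l by simp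
    finally show ?case by simp
  qed
  ultimately show ?thesis unfolding G_def by (rule Lim_transform_eventually)
qed

end

section \<open>Borel representatives and the theorem\<close>

lemma borel_representative_real:
  fixes f :: "'a::euclidean_space \<Rightarrow> real"
  assumes "f \<in> borel_measurable lebesgue"
  shows "\<exists>g\<in>borel_measurable borel. AE x in lborel. f x = g x"
proof -
  obtain g where "g \<in> borel_measurable lborel" "AE x in lborel. f x = g x"
    using completion_ex_borel_measurable_real[OF assms] by blast
  then show ?thesis by (intro bexI[of _ g]) simp_all
qed

lemma borel_representative:
  fixes f :: "'a::euclidean_space \<Rightarrow> 'b::euclidean_space"
  assumes [measurable]: "f \<in> borel_measurable lebesgue"
  shows "\<exists>g\<in>borel_measurable borel. AE x in lborel. f x = g x"
proof -
  have "\<exists>g\<in>borel_measurable borel. AE x in lborel. f x \<bullet> i = g x" for i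
    by (rule borel_representative_real) measurable
  then obtain g where g: "\<And>i. g i \<in> borel_measurable borel" "\<And>i. AE x in lborel. f x \<bullet> i = g i x"
    by metis
  have "AE x in lborel. \<forall>i\<in>Basis. f x \<bullet> i = g i x"
    using g(2) by (intro AE_finite_allI) auto
  then have "AE x in lborel. f x = (\<Sum>i\<in>Basis. g i x *\<^sub>R i)"
  proof eventually_elim
    case (elim x)
    then have "(\<Sum>i\<in>Basis. g i x *\<^sub>R i) = (\<Sum>i\<in>Basis. (f x \<bullet> i) *\<^sub>R i)" by (intro sum.cong) auto
    then show ?case by (simp add: euclidean_representation)
  qed
  moreover have "(\<lambda>x. \<Sum>i\<in>Basis. g i x *\<^sub>R i) \<in> borel_measurable borel"
    using g(1) by measurable
  ultimately show ?thesis by (rule bexI[where x = "\<lambda>x. \<Sum>i\<in>Basis. g i x *\<^sub>R i"])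
qed

lemma borel_representative_set:
  fixes E :: "'a::euclidean_space set"
  assumes "E \<in> sets lebesgue"
  shows "\<exists>E'\<in>sets borel. AE x in lborel. x \<in> E \<longleftrightarrow> x \<in> E'"
proof -
  have "indicat_real E \<in> borel_measurable lebesgue" using assms by simp
  then obtain g where g: "g \<in> borel_measurable borel" "AE x in lborel. indicat_real E x = g x"
    using borel_representative_real by blast
  have "{x. g x = 1} \<in> sets borel" using g(1) by measurable
  moreover have "AE x in lborel. x \<in> E \<longleftrightarrow> x \<in> {x. g x = 1}"
    using g(2) by eventually_elim (auto simp: indicator_def split: if_splits)
  ultimately show ?thesis by blast
qed

lemma AE_lborel_affine:
  fixes P :: "'a::euclidean_space \<Rightarrow> bool"
  assumes P: "AE y in lborel. P y" and c: "c \<noteq> 0"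
  shows "AE z in lborel. P (x + c *\<^sub>R z)"
proof -
  have "AE y in density (distr lborel borel (\<lambda>z. x + c *\<^sub>R z)) (\<lambda>_. ennreal (\<bar>c\<bar> ^ DIM('a))). P y"
    using P unfolding lborel_affine[OF c, symmetric] by simp
  then have "AE y in distr lborel borel (\<lambda>z. x + c *\<^sub>R z). P y"
    using c by (subst (asm) AE_density) auto
  then show ?thesis by (rule AE_distrD[rotated]) simp
qed

text \<open>Composition with an affine bijection preserves Lebesgue measurability, which composition with a general Borel map does not.\<close>

lemma lebesgue_measurable_compose_affine:
  fixes u :: "'a::euclidean_space \<Rightarrow> 'b::euclidean_space"
  assumes [measurable]: "u \<in> borel_measurable lebesgue" and c: "c \<noteq> 0"
  shows "(\<lambda>z. u (x + c *\<^sub>R z)) \<in> borel_measurable lebesgue"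
proof -
  have "(\<lambda>z. x + (\<Sum>j\<in>Basis. (c * (z \<bullet> j)) *\<^sub>R j)) \<in> lebesgue \<rightarrow>\<^sub>M lebesgue"
    by (rule lebesgue_affine_measurable) (use c in auto)
  moreover have "(\<lambda>z. x + (\<Sum>j\<in>Basis. (c * (z \<bullet> j)) *\<^sub>R j)) = (\<lambda>z. x + c *\<^sub>R z)"
    by (simp add: scaleR_sum_right[symmetric] euclidean_representation flip: scaleR_scaleR)
  ultimately have "(\<lambda>z. x + c *\<^sub>R z) \<in> lebesgue \<rightarrow>\<^sub>M lebesgue" by simp
  then show ?thesis by measurable
qed

text \<open>For each \<open>x\<close> the map \<open>z \<mapsto> x - \<epsilon> z\<close> preserves null sets, so the equality holds at every point \<open>x\<close>, also where the integral
  does not exist.\<close>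

lemma rescaled_conv_eq_mollify:
  fixes u u' :: "'a::euclidean_space \<Rightarrow> 'b::euclidean_space"
  assumes [measurable]: "u \<in> borel_measurable lebesgue" "\<eta> \<in> borel_measurable lebesgue"
    "u' \<in> borel_measurable borel" "\<eta>' \<in> borel_measurable borel"
    and ae: "AE x in lborel. u x = u' x" "AE x in lborel. \<eta> x = \<eta>' x" and \<epsilon>: "0 < \<epsilon>"
  shows "rescaled_conv \<eta> u \<epsilon> = mollify \<eta>' \<epsilon> u'"
proof (rule ext)
  fix x
  have "(\<lambda>z. u (x + (- \<epsilon>) *\<^sub>R z)) \<in> borel_measurable lebesgue"
    using \<epsilon> by (intro lebesgue_measurable_compose_affine) auto
  then have [measurable]: "(\<lambda>z. u (x - \<epsilon> *\<^sub>R z)) \<in> borel_measurable lebesgue" by simp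
  have m: "(\<lambda>z. \<eta>' z *\<^sub>R u' (x - \<epsilon> *\<^sub>R z)) \<in> borel_measurable lborel" by measurable
  have "AE z in lborel. u (x + (- \<epsilon>) *\<^sub>R z) = u' (x + (- \<epsilon>) *\<^sub>R z)"
    using \<epsilon> by (intro AE_lborel_affine[OF ae(1)]) auto
  with ae(2) have "AE z in lborel. \<eta> z *\<^sub>R u (x - \<epsilon> *\<^sub>R z) = \<eta>' z *\<^sub>R u' (x - \<epsilon> *\<^sub>R z)"
    by eventually_elim simp
  then have "AE z in lebesgue. \<eta> z *\<^sub>R u (x - \<epsilon> *\<^sub>R z) = \<eta>' z *\<^sub>R u' (x - \<epsilon> *\<^sub>R z)"
    by (rule AE_completion)
  then have "rescaled_conv \<eta> u \<epsilon> x = (LINT z|lebesgue. \<eta>' z *\<^sub>R u' (x - \<epsilon> *\<^sub>R z))"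
    unfolding rescaled_conv_def
  proof (rule integral_cong_AE[rotated 2])
    show "(\<lambda>z. \<eta>' z *\<^sub>R u' (x - \<epsilon> *\<^sub>R z)) \<in> borel_measurable lebesgue" using m by (rule measurable_completion)
  qed measurable
  also have "\<dots> = mollify \<eta>' \<epsilon> u' x"
    unfolding mollify_def using m by (rule integral_completion)
  finally show "rescaled_conv \<eta> u \<epsilon> x = mollify \<eta>' \<epsilon> u' x" .
qed

lemma Lq_powr_fdiff_besov:
  fixes u u' :: "'a::euclidean_space \<Rightarrow> 'b::euclidean_space"
  assumes u: "u \<in> besov_space r q" and ae: "AE x in lborel. u x = u' x" and q: "1 \<le> q"
  shows "Lq_powr q u' < \<infinity>"
    and "\<exists>C\<ge>0. \<forall>h. Lq_powr q (fdiff h u') \<le> ennreal (C * norm h powr (r * q))"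
proof -
  let ?Q = "\<lambda>h x. ennreal (norm (u (x + h) - u x) powr q / norm h powr (r * q))"
  have "Lq_powr q u' = (\<integral>\<^sup>+x. ennreal (norm (u x) powr q) \<partial>lebesgue)"
    unfolding Lq_powr_def nn_integral_completion
    using ae by (intro nn_integral_cong_AE) (auto elim: eventually_mono)
  then show "Lq_powr q u' < \<infinity>" using u by (simp add: besov_space_def)
  define s where "s = (SUP h \<in> UNIV - {0}.
      \<integral>\<^sup>+x. ?Q h x \<partial>lebesgue)"
  have s: "s = ennreal (enn2real s)" using u by (simp add: besov_space_def s_def less_top)
  have "Lq_powr q (fdiff h u') \<le> ennreal (enn2real s * norm h powr (r * q))" for h
  proof (cases "h = 0")
    case True
    then show ?thesis using q by (simp add: Lq_powr_def fdiff_def)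
  next
    case False
    have "(\<integral>\<^sup>+x. ?Q h x \<partial>lebesgue) \<le> s"
      unfolding s_def using False by (intro SUP_upper) auto
    then have "(\<integral>\<^sup>+x. ?Q h x \<partial>lborel) * ennreal (norm h powr (r * q))
        \<le> s * ennreal (norm h powr (r * q))"
      unfolding nn_integral_completion by (rule mult_right_mono) simp
    also have "\<dots> = ennreal (enn2real s * norm h powr (r * q))"
      by (subst s) (simp add: ennreal_mult)
    finally have le: "(\<integral>\<^sup>+x. ?Q h x \<partial>lborel) * ennreal (norm h powr (r * q))
        \<le> ennreal (enn2real s * norm h powr (r * q))" .
    have "AE x in lborel. u (x + h) = u' (x + h)" using ae by (rule AE_lborel_shift)
    with ae have "AE x in lborel. fdiff h u' x = u (x + h) - u x"
      by eventually_elim (simp add: fdiff_def)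
    then have "Lq_powr q (fdiff h u') = (\<integral>\<^sup>+x. ennreal (norm (u (x + h) - u x) powr q) \<partial>lborel)"
      unfolding Lq_powr_def by (intro nn_integral_cong_AE) (auto elim: eventually_mono)
    also have "\<dots> = (\<integral>\<^sup>+x. ?Q h x * ennreal (norm h powr (r * q)) \<partial>lborel)"
      using False by (intro nn_integral_cong) (simp add: ennreal_mult[symmetric])
    also have "\<dots> = (\<integral>\<^sup>+x. ?Q h x \<partial>lborel) * ennreal (norm h powr (r * q))"
    proof -
      have um: "u \<in> borel_measurable lebesgue" using u by (simp add: besov_space_def)
      then have "(\<lambda>x. u (h + 1 *\<^sub>R x)) \<in> borel_measurable lebesgue" by (rule lebesgue_measurable_compose_affine) simp
      then have [measurable]: "(\<lambda>x. u (x + h)) \<in> borel_measurable lebesgue" by (simp add: add.commute)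
      note um[measurable]
      have "(\<integral>\<^sup>+x. ?Q h x * ennreal (norm h powr (r * q)) \<partial>lebesgue) =
          (\<integral>\<^sup>+x. ?Q h x \<partial>lebesgue) * ennreal (norm h powr (r * q))"
        by (rule nn_integral_multc) measurable
      then show ?thesis by (simp add: nn_integral_completion)
    qed
    finally show ?thesis using le by simp
  qed
  then show "\<exists>C\<ge>0. \<forall>h. Lq_powr q (fdiff h u') \<le> ennreal (C * norm h powr (r * q))"
    by (intro exI[of _ "enn2real s"]) auto
qed

lemma nn_integral_lborel_recenter:
  fixes f :: "'a::euclidean_space \<Rightarrow> ennreal"
  assumes [measurable]: "f \<in> borel_measurable borel"
  shows "(\<integral>\<^sup>+y. f y \<partial>lborel) = (\<integral>\<^sup>+h. f (x + h) \<partial>lborel)"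
  using nn_integral_lborel_shift[OF assms, of x, symmetric] by (simp only: add.commute)

text \<open>Substitution \<open>x = y + h\<close> and Tonelli.\<close>

lemma gagliardo_seminorm_eq_energy:
  fixes w :: "'a::euclidean_space \<Rightarrow> 'b::euclidean_space"
  assumes [measurable]: "E' \<in> sets borel" "w \<in> borel_measurable borel"
    and ae: "AE x in lborel. x \<in> E \<longleftrightarrow> x \<in> E'" and q: "1 \<le> q"
  shows "enn_powr (gagliardo_seminorm r q E w) q = gagliardo_energy r q E' UNIV w"
proof -
  let ?P = "real DIM('a) + r * q"
  let ?K = "\<lambda>x y. ennreal (norm (w x - w y) powr q / norm (x - y) powr ?P)"
  let ?J = "\<lambda>y h. ennreal (norm (w (y + h) - w y) powr q / norm h powr ?P) * indicator E' (y + h) * indicator E' y"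
  let ?D = "\<lambda>y h. ennreal (indicat_real E' y * indicat_real E' (y + h) * norm (w (y + h) - w y) powr q)"
  define X where "X = (\<integral>\<^sup>+y\<in>E. (\<integral>\<^sup>+x\<in>E. ?K x y \<partial>lebesgue) \<partial>lebesgue)"
  have "enn_powr (enn_powr X (1 / q)) q = X"
    using q by (cases X rule: ennreal_cases) (auto simp: enn_powr_def powr_powr)
  then have "enn_powr (gagliardo_seminorm r q E w) q = X"
    by (simp add: gagliardo_seminorm_def X_def)
  also have "X = (\<integral>\<^sup>+y. (\<integral>\<^sup>+x. ?K x y * indicator E' x \<partial>lborel) * indicator E' y \<partial>lborel)"
    unfolding X_def nn_integral_completion
  proof (rule nn_integral_cong_AE, use ae in eventually_elim)
    fix y assume y: "y \<in> E \<longleftrightarrow> y \<in> E'"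
    have "(\<integral>\<^sup>+x. ?K x y * indicator E x \<partial>lborel) =
        (\<integral>\<^sup>+x. ?K x y * indicator E' x \<partial>lborel)"
      by (rule nn_integral_cong_AE, use ae in eventually_elim) (simp split: split_indicator)
    then show "(\<integral>\<^sup>+x. ?K x y * indicator E x \<partial>lborel) * indicator E y =
        (\<integral>\<^sup>+x. ?K x y * indicator E' x \<partial>lborel) * indicator E' y"
      using y by (simp split: split_indicator)
  qed
  also have "\<dots> = (\<integral>\<^sup>+y. (\<integral>\<^sup>+h. ?J y h \<partial>lborel) \<partial>lborel)"
  proof (rule nn_integral_cong)
    fix y
    have "(\<integral>\<^sup>+x. ?K x y * indicator E' x \<partial>lborel) =
        (\<integral>\<^sup>+h. ennreal (norm (w (y + h) - w y) powr q / norm (y + h - y) powr ?P) * indicator E' (y + h) \<partial>lborel)"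
      by (rule nn_integral_lborel_recenter) measurable
    then show "(\<integral>\<^sup>+x. ?K x y * indicator E' x \<partial>lborel) * indicator E' y =
        (\<integral>\<^sup>+h. ?J y h \<partial>lborel)"
      by (simp add: nn_integral_multc)
  qed
  also have "\<dots> = (\<integral>\<^sup>+h. (\<integral>\<^sup>+y. ?J y h \<partial>lborel) \<partial>lborel)"
    by (rule lborel_pair.Fubini'[symmetric]) measurable
  also have "\<dots> = gagliardo_energy r q E' UNIV w"
    unfolding gagliardo_energy_def pair_energy_def
  proof (rule nn_integral_cong)
    fix h :: 'a
    have "(\<integral>\<^sup>+y. ?J y h \<partial>lborel) =
        (\<integral>\<^sup>+y. ?D y h * ennreal (1 / norm h powr ?P) \<partial>lborel)"
      by (intro nn_integral_cong) (auto simp: ennreal_mult[symmetric] split: split_indicator)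
    also have "\<dots> = (\<integral>\<^sup>+y. ?D y h \<partial>lborel) * ennreal (1 / norm h powr ?P)"
      by (rule nn_integral_multc) measurable
    finally show "(\<integral>\<^sup>+y. ?J y h \<partial>lborel) =
        (\<integral>\<^sup>+y. ?D y h \<partial>lborel) *
        (ennreal (1 / norm h powr ?P) * indicator UNIV h)" by simp
  qed
  finally show ?thesis .
qed

lemma ball_functional_eq_energy:
  fixes u u' :: "'a::euclidean_space \<Rightarrow> 'b::euclidean_space"
  assumes [measurable]: "E' \<in> sets borel" "u' \<in> borel_measurable borel"
    and aeE: "AE x in lborel. x \<in> E \<longleftrightarrow> x \<in> E'" and aeu: "AE x in lborel. u x = u' x" and \<epsilon>: "0 < \<epsilon>"
  shows "ball_functional r q E u \<epsilon> = ball_energy r q E' u' \<epsilon>"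
proof -
  let ?p = "r * q" and ?e = "1 / \<epsilon> ^ DIM('a)"
  let ?A = "\<lambda>x y. ennreal (norm (u' x - u' y) powr q / norm (x - y) powr ?p) * (indicator E' y * (if dist x y < \<epsilon> then 1 else 0))"
  let ?B = "\<lambda>x h. ennreal (norm (u' (x + h) - u' x) powr q / norm h powr ?p) * (indicator E' (x + h) * indicator (ball 0 \<epsilon>) h)"
  let ?D = "\<lambda>x h. ennreal (indicat_real E' x * indicat_real E' (x + h) * norm (u' (x + h) - u' x) powr q)"
  let ?k = "\<lambda>h. ennreal (?e * (1 / norm h powr ?p)) * indicator (ball 0 \<epsilon>) h"
  have [measurable]: "ball (0::'a) \<epsilon> \<in> sets borel" by simp
  have "ball_functional r q E u \<epsilon> = (\<integral>\<^sup>+x. ennreal ?e * (\<integral>\<^sup>+y. ?A x y \<partial>lborel) * indicator E' x \<partial>lborel)"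
    unfolding ball_functional_def nn_integral_completion
  proof (rule nn_integral_cong_AE, use aeE aeu in eventually_elim)
    fix x assume x: "x \<in> E \<longleftrightarrow> x \<in> E'" "u x = u' x"
    have "(\<integral>\<^sup>+y. ennreal (norm (u x - u y) powr q / norm (x - y) powr ?p) * indicator (E \<inter> ball x \<epsilon>) y \<partial>lborel) =
        (\<integral>\<^sup>+y. ?A x y \<partial>lborel)"
      by (rule nn_integral_cong_AE, use aeE aeu in eventually_elim) (use x in \<open>auto split: split_indicator\<close>)
    then show "ennreal ?e * (\<integral>\<^sup>+y. ennreal (norm (u x - u y) powr q / norm (x - y) powr ?p) * indicator (E \<inter> ball x \<epsilon>) y \<partial>lborel) * indicator E x =
        ennreal ?e * (\<integral>\<^sup>+y. ?A x y \<partial>lborel) * indicator E' x"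
      using x by (simp split: split_indicator)
  qed
  also have "\<dots> = (\<integral>\<^sup>+x. (\<integral>\<^sup>+h. ennreal ?e * (?B x h) * indicator E' x \<partial>lborel) \<partial>lborel)"
  proof (rule nn_integral_cong)
    fix x
    have "(\<integral>\<^sup>+y. ?A x y \<partial>lborel) =
        (\<integral>\<^sup>+h. ennreal (norm (u' x - u' (x + h)) powr q / norm (x - (x + h)) powr ?p) * (indicator E' (x + h) * (if dist x (x + h) < \<epsilon> then 1 else 0)) \<partial>lborel)"
      by (rule nn_integral_lborel_recenter) measurable
    also have "\<dots> = (\<integral>\<^sup>+h. ?B x h \<partial>lborel)"
      by (intro nn_integral_cong) (auto simp: dist_norm norm_minus_commute split: split_indicator)
    finally have eq: "(\<integral>\<^sup>+y. ?A x y \<partial>lborel) =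
        (\<integral>\<^sup>+h. ?B x h \<partial>lborel)" .
    have m: "(\<lambda>h. ?B x h) \<in> borel_measurable lborel"
      by measurable
    have m2: "(\<lambda>h. ennreal ?e * (?B x h)) \<in> borel_measurable lborel"
      by measurable
    show "ennreal ?e * (\<integral>\<^sup>+y. ?A x y \<partial>lborel) * indicator E' x =
        (\<integral>\<^sup>+h. ennreal ?e * (?B x h) * indicator E' x \<partial>lborel)"
      by (simp only: eq nn_integral_cmult[OF m] nn_integral_multc[OF m2])
  qed
  also have "\<dots> = (\<integral>\<^sup>+h. (\<integral>\<^sup>+x. ennreal ?e * (?B x h) * indicator E' x \<partial>lborel) \<partial>lborel)"
    by (rule lborel_pair.Fubini'[symmetric]) measurable
  also have "\<dots> = ball_energy r q E' u' \<epsilon>"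
    unfolding ball_energy_def pair_energy_def
  proof (rule nn_integral_cong)
    fix h :: 'a
    have "(\<integral>\<^sup>+x. ennreal ?e * (?B x h) * indicator E' x \<partial>lborel) =
        (\<integral>\<^sup>+x. ?D x h * ?k h \<partial>lborel)"
    proof (rule nn_integral_cong)
      fix x
      have "ennreal ?e * ennreal (norm (u' (x + h) - u' x) powr q / norm h powr ?p) =
          ennreal (?e * (norm (u' (x + h) - u' x) powr q / norm h powr ?p))"
        by (rule ennreal_mult[symmetric]) (use \<epsilon> in simp_all)
      also have "?e * (norm (u' (x + h) - u' x) powr q / norm h powr ?p) =
          norm (u' (x + h) - u' x) powr q * (?e * (1 / norm h powr ?p))"
        by (simp add: mult.commute)
      also have "ennreal \<dots> = ennreal (norm (u' (x + h) - u' x) powr q) * ennreal (?e * (1 / norm h powr ?p))"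
        by (rule ennreal_mult) (use \<epsilon> in simp_all)
      finally have eq: "ennreal ?e * ennreal (norm (u' (x + h) - u' x) powr q / norm h powr ?p) =
          ennreal (norm (u' (x + h) - u' x) powr q) * ennreal (?e * (1 / norm h powr ?p))" .
      show "ennreal ?e * (?B x h) * indicator E' x =
          ?D x h * ?k h"
        by (cases "x \<in> E'"; cases "x + h \<in> E'"; cases "h \<in> ball 0 \<epsilon>")
           (simp_all only: indicator_simps simp_thms eq if_True if_False mult_1_left mult_1_right mult_zero_left mult_zero_right ennreal_0)
    qed
    also have "\<dots> = (\<integral>\<^sup>+x. ?D x h \<partial>lborel) *
        ?k h"
      by (rule nn_integral_multc) measurable
    finally show "(\<integral>\<^sup>+x. ennreal ?e * (?B x h) * indicator E' x \<partial>lborel) =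
        (\<integral>\<^sup>+x. ?D x h \<partial>lborel) *
        ?k h" .
  qed
  finally show ?thesis .
qed

lemma sphere_functional_eq_energy:
  fixes u u' :: "'a::euclidean_space \<Rightarrow> 'b::euclidean_space"
  assumes [measurable]: "E' \<in> sets borel" "u' \<in> borel_measurable borel"
    and aeE: "AE x in lborel. x \<in> E \<longleftrightarrow> x \<in> E'" and aeu: "AE x in lborel. u x = u' x" and \<epsilon>: "0 < \<epsilon>"
  shows "sphere_functional r q E u \<epsilon> = sphere_energy r q E' u' \<epsilon>"
proof -
  let ?p = "r * q"
  have inner: "(\<integral>\<^sup>+x\<in>E. ennreal (indicat_real E (x + \<epsilon> *\<^sub>R n) * (norm (u (x + \<epsilon> *\<^sub>R n) - u x) powr q / \<epsilon> powr ?p)) \<partial>lebesgue) =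
      ennreal (1 / \<epsilon> powr ?p) * pair_energy q E' u' (\<epsilon> *\<^sub>R n)" for n
  proof -
    have a1: "AE x in lborel. x + \<epsilon> *\<^sub>R n \<in> E \<longleftrightarrow> x + \<epsilon> *\<^sub>R n \<in> E'" using aeE by (rule AE_lborel_shift)
    have a2: "AE x in lborel. u (x + \<epsilon> *\<^sub>R n) = u' (x + \<epsilon> *\<^sub>R n)" using aeu by (rule AE_lborel_shift)
    have "(\<integral>\<^sup>+x\<in>E. ennreal (indicat_real E (x + \<epsilon> *\<^sub>R n) * (norm (u (x + \<epsilon> *\<^sub>R n) - u x) powr q / \<epsilon> powr ?p)) \<partial>lebesgue) =
        (\<integral>\<^sup>+x. ennreal (1 / \<epsilon> powr ?p) * ennreal (indicat_real E' x * indicat_real E' (x + \<epsilon> *\<^sub>R n) * norm (u' (x + \<epsilon> *\<^sub>R n) - u' x) powr q) \<partial>lborel)"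
      unfolding nn_integral_completion
      by (intro nn_integral_cong_AE, use aeE aeu a1 a2 in eventually_elim)
         (auto simp: ennreal_mult[symmetric] split: split_indicator)
    also have "\<dots> = ennreal (1 / \<epsilon> powr ?p) * pair_energy q E' u' (\<epsilon> *\<^sub>R n)"
      unfolding pair_energy_def by (rule nn_integral_cmult) measurable
    finally show ?thesis .
  qed
  have "sphere_functional r q E u \<epsilon> = (\<integral>\<^sup>+n. ennreal (1 / \<epsilon> powr ?p) * pair_energy q E' u' (\<epsilon> *\<^sub>R n) \<partial>hausdorff_sphere)"
    unfolding sphere_functional_def inner by (rule nn_integral_hausdorff_sphere[symmetric]) measurable
  also have "\<dots> = sphere_energy r q E' u' \<epsilon>"
    unfolding sphere_energy_def by (rule nn_integral_cmult) measurable
  finally show ?thesis .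
qed

text \<open>The limit of the ball functional passes through the \<open>q\<close>-th root, so the upper limit in the seminorm is a limit.\<close>

lemma enn_powr_Limsup:
  assumes lim: "(f \<longlongrightarrow> l) (at_right (0::real))" and l: "l < \<infinity>" and q: "1 \<le> q"
  shows "enn_powr (Limsup (at_right 0) (\<lambda>\<epsilon>. enn_powr (f \<epsilon>) (1 / q))) q = l"
proof -
  define c where "c = enn2real l"
  have c: "l = ennreal c" "0 \<le> c" using l by (auto simp: c_def less_top)
  have "((\<lambda>\<epsilon>. enn2real (f \<epsilon>)) \<longlongrightarrow> c) (at_right 0)"
    using lim c by (intro tendsto_enn2real) auto
  then have "((\<lambda>\<epsilon>. enn2real (f \<epsilon>) powr (1 / q)) \<longlongrightarrow> c powr (1 / q)) (at_right 0)"
    using q by (intro tendsto_powr'[OF _ tendsto_const]) auto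
  then have "((\<lambda>\<epsilon>. ennreal (enn2real (f \<epsilon>) powr (1 / q))) \<longlongrightarrow> ennreal (c powr (1 / q))) (at_right 0)"
    by (rule tendsto_ennrealI)
  moreover have "eventually (\<lambda>\<epsilon>. ennreal (enn2real (f \<epsilon>) powr (1 / q)) = enn_powr (f \<epsilon>) (1 / q)) (at_right 0)"
    using order_tendstoD(2)[OF lim l] by eventually_elim (auto simp: enn_powr_def)
  ultimately have "((\<lambda>\<epsilon>. enn_powr (f \<epsilon>) (1 / q)) \<longlongrightarrow> ennreal (c powr (1 / q))) (at_right 0)"
    by (rule Lim_transform_eventually)
  then have "Limsup (at_right 0) (\<lambda>\<epsilon>. enn_powr (f \<epsilon>) (1 / q)) = ennreal (c powr (1 / q))"
    by (intro lim_imp_Limsup) (auto simp: trivial_limit_at_right_real)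
  then show ?thesis using c q by (simp add: enn_powr_def powr_powr)
qed

theorem corollary7p4:
  fixes q r :: real
    and u :: "real ^ 'n \<Rightarrow> real ^ 'd"
    and E :: "(real ^ 'n) set"
    and \<eta> :: "real ^ 'n \<Rightarrow> real"
  assumes "1 \<le> q"
    and "0 < r" and "r < 1"
    and "u \<in> besov_space r q"
    and "E \<in> sets lebesgue"
    and "\<eta> \<in> sobolev_W11"
    and "\<exists>L. (sphere_functional r q E u \<longlongrightarrow> L) (at_right 0)"
  shows "\<exists>l. l < \<infinity> \<and> (ball_functional r q E u \<longlongrightarrow> l) (at_right 0) \<and>
    ((\<lambda>\<epsilon>. ennreal (1 / \<bar>ln \<epsilon>\<bar>) * enn_powr (gagliardo_seminorm r q E (rescaled_conv \<eta> u \<epsilon>)) q)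
      \<longlongrightarrow> ennreal (real CARD('n) * \<bar>LINT z|lebesgue. \<eta> z\<bar> powr q) * l) (at_right 0) \<and>
    ennreal (real CARD('n) * \<bar>LINT z|lebesgue. \<eta> z\<bar> powr q) * l =
      ennreal (real CARD('n) * \<bar>LINT z|lebesgue. \<eta> z\<bar> powr q) * enn_powr (upper_B_seminorm r q E u) q"
proof -
  have um: "u \<in> borel_measurable lebesgue" using assms(4) by (simp add: besov_space_def)
  have \<eta>i: "integrable lebesgue \<eta>" using assms(6) by (simp add: sobolev_W11_def)
  then have \<eta>m: "\<eta> \<in> borel_measurable lebesgue" by simp
  obtain u' where u'[measurable]: "u' \<in> borel_measurable borel" and aeu: "AE x in lborel. u x = u' x"
    using borel_representative[OF um] by blast
  obtain \<eta>' where \<eta>'[measurable]: "\<eta>' \<in> borel_measurable borel" and ae\<eta>: "AE x in lborel. \<eta> x = \<eta>' x"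
    using borel_representative[OF \<eta>m] by blast
  obtain E' where E'[measurable]: "E' \<in> sets borel" and aeE: "AE x in lborel. x \<in> E \<longleftrightarrow> x \<in> E'"
    using borel_representative_set[OF assms(5)] by blast
  have ae\<eta>': "AE x in lebesgue. \<eta> x = \<eta>' x" using ae\<eta> by (rule AE_completion)
  have \<eta>'l: "\<eta>' \<in> borel_measurable lebesgue" using \<eta>' by (intro measurable_completion) simp
  have "integrable lebesgue \<eta>'" using \<eta>i ae\<eta>' \<eta>m \<eta>'l by (subst integrable_cong_AE[symmetric]) auto
  then have \<eta>'i: "integrable lborel \<eta>'" using \<eta>' by (simp add: integrable_completion)
  have "(LINT z|lebesgue. \<eta> z) = (LINT z|lebesgue. \<eta>' z)"
    using ae\<eta>' \<eta>m \<eta>'l by (intro integral_cong_AE) auto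
  also have "\<dots> = (LINT z|lborel. \<eta>' z)" using \<eta>' by (intro integral_completion) simp
  finally have mean: "(LINT z|lebesgue. \<eta> z) = (LINT z|lborel. \<eta>' z)" .
  obtain M where M: "0 \<le> M" "\<And>k. (\<integral>\<^sup>+x. ennreal \<bar>\<eta>' (x + k) - \<eta>' x\<bar> \<partial>lborel) \<le> ennreal (M * norm k)"
    using sobolev_L1_translation_le[OF assms(6) \<eta>' ae\<eta>'] by blast
  obtain C where C: "0 \<le> C" "\<And>h. Lq_powr q (fdiff h u') \<le> ennreal (C * norm h powr (r * q))"
    using Lq_powr_fdiff_besov(2)[OF assms(4) aeu assms(1)] by blast
  interpret mollified_besov q r C M u' \<eta>'
    using assms(1-3) u' Lq_powr_fdiff_besov(1)[OF assms(4) aeu assms(1)] C M \<eta>'i by unfold_locales auto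
  obtain \<kappa> where \<kappa>: "0 < \<kappa>" "\<And>f :: real ^ 'n \<Rightarrow> ennreal. f \<in> borel_measurable borel \<Longrightarrow> (\<integral>\<^sup>+x. f x \<partial>lborel) =
      (\<integral>\<^sup>+\<rho>. (\<integral>\<^sup>+n. f (\<rho> *\<^sub>R n) \<partial>hausdorff_sphere) * (ennreal (\<kappa> * \<rho> ^ (DIM(real ^ 'n) - 1)) * indicator {0<..} \<rho>) \<partial>lborel)"
    using nn_integral_polar[where 'a="real ^ 'n"] by blast
  obtain L0 where L0: "(sphere_functional r q E u \<longlongrightarrow> L0) (at_right 0)" using assms(7) by blast
  have "eventually (\<lambda>\<epsilon>. sphere_functional r q E u \<epsilon> = sphere_energy r q E' u' \<epsilon>) (at_right 0)"
    using eventually_at_right_0_unit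
    by eventually_elim (simp add: sphere_functional_eq_energy[OF E' u' aeE aeu])
  with L0 have lim0: "(sphere_energy r q E' u' \<longlongrightarrow> L0) (at_right 0)" by (rule Lim_transform_eventually)
  have fin: "emeasure (hausdorff_sphere :: (real ^ 'n) measure) UNIV < \<infinity>"
    using finite_measure.emeasure_finite[OF finite_hausdorff_sphere] by (simp add: less_top)
  \<comment> \<open>The Besov bound makes the sphere functional bounded, so its limit is finite.\<close>
  have "L0 \<le> ennreal C * emeasure (hausdorff_sphere :: (real ^ 'n) measure) UNIV"
  proof (rule tendsto_upperbound[OF lim0])
    show "eventually (\<lambda>\<epsilon>. sphere_energy r q E' u' \<epsilon> \<le> ennreal C * emeasure (hausdorff_sphere :: (real ^ 'n) measure) UNIV) (at_right 0)"
      using eventually_at_right_0_unit by eventually_elim (intro sphere_energy_bounded, simp)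
  qed (simp add: trivial_limit_at_right_real)
  also have "\<dots> < \<infinity>" using fin by (simp add: ennreal_mult_less_top)
  finally have "L0 < \<infinity>" .
  define L where "L = enn2real L0"
  have L: "0 \<le> L" "L0 = ennreal L" using \<open>L0 < \<infinity>\<close> by (auto simp: L_def less_top)
  interpret besov_energy q r C M u' \<eta>' E' \<kappa> L
    using E' \<kappa> L lim0 by unfold_locales auto
  let ?N = "real CARD('n)"
  let ?m = "\<bar>LINT z|lborel. \<eta>' z\<bar> powr q"
  define l where "l = ennreal (\<kappa> * L / ?N)"
  have N: "0 < ?N" by simp
  have ball: "(ball_functional r q E u \<longlongrightarrow> l) (at_right 0)"
  proof (rule Lim_transform_eventually)
    show "(ball_energy r q E' u' \<longlongrightarrow> l) (at_right 0)" using ball_energy_lim by (simp add: l_def)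
    show "eventually (\<lambda>\<epsilon>. ball_energy r q E' u' \<epsilon> = ball_functional r q E u \<epsilon>) (at_right 0)"
      using eventually_at_right_0_unit
      by eventually_elim (simp add: ball_functional_eq_energy[OF E' u' aeE aeu])
  qed
  have l: "l < \<infinity>" by (simp add: l_def)
  have value_eq: "ennreal (?N * ?m) * l = ennreal (?m * (\<kappa> * L))"
    unfolding l_def using N \<kappa>(1) L(1) by (subst ennreal_mult[symmetric]) auto
  have "((\<lambda>\<epsilon>. ennreal (1 / \<bar>ln \<epsilon>\<bar>) * enn_powr (gagliardo_seminorm r q E (rescaled_conv \<eta> u \<epsilon>)) q)
      \<longlongrightarrow> ennreal (?N * ?m) * l) (at_right 0)"
  proof (rule Lim_transform_eventually)
    show "((\<lambda>\<epsilon>. ennreal (1 / \<bar>ln \<epsilon>\<bar>) * gagliardo_energy r q E' UNIV (mollify \<eta>' \<epsilon> u')) \<longlongrightarrow> ennreal (?N * ?m) * l) (at_right 0)"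
      unfolding value_eq by (rule gagliardo_energy_lim)
    show "eventually (\<lambda>\<epsilon>. ennreal (1 / \<bar>ln \<epsilon>\<bar>) * gagliardo_energy r q E' UNIV (mollify \<eta>' \<epsilon> u') =
        ennreal (1 / \<bar>ln \<epsilon>\<bar>) * enn_powr (gagliardo_seminorm r q E (rescaled_conv \<eta> u \<epsilon>)) q) (at_right 0)"
      using eventually_at_right_0_unit
    proof eventually_elim
      case (elim \<epsilon>)
      then have "rescaled_conv \<eta> u \<epsilon> = mollify \<eta>' \<epsilon> u'"
        by (intro rescaled_conv_eq_mollify um \<eta>m u' \<eta>' aeu ae\<eta>) simp
      moreover have meas: "mollify \<eta>' \<epsilon> u' \<in> borel_measurable borel" by measurable
      ultimately show ?case
        using gagliardo_seminorm_eq_energy[OF E' meas aeE assms(1), of r] by simp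
    qed
  qed
  moreover have "enn_powr (upper_B_seminorm r q E u) q = l"
    unfolding upper_B_seminorm_def by (rule enn_powr_Limsup[OF ball l assms(1)])
  ultimately show ?thesis using ball l unfolding mean by (intro exI[of _ l]) simp
qed

end
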